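(* Suppose that there exists $\delta>0$ such that $\mathbb{E}[|Z_{ij}|^{4+\delta}]<+\infty$ and $\mathbb{E}[|\tilde z_j|^{4+\delta}]<+\infty$ for all $1\le i\le n$ and $1\le j\le p$, and that there exists $\gamma_{\max}>0$ such that $$\sup_{n\ge 1}\ \max_{1\le i\le n,\,1\le j\le p}\bigl\{|\gamma_{ij}^{(n)}|,|\tilde\gamma_j^{(n)}|\bigr\}<\gamma_{\max}.$$ Then for any $\lambda>0$, $$\lim_{n\to\infty,\ p/n\to c}\ \bigl|\widehat{df}_1(\lambda)-df_1(\lambda)\bigr|=0\quad\text{almost surely},$$ with $$df_1(\lambda)=\frac1p\operatorname{Tr}\bigl[\Sigma_n(\Sigma_n+\kappa(\lambda))^{-1}\bigr],$$ and $\kappa(\lambda)=\operatorname{diag}(\kappa_1(\lambda),\dots,\kappa_p(\lambda))$, where $$\kappa_j(\lambda)=\frac{\operatorname{Tr}[\widetilde D_j]}{\operatorname{Tr}[\widetilde D_j\widetilde T_n(-\lambda)]},\qquad 1\le j\le p.$$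
   Context: Asymptotic regime: $n\to\infty$ and $p/n\to c$ for some $c>0$. Design: $X_n=\Upsilon_n\circ Z_n\in\mathbb{R}^{n\times p}$, where $\circ$ is the Hadamard (entrywise) product, $\Upsilon_n=(\gamma_{ij}^{(n)})$ is a deterministic $n\times p$ matrix, and $Z_n=(Z_{ij})$ has i.i.d. centered entries with variance one. Write $\gamma_{ij}=\gamma_{ij}^{(n)}$; the matrix $\Gamma_n=(\gamma_{ij}^2)$ is called the variance profile. The test predictor is $\tilde x=\widetilde S_p^{1/2}\tilde z$, where $\tilde z=(\tilde z_j)\in\mathbb{R}^p$ is a random vector with i.i.d. centered entries with variance one and $\widetilde S_p=\mathbb{E}[\tilde x\tilde x^\top]=\operatorname{diag}(\tilde\gamma_1^2,\dots,\tilde\gamma_p^2)$, with $\tilde\gamma_j=\tilde\gamma_j^{(n)}$. Put $\widehat\Sigma_n=\frac1nX_n^\top X_n$ and $\Sigma_n=\mathbb{E}[\widehat\Sigma_n]=\frac1n\operatorname{diag}\bigl(\sum_{i=1}^n\gamma_{i1}^2,\dots,\sum_{i=1}^n\gamma_{ip}^2\bigr)$. The degrees of freedom of the ridge regression estimator with parameter $\lambda>0$ are $$\widehat{df}_1(\lambda)=\frac1p\operatorname{Tr}\bigl[\widehat\Sigma_n(\widehat\Sigma_n+\lambda I_p)^{-1}\bigr].$$ Let $D_i=\operatorname{diag}(\gamma_{i1}^2,\dots,\gamma_{ip}^2)$ for $1\le i\le n$ and $\widetilde D_j=\operatorname{diag}(\gamma_{1j}^2,\dots,\gamma_{nj}^2)$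 for $1\le j\le p$. For $z\in\mathbb{C}\setminus\mathbb{R}^+$, the diagonal matrices $T_p(z)=\operatorname{diag}(T_p^{(1)}(z),\dots,T_p^{(p)}(z))$ and $\widetilde T_n(z)=\operatorname{diag}(\widetilde T_n^{(1)}(z),\dots,\widetilde T_n^{(n)}(z))$ are those whose diagonal elements are the unique solutions of the deterministic system of $p+n$ equations $$T_p^{(j)}(z)=\frac{-1}{z\bigl(1+\frac1n\operatorname{Tr}[\widetilde D_j\widetilde T_n(z)]\bigr)},\qquad \widetilde T_n^{(i)}(z)=\frac{-1}{z\bigl(1+\frac1n\operatorname{Tr}[D_iT_p(z)]\bigr)},\qquad 1\le j\le p,\ 1\le i\le n.$$ Moreover, $\frac1p\operatorname{Tr}[T_p(z)]$ and $\frac1n\operatorname{Tr}[\widetilde T_n(z)]$ are Stieltjes transforms (with the convention $z\mapsto\int\frac{\mu(dt)}{t-z}$) of probability measures. *)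

theory Defs
  imports
    "HOL-Probability.Probability"
    "Jordan_Normal_Form.Gauss_Jordan_Elimination"
begin

text \<open>
  Matrices are those of \<open>Jordan_Normal_Form\<close>, because the dimensions n and p vary.
  Rows are indexed by \<open>i < n\<close> and columns by \<open>j < p\<close>, so the usual index pair (i, j)
  with \<open>1 \<le> i \<le> n\<close>, \<open>1 \<le> j \<le> p\<close> is written (i - 1, j - 1).
\<close>

definition mtrace :: "'a :: comm_monoid_add mat \<Rightarrow> 'a" where
  "mtrace A = (\<Sum>i<dim_row A. A $$ (i, i))"

text \<open>Meaningful for invertible A only; otherwise \<^const>\<open>mat_inverse\<close> yields \<^const>\<open>None\<close>.\<close>

definition minv :: "'a :: field mat \<Rightarrow> 'a mat" where
  "minv A = the (mat_inverse A)"

definition iid_standardized ::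
    "'w measure \<Rightarrow> real measure \<Rightarrow> 'i set \<Rightarrow> ('i \<Rightarrow> 'w \<Rightarrow> real) \<Rightarrow> bool" where
  "iid_standardized M L I X \<longleftrightarrow>
     prob_space.indep_vars M (\<lambda>_. borel) X I \<and>
     (\<forall>i\<in>I. distr M borel (X i) = L \<and>
        integrable M (\<lambda>\<omega>. (X i \<omega>)\<^sup>2) \<and>
        prob_space.expectation M (X i) = 0 \<and>
        prob_space.variance M (X i) = 1)"


subsection \<open>Sample covariance and degrees of freedom\<close>

definition design :: "nat \<Rightarrow> nat \<Rightarrow> (nat \<Rightarrow> nat \<Rightarrow> real) \<Rightarrow> (nat \<Rightarrow> nat \<Rightarrow> real) \<Rightarrow> real mat" where
  "design n p \<gamma> Z = mat n p (\<lambda>(i, j). \<gamma> i j * Z i j)"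

definition Sigma_hat :: "nat \<Rightarrow> nat \<Rightarrow> (nat \<Rightarrow> nat \<Rightarrow> real) \<Rightarrow> (nat \<Rightarrow> nat \<Rightarrow> real) \<Rightarrow> real mat" where
  "Sigma_hat n p \<gamma> Z =
     (1 / real n) \<cdot>\<^sub>m (transpose_mat (design n p \<gamma> Z) * design n p \<gamma> Z)"

definition Sigma_mean ::
    "'w measure \<Rightarrow> nat \<Rightarrow> nat \<Rightarrow> (nat \<Rightarrow> nat \<Rightarrow> real) \<Rightarrow> (nat \<Rightarrow> nat \<Rightarrow> 'w \<Rightarrow> real) \<Rightarrow> real mat" where
  "Sigma_mean M n p \<gamma> Z =
     mat p p (\<lambda>jk. prob_space.expectation M (\<lambda>\<omega>. Sigma_hat n p \<gamma> (\<lambda>i j. Z i j \<omega>) $$ jk))"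

definition df1_hat ::
    "nat \<Rightarrow> nat \<Rightarrow> (nat \<Rightarrow> nat \<Rightarrow> real) \<Rightarrow> (nat \<Rightarrow> nat \<Rightarrow> real) \<Rightarrow> real \<Rightarrow> real" where
  "df1_hat n p \<gamma> Z lam =
     1 / real p * mtrace (Sigma_hat n p \<gamma> Z * minv (Sigma_hat n p \<gamma> Z + lam \<cdot>\<^sub>m (1\<^sub>m p)))"


subsection \<open>The deterministic system\<close>

definition D_row :: "nat \<Rightarrow> (nat \<Rightarrow> nat \<Rightarrow> real) \<Rightarrow> nat \<Rightarrow> complex mat" where
  "D_row p \<gamma> i = mat_diag p (\<lambda>j. complex_of_real ((\<gamma> i j)\<^sup>2))"

definition D_col :: "nat \<Rightarrow> (nat \<Rightarrow> nat \<Rightarrow> real) \<Rightarrow> nat \<Rightarrow> complex mat" where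
  "D_col n \<gamma> j = mat_diag n (\<lambda>i. complex_of_real ((\<gamma> i j)\<^sup>2))"

definition diag_at :: "nat \<Rightarrow> (nat \<Rightarrow> complex \<Rightarrow> complex) \<Rightarrow> complex \<Rightarrow> complex mat" where
  "diag_at d T z = mat_diag d (\<lambda>k. T k z)"

definition is_stieltjes :: "(complex \<Rightarrow> complex) \<Rightarrow> bool" where
  "is_stieltjes f \<longleftrightarrow>
     (\<exists>\<mu>. real_distribution \<mu> \<and> (AE t in \<mu>. 0 \<le> t) \<and>
        (\<forall>z. z \<notin> \<real>\<^sub>\<ge>\<^sub>0 \<longrightarrow> f z = (\<integral>t. 1 / (complex_of_real t - z) \<partial>\<mu>)))"

text \<open>
  For a single z the algebraic system may have several solutions; the solution is unique among
  families of Stieltjes transforms of probability measures on the nonnegative half-line, which is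
  the class imposed here on every diagonal entry.
\<close>

definition solves_system ::
    "nat \<Rightarrow> nat \<Rightarrow> (nat \<Rightarrow> nat \<Rightarrow> real) \<Rightarrow>
     (nat \<Rightarrow> complex \<Rightarrow> complex) \<Rightarrow> (nat \<Rightarrow> complex \<Rightarrow> complex) \<Rightarrow> bool" where
  "solves_system n p \<gamma> T T' \<longleftrightarrow>
     (\<forall>j<p. is_stieltjes (T j)) \<and> (\<forall>i<n. is_stieltjes (T' i)) \<and>
     (\<forall>z. z \<notin> \<real>\<^sub>\<ge>\<^sub>0 \<longrightarrow>
        (\<forall>j<p. T j z = -1 / (z * (1 + 1 / of_nat n * mtrace (D_col n \<gamma> j * diag_at n T' z)))) \<and>
        (\<forall>i<n. T' i z = -1 / (z * (1 + 1 / of_nat n * mtrace (D_row p \<gamma> i * diag_at p T z)))))"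

text \<open>
  If column j of the variance profile vanishes, the quotient below is 0/0. The j-th diagonal entry
  of \<open>\<Sigma>\<^sub>n\<close> is then 0 and contributes 0 to \<open>df\<^sub>1\<close> for every
  nonzero choice of \<open>\<kappa>\<^sub>j\<close>; we choose 1 to keep \<open>\<Sigma>\<^sub>n + \<kappa>\<close> invertible.
\<close>

definition kappa ::
    "nat \<Rightarrow> (nat \<Rightarrow> nat \<Rightarrow> real) \<Rightarrow> (nat \<Rightarrow> complex \<Rightarrow> complex) \<Rightarrow> real \<Rightarrow> nat \<Rightarrow> complex" where
  "kappa n \<gamma> T' lam j =
     (if mtrace (D_col n \<gamma> j) = 0 then 1
      else mtrace (D_col n \<gamma> j) /
             mtrace (D_col n \<gamma> j * diag_at n T' (- complex_of_real lam)))"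

definition df1 :: "nat \<Rightarrow> real mat \<Rightarrow> (nat \<Rightarrow> complex) \<Rightarrow> complex" where
  "df1 p \<Sigma> \<kappa> =
     1 / of_nat p * mtrace (map_mat complex_of_real \<Sigma> *
                            minv (map_mat complex_of_real \<Sigma> + mat_diag p \<kappa>))"


lemma Sigma_mean_eq_diag:
  assumes M: "prob_space M"
    and iid: "iid_standardized M L ({..<n} \<times> {..<p}) (\<lambda>(i, j). Z i j)"
  shows "Sigma_mean M n p \<gamma> Z = (1 / real n) \<cdot>\<^sub>m mat_diag p (\<lambda>j. \<Sum>i<n. (\<gamma> i j)\<^sup>2)"
proof (rule eq_matI)
  interpret prob_space M by (rule M)
  let ?I = "{..<n} \<times> {..<p}"
  let ?X = "\<lambda>(i, j). Z i j"
  have ind: "indep_vars (\<lambda>_. borel) ?X ?I"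
    and props: "\<And>i j. i < n \<Longrightarrow> j < p \<Longrightarrow> integrable M (\<lambda>\<omega>. (Z i j \<omega>)\<^sup>2)"
      "\<And>i j. i < n \<Longrightarrow> j < p \<Longrightarrow> expectation (Z i j) = 0"
      "\<And>i j. i < n \<Longrightarrow> j < p \<Longrightarrow> variance (Z i j) = 1"
    using iid unfolding iid_standardized_def by (blast, force+)
  have meas: "Z i j \<in> borel_measurable M" if "i < n" "j < p" for i j
    using ind that unfolding indep_vars_def by auto
  have int1: "integrable M (Z i j)" if "i < n" "j < p" for i j
    using square_integrable_imp_integrable[OF meas props(1)] that by blast
  have sq: "expectation (\<lambda>\<omega>. Z i j \<omega> * Z i j \<omega>) = 1" if "i < n" "j < p" for i j
    using props(2,3)[OF that] by (simp add: power2_eq_square)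
  have cross: "integrable M (\<lambda>\<omega>. Z i j \<omega> * Z i k \<omega>) \<and>
      expectation (\<lambda>\<omega>. Z i j \<omega> * Z i k \<omega>) = 0"
    if "i < n" "j < p" "k < p" "j \<noteq> k" for i j k
  proof -
    have "indep_vars (\<lambda>_. borel) ?X (insert (i, j) {(i, k)})"
      by (rule indep_vars_subset[OF ind]) (use that in auto)
    from indep_vars_sum[OF _ _ this] that(4)
    have "indep_var borel (?X (i, j)) borel (\<lambda>\<omega>. \<Sum>q\<in>{(i, k)}. ?X q \<omega>)" by simp
    then have iv: "indep_var borel (Z i j) borel (Z i k)" by simp
    show ?thesis
      using indep_var_integrable[OF iv int1 int1] indep_var_lebesgue_integral[OF iv int1 int1]
        props(2) that by simp
  qed
  have mom: "integrable M (\<lambda>\<omega>. Z i j \<omega> * Z i k \<omega>)"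
      "expectation (\<lambda>\<omega>. Z i j \<omega> * Z i k \<omega>) = (if j = k then 1 else 0)"
    if "i < n" "j < p" "k < p" for i j k
    using cross[OF that] sq[OF that(1,2)] props(1)[OF that(1,2)]
    by (auto simp: power2_eq_square)
  fix j k
  assume "j < dim_row ((1 / real n) \<cdot>\<^sub>m mat_diag p (\<lambda>j. \<Sum>i<n. (\<gamma> i j)\<^sup>2))"
    and "k < dim_col ((1 / real n) \<cdot>\<^sub>m mat_diag p (\<lambda>j. \<Sum>i<n. (\<gamma> i j)\<^sup>2))"
  then have jk: "j < p" "k < p" by (auto simp: mat_diag_def)
  have "Sigma_hat n p \<gamma> (\<lambda>i j. Z i j \<omega>) $$ (j, k) =
      (1 / real n) * (\<Sum>i<n. \<gamma> i j * \<gamma> i k * (Z i j \<omega> * Z i k \<omega>))" for \<omega>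
    using jk by (simp add: Sigma_hat_def design_def scalar_prod_def lessThan_atLeast0 mult_ac)
  then have "Sigma_mean M n p \<gamma> Z $$ (j, k) =
      expectation (\<lambda>\<omega>. (1 / real n) * (\<Sum>i<n. \<gamma> i j * \<gamma> i k * (Z i j \<omega> * Z i k \<omega>)))"
    using jk by (simp add: Sigma_mean_def)
  also have "\<dots> = (1 / real n) * (\<Sum>i<n. \<gamma> i j * \<gamma> i k * (if j = k then 1 else 0))"
    using jk mom by (simp add: Bochner_Integration.integral_sum del: mult_if_delta)
  finally show "Sigma_mean M n p \<gamma> Z $$ (j, k) =
      ((1 / real n) \<cdot>\<^sub>m mat_diag p (\<lambda>j. \<Sum>i<n. (\<gamma> i j)\<^sup>2)) $$ (j, k)"
    using jk by (simp add: mat_diag_def power2_eq_square)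
qed (auto simp: Sigma_mean_def mat_diag_def)

end

theory Submission
  imports Defs "Jordan_Normal_Form.Determinant"
begin

text \<open>
  On the negative half-line \<open>z = - \<lambda>\<close> everything is real: with \<open>Q = (X\<^sup>T X / n + \<lambda>)\<^sup>-\<^sup>1\<close> the empirical
  degrees of freedom are \<open>1 - \<lambda> Tr Q / p\<close>, and the system turns \<open>df\<^sub>1\<close> into \<open>1 - \<lambda> Tr T(- \<lambda>) / p\<close>.
  Changing one row of \<open>X\<close> is a perturbation of \<open>Tr Q\<close> by \<open>O(1)\<close>, so the method of bounded differences
  and the Borel-Cantelli lemma give \<open>Tr Q / p - E Tr Q / p \<longlonglongrightarrow> 0\<close> almost surely.
  For the means, the Schur complement formula writes \<open>Q\<^sub>j\<^sub>j\<close> as \<open>1 / (\<lambda> (1 + q))\<close>, where \<open>q\<close> is a quadratic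
  form in column \<open>j\<close> whose matrix depends on the other columns only; its variance is \<open>O(1/n)\<close>.
  Hence the mean diagonals of \<open>Q\<close> and of \<open>(X X\<^sup>T / n + \<lambda>)\<^sup>-\<^sup>1\<close> solve the deterministic system up to a
  uniform error \<open>O(n\<^sup>-\<^sup>1\<^sup>/\<^sup>2)\<close>. The positive system is contracting in the sup-norm of logarithms, so its approximate
  solutions are close to the exact one, for every \<open>\<lambda> > 0\<close>.
\<close>

section \<open>Resolvents as bilinear forms\<close>

text \<open>The entries may be unbounded, and nothing relates the matrices for different
  \<open>n\<close> to each other, so almost sure convergence needs summable tails obtained without
  truncation. They exist because a rank-one term x x^T moves a weighted trace by at most \<beta> /
  l, whatever the size of x: with Q the resolvent, the change is at most \<beta> |Q x|^2 / (1 + x^T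
  Q x), and |Q x|^2 is at most x^T Q x / l. The fourth moment enters through the variance of the
  quadratic form, where weights of order 1/n meet a resolvent of squared Frobenius norm at most m /
  l^2.

  Each diagonal entry of one resolvent is tied to a weighted trace of the other, so both sides of
  the system must be controlled together; one estimate serves both, applied to the matrix and to its
  transpose. In the stability argument S bounds all weighted sums, exact and approximate. The
  largest ratio K then satisfies K (1 + S) \<le> (1 + K S) (1 + \<eta>); the terms K S cancel, which
  leaves an explicit bound on K once \<eta> S < 1, with no condition relating \<lambda> to the
  profile.\<close>

definition ip :: "nat \<Rightarrow> (nat \<Rightarrow> real) \<Rightarrow> (nat \<Rightarrow> real) \<Rightarrow> real" where
  "ip m u v = (\<Sum>i<m. u i * v i)"

definition unit_fun :: "nat \<Rightarrow> nat \<Rightarrow> real" where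
  "unit_fun a = (\<lambda>i. if i = a then 1 else 0)"

text \<open>
  The bilinear form \<open>u\<^sup>T (\<Sum>x\<leftarrow>xs. x x\<^sup>T + l)\<^sup>-\<^sup>1 v\<close> on the first \<open>m\<close> coordinates, by the
  Sherman-Morrison formula. The recursion makes measurability and rank-one perturbation bounds immediate.
\<close>

primrec res_form :: "real \<Rightarrow> nat \<Rightarrow> (nat \<Rightarrow> real) list \<Rightarrow> (nat \<Rightarrow> real) \<Rightarrow> (nat \<Rightarrow> real) \<Rightarrow> real" where
  "res_form l m [] u v = ip m u v / l"
| "res_form l m (x # xs) u v =
     res_form l m xs u v - res_form l m xs u x * res_form l m xs x v / (1 + res_form l m xs x x)"

text \<open>The clauses are symmetry, linearity in the first argument through its first
  \<open>m\<close> coordinates, and the weak form of \<open>(l + \<Sum> x x^T) B = 1\<close>. For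
  \<open>l > 0\<close> they determine \<open>B\<close>, so identities between resolvents are proved
  by checking clauses instead of manipulating inverses.\<close>

definition is_resolvent ::
    "real \<Rightarrow> nat \<Rightarrow> (nat \<Rightarrow> real) list \<Rightarrow> ((nat \<Rightarrow> real) \<Rightarrow> (nat \<Rightarrow> real) \<Rightarrow> real) \<Rightarrow> bool" where
  "is_resolvent l m xs B \<longleftrightarrow>
     (\<forall>u v. B u v = B v u) \<and>
     (\<forall>u v. B u v = (\<Sum>a<m. u a * B (unit_fun a) v)) \<and>
     (\<forall>u v. l * B u v + (\<Sum>x\<leftarrow>xs. ip m u x * B x v) = ip m u v)"

lemma ip_commute: "ip m u v = ip m v u"
  by (simp add: ip_def mult.commute)

lemma ip_unit_fun: "a < m \<Longrightarrow> ip m (unit_fun a) v = v a"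
  by (simp add: ip_def unit_fun_def mult_delta_left)

lemma
  assumes "is_resolvent l m xs B"
  shows is_resolvent_sym: "B u v = B v u"
    and is_resolvent_rep: "B u v = (\<Sum>a<m. u a * B (unit_fun a) v)"
    and is_resolvent_eq: "l * B u v + (\<Sum>x\<leftarrow>xs. ip m u x * B x v) = ip m u v"
  using assms unfolding is_resolvent_def by blast+

text \<open>Test the resolvent equation with the vector \<open>w = Q u\<close>, whose coordinates
  are \<open>B (unit_fun a) u\<close>. By symmetry \<open>ip m w v = B v u\<close>, so
  \<open>B w u\<close> becomes |Q u|^2 and the sum over the list a sum of squares. Positivity and
  the norm bounds on the resolvent come from this identity.\<close>

lemma is_resolvent_energy:
  assumes "is_resolvent l m xs B"
  shows "B u u = l * (\<Sum>a<m. (B (unit_fun a) u)\<^sup>2) + (\<Sum>x\<leftarrow>xs. (B x u)\<^sup>2)"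
proof -
  define w where "w = (\<lambda>a. B (unit_fun a) u)"
  have ipw: "ip m w v = B v u" for v
    using is_resolvent_rep[OF assms, of v u] by (simp add: ip_def w_def mult.commute)
  have "B w u = (\<Sum>a<m. (B (unit_fun a) u)\<^sup>2)"
    using is_resolvent_rep[OF assms, of w u] by (simp add: w_def power2_eq_square)
  then show ?thesis
    using is_resolvent_eq[OF assms, of w u] by (simp add: ipw power2_eq_square)
qed

lemma is_resolvent_nonneg:
  assumes "is_resolvent l m xs B" "0 \<le> l"
  shows "0 \<le> B u u"
  unfolding is_resolvent_energy[OF assms(1), of u]
  using assms(2) by (intro add_nonneg_nonneg mult_nonneg_nonneg sum_nonneg sum_list_nonneg) auto

lemma is_resolvent_norm_le:
  assumes "is_resolvent l m xs B" "0 < l"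
  shows "(\<Sum>a<m. (B (unit_fun a) u)\<^sup>2) \<le> B u u / l"
proof -
  have "l * (\<Sum>a<m. (B (unit_fun a) u)\<^sup>2) \<le> B u u"
    unfolding is_resolvent_energy[OF assms(1), of u] by (auto intro!: sum_list_nonneg)
  then show ?thesis using assms(2) by (simp add: field_simps)
qed

text \<open>The difference solves the homogeneous equation; testing it with its own coordinate
  vector \<open>w\<close> makes l |w|^2 plus a sum of squares equal to 0. The lists are compared
  only through sums over them, so the order of a list is irrelevant.\<close>

lemma is_resolvent_unique:
  assumes B: "is_resolvent l m xs B" and C: "is_resolvent l m ys C"
    and eq: "\<And>f. (\<Sum>x\<leftarrow>xs. f x) = (\<Sum>y\<leftarrow>ys. f y :: real)" and l: "0 < l"
  shows "B = C"
proof (intro ext)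
  fix u v
  define E where "E u = B u v - C u v" for u
  have rep: "E u = (\<Sum>a<m. u a * E (unit_fun a))" for u
    unfolding E_def by (subst is_resolvent_rep[OF B], subst is_resolvent_rep[OF C])
      (simp add: sum_subtractf right_diff_distrib)
  have main: "l * E u + (\<Sum>x\<leftarrow>xs. ip m u x * E x) = 0" for u
    using is_resolvent_eq[OF B, of u v] is_resolvent_eq[OF C, of u v]
      eq[of "\<lambda>x. ip m u x * C x v"]
    by (simp add: E_def right_diff_distrib sum_list_subtractf)
  define w where "w a = E (unit_fun a)" for a
  have ipw: "ip m w x = E x" for x
    using rep[of x] by (simp add: ip_def w_def mult.commute)
  have "E w = (\<Sum>a<m. (w a)\<^sup>2)"
    using rep[of w] by (simp add: w_def power2_eq_square)
  moreover have "0 \<le> (\<Sum>x\<leftarrow>xs. ip m w x * E x)"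
    by (intro sum_list_nonneg) (auto simp: ipw)
  ultimately have "l * (\<Sum>a<m. (w a)\<^sup>2) \<le> 0"
    using main[of w] by simp
  then have "(\<Sum>a<m. (w a)\<^sup>2) \<le> 0"
    using l by (simp add: mult_le_0_iff)
  then have "(\<Sum>a<m. (w a)\<^sup>2) = 0"
    by (simp add: order_antisym sum_nonneg)
  then have "\<forall>a<m. w a = 0"
    by (simp add: sum_nonneg_eq_0_iff)
  then have "E u = 0"
    using rep[of u] by (simp add: w_def)
  then show "B u v = C u v" by (simp add: E_def)
qed

text \<open>Put \<open>c = ?B x v / (1 + ?B x x)\<close>. The old equation at (u, v) minus c times
  the old equation at (u, x) falls short by \<open>ip m u x * c\<close>. Since c is also the value
  of the new form at (x, v), the summand of the new vector supplies exactly this term. Nonnegativity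
  of the old form keeps the denominator positive.\<close>

lemma is_resolvent_res_form:
  assumes l: "0 < l"
  shows "is_resolvent l m xs (res_form l m xs)"
proof (induction xs)
  case Nil
  have "ip m u v = (\<Sum>a<m. u a * ip m (unit_fun a) v)" for u v
    by (simp add: ip_unit_fun) (simp add: ip_def)
  then have rep: "ip m u v / l = (\<Sum>a<m. u a * (ip m (unit_fun a) v / l))" for u v
    by (metis (no_types, lifting) sum.cong sum_divide_distrib times_divide_eq_right)
  have "l * (ip m u v / l) = ip m u v" for u v using l by simp
  then show ?case
    unfolding is_resolvent_def res_form.simps list.map sum_list.Nil
    using rep ip_commute[of m] by (metis add.right_neutral)
next
  case (Cons x xs)
  let ?B = "res_form l m xs"
  note sym = is_resolvent_sym[OF Cons] and rep = is_resolvent_rep[OF Cons]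
    and eq = is_resolvent_eq[OF Cons]
  have pos: "1 + ?B x x > 0"
    using is_resolvent_nonneg[OF Cons, of x] l by simp
  show ?case unfolding is_resolvent_def
  proof (intro conjI allI)
    fix u v
    show "res_form l m (x # xs) u v = res_form l m (x # xs) v u"
      using sym[of u v] sym[of u x] sym[of x v] by simp
    show "res_form l m (x # xs) u v = (\<Sum>a<m. u a * res_form l m (x # xs) (unit_fun a) v)"
      using rep[of u v] rep[of u x]
      by (simp add: right_diff_distrib sum_subtractf sum_divide_distrib sum_distrib_right mult.assoc)
    have "l * res_form l m (x # xs) u v + (\<Sum>y\<leftarrow>xs. ip m u y * res_form l m (x # xs) y v)
        = (l * ?B u v + (\<Sum>y\<leftarrow>xs. ip m u y * ?B y v))
          - (l * ?B u x + (\<Sum>y\<leftarrow>xs. ip m u y * ?B y x)) * (?B x v / (1 + ?B x x))"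
    proof -
      have "(\<Sum>y\<leftarrow>xs. ip m u y * res_form l m (x # xs) y v) = (\<Sum>y\<leftarrow>xs. ip m u y * ?B y v)
          - (\<Sum>y\<leftarrow>xs. ip m u y * ?B y x) * (?B x v / (1 + ?B x x))"
        unfolding sum_list_mult_const[symmetric]
        by (simp add: right_diff_distrib sum_list_subtractf mult.assoc)
      then show ?thesis by (simp add: algebra_simps)
    qed
    also have "\<dots> = ip m u v - ip m u x * (?B x v / (1 + ?B x x))"
      by (simp only: eq)
    finally have "l * res_form l m (x # xs) u v + (\<Sum>y\<leftarrow>xs. ip m u y * res_form l m (x # xs) y v)
        = ip m u v - ip m u x * (?B x v / (1 + ?B x x))" .
    moreover have "res_form l m (x # xs) x v = ?B x v / (1 + ?B x x)"
      using pos by (simp add: field_simps)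
    ultimately show "l * res_form l m (x # xs) u v +
        (\<Sum>y\<leftarrow>x # xs. ip m u y * res_form l m (x # xs) y v) = ip m u v"
      by (simp del: res_form.simps)
  qed
qed

lemma res_form_cong_mset:
  assumes "0 < l" "mset xs = mset ys"
  shows "res_form l m xs = res_form l m ys"
proof (rule is_resolvent_unique[OF is_resolvent_res_form is_resolvent_res_form])
  fix f :: "(nat \<Rightarrow> real) \<Rightarrow> real"
  show "(\<Sum>x\<leftarrow>xs. f x) = (\<Sum>y\<leftarrow>ys. f y)"
    using assms(2) by (metis mset_map sum_mset_sum_list)
qed (use assms in auto)

lemma res_form_nonneg: "0 < l \<Longrightarrow> 0 \<le> res_form l m xs u u"
  using is_resolvent_nonneg[OF is_resolvent_res_form] by simp

lemma res_form_Cons_le: "0 < l \<Longrightarrow> res_form l m (x # xs) u u \<le> res_form l m xs u u"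
  using is_resolvent_sym[OF is_resolvent_res_form[of l m xs], of x u] res_form_nonneg[of l m xs x]
  by (simp add: divide_nonneg_nonneg)

lemma res_form_le: "0 < l \<Longrightarrow> res_form l m xs u u \<le> ip m u u / l"
proof (induction xs)
  case (Cons x xs)
  then show ?case using res_form_Cons_le[of l m x xs u] by simp
qed simp

lemma res_form_unit_fun_le: "0 < l \<Longrightarrow> a < m \<Longrightarrow> res_form l m xs (unit_fun a) (unit_fun a) \<le> 1 / l"
  using res_form_le[of l m xs "unit_fun a"] by (simp add: ip_unit_fun) (simp add: unit_fun_def)

text \<open>With s = x^T Q x, the trace drops by the sum of b_a (Q x)_a^2, divided by 1 + s. The
  energy identity bounds |Q x|^2 by s / l, and s / (1 + s) is at most 1, so the bound does not
  involve \<open>x\<close>.\<close>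

lemma weighted_trace_res_form_Cons:
  assumes l: "0 < l" and b: "\<And>a. a < m \<Longrightarrow> 0 \<le> b a" "\<And>a. a < m \<Longrightarrow> b a \<le> \<beta>"
  defines "tr \<equiv> \<lambda>xs. \<Sum>a<m. b a * res_form l m xs (unit_fun a) (unit_fun a)"
  shows "tr (x # xs) \<le> tr xs" and "0 \<le> \<beta> \<Longrightarrow> tr xs \<le> tr (x # xs) + \<beta> / l"
proof -
  show "tr (x # xs) \<le> tr xs"
    unfolding tr_def using b res_form_Cons_le[OF l] by (intro sum_mono mult_left_mono) auto
  let ?B = "res_form l m xs" let ?s = "?B x x"
  note R = is_resolvent_res_form[OF l, of m xs]
  have s: "0 \<le> ?s" by (rule res_form_nonneg[OF l])
  have sym: "?B x (unit_fun a) = ?B (unit_fun a) x" for a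
    by (rule is_resolvent_sym[OF R])
  assume \<beta>: "0 \<le> \<beta>"
  have "tr xs - tr (x # xs) = (\<Sum>a<m. b a * (?B (unit_fun a) x)\<^sup>2) / (1 + ?s)"
    by (simp add: sym tr_def right_diff_distrib sum_subtractf sum_divide_distrib power2_eq_square)
  also have "\<dots> \<le> (\<beta> * (?s / l)) / (1 + ?s)"
  proof (rule divide_right_mono)
    have "(\<Sum>a<m. b a * (?B (unit_fun a) x)\<^sup>2) \<le> (\<Sum>a<m. \<beta> * (?B (unit_fun a) x)\<^sup>2)"
      using b by (intro sum_mono mult_right_mono) auto
    also have "\<dots> \<le> \<beta> * (?s / l)"
      using is_resolvent_norm_le[OF R l, of x] \<beta>
      by (simp only: mult_left_mono flip: sum_distrib_left)
    finally show "(\<Sum>a<m. b a * (?B (unit_fun a) x)\<^sup>2) \<le> \<beta> * (?s / l)" .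
  qed (use s in simp)
  also have "\<dots> = \<beta> / l * (?s / (1 + ?s))" by simp
  also have "\<dots> \<le> \<beta> / l * 1"
    using s \<beta> l by (intro mult_left_mono) auto
  finally show "tr xs \<le> tr (x # xs) + \<beta> / l" by simp
qed

text \<open>By the energy identity column b of the resolvent has squared norm at most Q_bb / l, and
  Q_bb is at most 1 / l; there are \<open>m\<close> columns.\<close>

lemma res_form_frobenius_le:
  assumes l: "0 < l"
  shows "(\<Sum>a<m. \<Sum>b<m. (res_form l m xs (unit_fun a) (unit_fun b))\<^sup>2) \<le> real m / l\<^sup>2"
proof -
  have "(\<Sum>a<m. \<Sum>b<m. (res_form l m xs (unit_fun a) (unit_fun b))\<^sup>2)
      = (\<Sum>b<m. \<Sum>a<m. (res_form l m xs (unit_fun a) (unit_fun b))\<^sup>2)"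
    by (rule sum.swap)
  also have "\<dots> \<le> (\<Sum>b<m. 1 / l\<^sup>2)"
  proof (rule sum_mono)
    fix b assume "b \<in> {..<m}"
    then have "res_form l m xs (unit_fun b) (unit_fun b) / l \<le> (1 / l) / l"
      using l res_form_unit_fun_le[OF l] by (intro divide_right_mono) auto
    with is_resolvent_norm_le[OF is_resolvent_res_form[OF l] l, of m xs "unit_fun b"]
    show "(\<Sum>a<m. (res_form l m xs (unit_fun a) (unit_fun b))\<^sup>2) \<le> 1 / l\<^sup>2"
      by (simp add: power2_eq_square)
  qed
  finally show ?thesis by simp
qed

lemma sum_list_map_upt: "(\<Sum>i\<leftarrow>[0..<k]. f i) = (\<Sum>i<k. f i :: real)"
  by (simp add: interv_sum_list_conv_sum_set_nat lessThan_atLeast0)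

text \<open>\<open>(X\<^sup>T X + l)\<^sup>-\<^sup>1 = (1 - X\<^sup>T (X X\<^sup>T + l)\<^sup>-\<^sup>1 X) / l\<close>.\<close>

lemma res_form_rows_eq:
  fixes X :: "nat \<Rightarrow> nat \<Rightarrow> real" and k :: nat
  assumes l: "0 < l"
  defines "xs \<equiv> map (\<lambda>j i. X i j) [0..<k]"
  defines "ap \<equiv> \<lambda>u i. \<Sum>j<k. u j * X i j"
  shows "res_form l k (map X [0..<m]) = (\<lambda>u v. (ip k u v - res_form l m xs (ap u) (ap v)) / l)"
proof (rule is_resolvent_unique[OF is_resolvent_res_form[OF l] _ refl l])
  let ?B = "res_form l m xs"
  let ?C = "\<lambda>u v. (ip k u v - ?B (ap u) (ap v)) / l"
  note R = is_resolvent_res_form[OF l, of m xs]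
  have lin: "?B (ap u) w = (\<Sum>a<k. u a * ?B (ap (unit_fun a)) w)" for u w
  proof -
    have b: "ap (unit_fun a) i = X i a" if "a < k" for a i
      using that by (simp add: ap_def unit_fun_def mult_delta_left)
    have "?B (ap u) w = (\<Sum>i<m. \<Sum>a<k. u a * (X i a * ?B (unit_fun i) w))"
      by (subst is_resolvent_rep[OF R]) (simp add: ap_def sum_distrib_right mult.assoc)
    also have "\<dots> = (\<Sum>a<k. u a * (\<Sum>i<m. ap (unit_fun a) i * ?B (unit_fun i) w))"
      by (subst sum.swap) (simp add: b sum_distrib_left)
    also have "\<dots> = (\<Sum>a<k. u a * ?B (ap (unit_fun a)) w)"
      by (subst (2) is_resolvent_rep[OF R]) simp
    finally show ?thesis .
  qed
  have ipap: "ip k u (X i) = ap u i" for u i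
    by (simp add: ip_def ap_def)
  show "is_resolvent l k (map X [0..<m]) ?C"
    unfolding is_resolvent_def
  proof (intro conjI allI)
    fix u v
    show "?C u v = ?C v u"
      by (simp only: ip_commute[of k u v] is_resolvent_sym[OF R, of "ap u" "ap v"])
    have "(\<Sum>a<k. u a * ?C (unit_fun a) v)
        = ((\<Sum>a<k. u a * ip k (unit_fun a) v) - (\<Sum>a<k. u a * ?B (ap (unit_fun a)) (ap v))) / l"
      by (simp add: right_diff_distrib diff_divide_distrib sum_subtractf sum_divide_distrib)
    also have "(\<Sum>a<k. u a * ip k (unit_fun a) v) = ip k u v"
      by (simp add: ip_unit_fun) (simp add: ip_def)
    finally show "?C u v = (\<Sum>a<k. u a * ?C (unit_fun a) v)"
      by (simp add: lin[of u])
    have S1: "(\<Sum>i<m. ap u i * ap v i) = ip m (ap u) (ap v)" by (simp add: ip_def)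
    have "?B (ap (X i)) (ap v) = (\<Sum>j<k. X i j * ?B (ap (unit_fun j)) (ap v))" for i
      by (rule lin)
    then have "(\<Sum>i<m. ap u i * ?B (ap (X i)) (ap v))
        = (\<Sum>i<m. \<Sum>j<k. ap u i * X i j * ?B (ap (unit_fun j)) (ap v))"
      by (simp add: sum_distrib_left mult.assoc)
    also have "\<dots> = (\<Sum>j<k. ip m (ap u) (\<lambda>i. X i j) * ?B (\<lambda>i. X i j) (ap v))"
    proof (subst sum.swap, rule sum.cong[OF refl])
      fix j assume "j \<in> {..<k}"
      then have "ap (unit_fun j) = (\<lambda>i. X i j)"
        by (auto simp: ap_def unit_fun_def mult_delta_left)
      then show "(\<Sum>i<m. ap u i * X i j * ?B (ap (unit_fun j)) (ap v)) =
          ip m (ap u) (\<lambda>i. X i j) * ?B (\<lambda>i. X i j) (ap v)"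
        by (simp add: ip_def sum_distrib_right)
    qed
    \<comment> \<open>The sum just obtained is the one in the resolvent equation for the list of
      columns.\<close>
    also have "\<dots> = ip m (ap u) (ap v) - l * ?B (ap u) (ap v)"
      using is_resolvent_eq[OF R, of "ap u" "ap v"]
      by (simp add: xs_def o_def sum_list_map_upt)
    finally have S2: "(\<Sum>i<m. ap u i * ?B (ap (X i)) (ap v))
        = ip m (ap u) (ap v) - l * ?B (ap u) (ap v)" .
    have ipap': "ip k (X i) v = ap v i" for i
      by (simp add: ip_def ap_def mult.commute)
    have "(\<Sum>x\<leftarrow>map X [0..<m]. ip k u x * ?C x v)
        = (\<Sum>i<m. ap u i * ((ap v i - ?B (ap (X i)) (ap v)) / l))"
      by (simp add: o_def sum_list_map_upt ipap ipap')
    also have "\<dots> = ((\<Sum>i<m. ap u i * ap v i) - (\<Sum>i<m. ap u i * ?B (ap (X i)) (ap v))) / l"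
      by (simp add: right_diff_distrib diff_divide_distrib sum_subtractf sum_divide_distrib)
    also have "\<dots> = ?B (ap u) (ap v)"
      using l by (simp add: S1 S2)
    finally show "l * ?C u v + (\<Sum>x\<leftarrow>map X [0..<m]. ip k u x * ?C x v) = ip k u v"
      using l by simp
  qed
qed

text \<open>Column \<open>j\<close> is brought to the head of the list, where one unfolding of the
  recursion separates it from the resolvent of the other columns.\<close>

lemma res_form_remove1:
  assumes l: "0 < l" and j: "j < k"
  shows "res_form l m (map f [0..<k]) = res_form l m (f j # map f (remove1 j [0..<k]))"
proof (rule res_form_cong_mset[OF l])
  have "mset [0..<k] = mset (j # remove1 j [0..<k])"
    using j by simp
  then show "mset (map f [0..<k]) = mset (f j # map f (remove1 j [0..<k]))"
    by (metis list.simps(9) mset_map)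
qed

text \<open>The Schur complement formula: take u = v = e_j in the exchange identity, so that X e_j
  is column j. With s the quadratic form of that column in the resolvent of the others,
  Sherman-Morrison gives s - s^2 / (1 + s) = s / (1 + s), and 1 - s / (1 + s) = 1 / (1 + s).\<close>

lemma res_form_rows_diag:
  fixes X :: "nat \<Rightarrow> nat \<Rightarrow> real"
  assumes l: "0 < l" and j: "j < k"
  shows "res_form l k (map X [0..<m]) (unit_fun j) (unit_fun j) =
    1 / (l * (1 + res_form l m (map (\<lambda>j i. X i j) (remove1 j [0..<k])) (\<lambda>i. X i j) (\<lambda>i. X i j)))"
proof -
  let ?B = "res_form l m (map (\<lambda>j i. X i j) (remove1 j [0..<k]))" and ?x = "\<lambda>i. X i j"
  have "0 \<le> ?B ?x ?x" by (rule res_form_nonneg[OF l])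
  moreover have "(\<lambda>i. \<Sum>j'<k. unit_fun j j' * X i j') = ?x"
    using j by (auto simp: unit_fun_def mult_delta_left)
  moreover have "ip k (unit_fun j) (unit_fun j) = 1"
    using j by (simp add: ip_unit_fun) (simp add: unit_fun_def)
  ultimately show ?thesis
    using l by (simp add: res_form_rows_eq[OF l, of k X m] res_form_remove1[OF l j, of m "\<lambda>j i. X i j"])
      (simp add: field_simps)
qed

text \<open>Both arguments may vary with \<omega> and stay arbitrary in the induction, because the
  recursion inserts members of the random list into them.\<close>

lemma measurable_res_form:
  assumes l: "0 < l"
    and "\<And>j i. j \<in> set js \<Longrightarrow> i < m \<Longrightarrow> (\<lambda>\<omega>. X \<omega> j i) \<in> borel_measurable N"
    and "\<And>i. i < m \<Longrightarrow> (\<lambda>\<omega>. U \<omega> i) \<in> borel_measurable N"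
    and "\<And>i. i < m \<Longrightarrow> (\<lambda>\<omega>. V \<omega> i) \<in> borel_measurable N"
  shows "(\<lambda>\<omega>. res_form l m (map (X \<omega>) js) (U \<omega>) (V \<omega>)) \<in> borel_measurable N"
  using assms(2-)
proof (induction js arbitrary: U V)
  case Nil
  then show ?case by (simp add: ip_def)
next
  case (Cons j js)
  have 1: "(\<lambda>\<omega>. res_form l m (map (X \<omega>) js) (U \<omega>) (V \<omega>)) \<in> borel_measurable N"
    if "\<And>i. i < m \<Longrightarrow> (\<lambda>\<omega>. U \<omega> i) \<in> borel_measurable N"
      "\<And>i. i < m \<Longrightarrow> (\<lambda>\<omega>. V \<omega> i) \<in> borel_measurable N" for U V
    using Cons.prems that by (intro Cons.IH) auto
  have [measurable]: "(\<lambda>\<omega>. res_form l m (map (X \<omega>) js) (U \<omega>) (V \<omega>)) \<in> borel_measurable N"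
    "(\<lambda>\<omega>. res_form l m (map (X \<omega>) js) (U \<omega>) (X \<omega> j)) \<in> borel_measurable N"
    "(\<lambda>\<omega>. res_form l m (map (X \<omega>) js) (X \<omega> j) (V \<omega>)) \<in> borel_measurable N"
    "(\<lambda>\<omega>. res_form l m (map (X \<omega>) js) (X \<omega> j) (X \<omega> j)) \<in> borel_measurable N"
    using Cons.prems by (auto intro!: 1)
  show ?case by simp
qed

section \<open>Bounded differences\<close>

lemma integrable_bounded_on_space:
  fixes f :: "'a \<Rightarrow> real"
  assumes "finite_measure N" "f \<in> borel_measurable N" "\<And>x. x \<in> space N \<Longrightarrow> \<bar>f x\<bar> \<le> K"
  shows "integrable N f"
  using assms by (intro finite_measure.integrable_const_bound[of N f K]) auto

text \<open>Fixing one point \<open>x0\<close> confines \<open>h\<close> to an interval of length 2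
  c around \<open>h x0\<close>, so Hoeffding's lemma yields (2 c)^2 / 8 = c^2 / 2. Negative
  \<open>t\<close> is reduced to positive \<open>t\<close> by passing to - h.\<close>

lemma (in prob_space) Hoeffding_oscillation:
  fixes h :: "'a \<Rightarrow> real"
  assumes h[measurable]: "h \<in> borel_measurable M"
    and osc: "\<And>x y. x \<in> space M \<Longrightarrow> y \<in> space M \<Longrightarrow> \<bar>h x - h y\<bar> \<le> c"
  shows "expectation (\<lambda>x. exp (t * (h x - expectation h))) \<le> exp (t\<^sup>2 * c\<^sup>2 / 2)"
proof -
  obtain x0 where x0: "x0 \<in> space M" using not_empty by blast
  have c: "0 \<le> c" using osc[OF x0 x0] by simp
  have pos: "expectation (\<lambda>x. exp (t * (h x - expectation h))) \<le> exp (t\<^sup>2 * c\<^sup>2 / 2)"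
    if t: "0 < t" and [measurable]: "h \<in> borel_measurable M"
      and osc: "\<And>x y. x \<in> space M \<Longrightarrow> y \<in> space M \<Longrightarrow> \<bar>h x - h y\<bar> \<le> c" for h t
  proof -
    interpret I: interval_bounded_random_variable M h "h x0 - c" "h x0 + c"
    proof
      have "h x \<in> {h x0 - c..h x0 + c}" if "x \<in> space M" for x
        using osc[OF x0 that] by (auto simp: abs_le_iff)
      then show "AE x in M. h x \<in> {h x0 - c..h x0 + c}" by (intro AE_I2) auto
    qed auto
    have bnd: "exp (t * (h x - expectation h)) \<le> exp (t * (h x0 + c - expectation h))"
      if "x \<in> space M" for x
      using osc[OF x0 that] t by (auto simp: abs_le_iff)
    have "integrable M (\<lambda>x. exp (t * (h x - expectation h)))"
      by (rule integrable_bounded_on_space[OF finite_measure_axioms]) (use bnd in auto)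
    then have "ennreal (expectation (\<lambda>x. exp (t * (h x - expectation h))))
        = (\<integral>\<^sup>+x. ennreal (exp (t * (h x - expectation h))) \<partial>M)"
      by (subst nn_integral_eq_integral) auto
    also have "\<dots> \<le> ennreal (exp (t\<^sup>2 * (h x0 + c - (h x0 - c))\<^sup>2 / 8))"
      by (rule I.Hoeffdings_lemma_nn_integral[OF t])
    also have "(h x0 + c - (h x0 - c))\<^sup>2 = 4 * c\<^sup>2"
      by (simp add: power2_eq_square algebra_simps)
    finally show ?thesis by (simp add: ennreal_le_iff mult.commute)
  qed
  consider "t > 0" | "t = 0" | "t < 0" by linarith
  then show ?thesis
  proof cases
    case 3
    then have "expectation (\<lambda>x. exp (- t * (- h x - expectation (\<lambda>x. - h x)))) \<le> exp ((- t)\<^sup>2 * c\<^sup>2 / 2)"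
      using osc by (intro pos) (auto simp: abs_minus_commute)
    moreover have "- t * (- h x - expectation (\<lambda>x. - h x)) = t * (h x - expectation h)" for x
      by (simp add: algebra_simps)
    ultimately show ?thesis by simp
  qed (use pos[OF _ h osc] in \<open>simp_all add: prob_space\<close>)
qed

lemma (in product_prob_space) integrable_bounded_PiM:
  fixes f :: "('i \<Rightarrow> 'a) \<Rightarrow> real"
  assumes "f \<in> borel_measurable (PiM J M)" "\<And>x. x \<in> space (PiM J M) \<Longrightarrow> \<bar>f x\<bar> \<le> K"
  shows "integrable (PiM J M) f"
proof -
  interpret PJ: prob_space "PiM J M" by (intro prob_space_PiM M.prob_space_axioms)
  show ?thesis by (rule integrable_bounded_on_space[OF PJ.finite_measure_axioms assms])
qed

text \<open>Integrate out one coordinate at a time, applying Hoeffding's lemma to that coordinate.\<close>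

lemma (in product_prob_space) bounded_differences_mgf:
  fixes f :: "('i \<Rightarrow> 'a) \<Rightarrow> real"
  assumes "finite J"
    and "f \<in> borel_measurable (PiM J M)"
    and "\<And>x. x \<in> space (PiM J M) \<Longrightarrow> \<bar>f x\<bar> \<le> K"
    and "\<And>x i y. x \<in> space (PiM J M) \<Longrightarrow> i \<in> J \<Longrightarrow> y \<in> space (M i) \<Longrightarrow>
            \<bar>f x - f (x(i := y))\<bar> \<le> c"
  shows "(\<integral>x. exp (t * (f x - (\<integral>x. f x \<partial>PiM J M))) \<partial>PiM J M) \<le> exp (card J * (t\<^sup>2 * c\<^sup>2 / 2))"
  using assms
proof (induction J arbitrary: f rule: finite_induct)
  case empty
  then show ?case by (simp add: PiM_empty lebesgue_integral_count_space_finite)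
next
  case (insert i J)
  note [measurable] = insert.prems(1)
  interpret PJ: prob_space "PiM J M" by (intro prob_space_PiM M.prob_space_axioms)
  interpret i: prob_space "M i" by (rule M.prob_space_axioms)
  have sp: "x(i := y) \<in> space (PiM (insert i J) M)"
    if "x \<in> space (PiM J M)" "y \<in> space (M i)" for x y
    using that by (auto simp: space_PiM PiE_def Pi_def extensional_def)
  have [measurable]: "(\<lambda>(x, y). f (x(i := y))) \<in> borel_measurable (PiM J M \<Otimes>\<^sub>M M i)"
    using measurable_compose[OF measurable_add_dim insert.prems(1)] by (simp add: case_prod_beta)
  \<comment> \<open>Averaging over coordinate \<open>i\<close> preserves the bound \<open>K\<close>
    and the oscillation \<open>c\<close> in every other coordinate, so the induction hypothesis
    applies to \<open>g\<close>.\<close>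
  define g where "g x = (\<integral>y. f (x(i := y)) \<partial>M i)" for x
  have g[measurable]: "g \<in> borel_measurable (PiM J M)"
    unfolding g_def by measurable
  have meas_y: "(\<lambda>y. f (x(i := y))) \<in> borel_measurable (M i)" if "x \<in> space (PiM J M)" for x
    using that by measurable
  have inty: "integrable (M i) (\<lambda>y. f (x(i := y)))" if "x \<in> space (PiM J M)" for x
    using that sp insert.prems(2)
    by (intro integrable_bounded_on_space[OF M.finite_measure_axioms meas_y, of _ K]) auto
  have gK: "\<bar>g x\<bar> \<le> K" if "x \<in> space (PiM J M)" for x
  proof -
    have "\<bar>g x\<bar> \<le> (\<integral>y. \<bar>f (x(i := y))\<bar> \<partial>M i)" unfolding g_def by (rule integral_abs_bound)
    also have "\<dots> \<le> (\<integral>y. K \<partial>M i)"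
      using that sp insert.prems(2) inty[OF that] by (intro integral_mono) auto
    finally show ?thesis by (simp add: M.prob_space)
  qed
  have gc: "\<bar>g x - g (x(k := z))\<bar> \<le> c"
    if "x \<in> space (PiM J M)" "k \<in> J" "z \<in> space (M k)" for x k z
  proof -
    have x': "x(k := z) \<in> space (PiM J M)"
      using that by (auto simp: space_PiM PiE_def Pi_def extensional_def)
    have ki: "k \<noteq> i" using that insert.hyps by auto
    have "\<bar>g x - g (x(k := z))\<bar> = \<bar>\<integral>y. f (x(i := y)) - f (x(k := z, i := y)) \<partial>M i\<bar>"
      unfolding g_def using inty that(1) x' by simp
    also have "\<dots> \<le> (\<integral>y. \<bar>f (x(i := y)) - f (x(k := z, i := y))\<bar> \<partial>M i)"
      by (rule integral_abs_bound)
    also have "\<dots> \<le> (\<integral>y. c \<partial>M i)"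
    proof (intro integral_mono)
      fix y assume "y \<in> space (M i)"
      then show "\<bar>f (x(i := y)) - f (x(k := z, i := y))\<bar> \<le> c"
        using insert.prems(3)[OF sp[OF that(1)], of y k z] that ki fun_upd_twist[OF ki, of x z y] by (simp del: fun_upd_apply)
    qed (use inty that(1) x' in auto)
    finally show ?thesis by (simp add: M.prob_space)
  qed
  define E where "E = (\<integral>x. g x \<partial>PiM J M)"
  have int_f: "integrable (PiM (insert i J) M) f"
    using insert.prems by (intro integrable_bounded_PiM) auto
  have Ef: "(\<integral>x. f x \<partial>PiM (insert i J) M) = E"
    unfolding E_def g_def by (rule product_integral_insert[OF insert.hyps int_f])
  have ebound: "\<bar>exp (t * (a - b))\<bar> \<le> exp (\<bar>t\<bar> * (K + \<bar>b\<bar>))" if "\<bar>a\<bar> \<le> K" for a b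
  proof -
    have "t * (a - b) \<le> \<bar>t\<bar> * \<bar>a - b\<bar>" by (metis abs_ge_self abs_mult)
    also have "\<dots> \<le> \<bar>t\<bar> * (K + \<bar>b\<bar>)" using that by (intro mult_left_mono) auto
    finally show ?thesis by simp
  qed
  have int_e: "integrable (PiM (insert i J) M) (\<lambda>x. exp (t * (f x - E)))"
    by (rule integrable_bounded_PiM[where K = "exp (\<bar>t\<bar> * (K + \<bar>E\<bar>))"])
      (measurable, rule ebound, rule insert.prems(2))
  \<comment> \<open>Split f - E into (g - E) + (f - g): the first part is constant in
    \<open>y\<close>, and the second is centred in \<open>y\<close> with oscillation at most
    \<open>c\<close>.\<close>
  have inner: "(\<integral>y. exp (t * (f (x(i := y)) - E)) \<partial>M i)
      \<le> exp (t * (g x - E)) * exp (t\<^sup>2 * c\<^sup>2 / 2)" if x: "x \<in> space (PiM J M)" for x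
  proof -
    have "\<bar>f (x(i := y)) - f (x(i := z))\<bar> \<le> c" if "y \<in> space (M i)" "z \<in> space (M i)" for y z
      using insert.prems(3)[OF sp[OF x that(1)], of i z] that by (simp del: fun_upd_apply)
    from M.Hoeffding_oscillation[OF meas_y[OF x] this, of t]
    have "(\<integral>y. exp (t * (f (x(i := y)) - g x)) \<partial>M i) \<le> exp (t\<^sup>2 * c\<^sup>2 / 2)"
      by (simp add: g_def)
    moreover have "exp (t * (f (x(i := y)) - E))
        = exp (t * (g x - E)) * exp (t * (f (x(i := y)) - g x))" for y
      by (simp add: algebra_simps flip: exp_add)
    ultimately show ?thesis by (simp add: mult_left_mono)
  qed
  have int_g: "integrable (PiM J M) (\<lambda>x. exp (t * (g x - E)))"
    by (rule integrable_bounded_PiM[where K = "exp (\<bar>t\<bar> * (K + \<bar>E\<bar>))"])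
      (measurable, rule ebound, rule gK)
  have "(\<integral>x. exp (t * (f x - E)) \<partial>PiM (insert i J) M)
      = (\<integral>x. (\<integral>y. exp (t * (f (x(i := y)) - E)) \<partial>M i) \<partial>PiM J M)"
    by (rule product_integral_insert[OF insert.hyps int_e])
  also have "\<dots> \<le> (\<integral>x. exp (t * (g x - E)) * exp (t\<^sup>2 * c\<^sup>2 / 2) \<partial>PiM J M)"
  proof (rule integral_mono)
    show "integrable (PiM J M) (\<lambda>x. \<integral>y. exp (t * (f (x(i := y)) - E)) \<partial>M i)"
    proof (rule integrable_bounded_PiM[where K = "exp (\<bar>t\<bar> * (K + \<bar>E\<bar>)) * exp (t\<^sup>2 * c\<^sup>2 / 2)"])
      fix x assume x: "x \<in> space (PiM J M)"
      have "\<bar>\<integral>y. exp (t * (f (x(i := y)) - E)) \<partial>M i\<bar> \<le> exp (t * (g x - E)) * exp (t\<^sup>2 * c\<^sup>2 / 2)"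
        using inner[OF x] by (subst abs_of_nonneg) auto
      also have "\<dots> \<le> exp (\<bar>t\<bar> * (K + \<bar>E\<bar>)) * exp (t\<^sup>2 * c\<^sup>2 / 2)"
        using ebound[OF gK[OF x], of E] by (intro mult_right_mono) auto
      finally show "\<bar>\<integral>y. exp (t * (f (x(i := y)) - E)) \<partial>M i\<bar> \<le> \<dots>" .
    qed measurable
  qed (use int_g inner in auto)
  also have "\<dots> = (\<integral>x. exp (t * (g x - E)) \<partial>PiM J M) * exp (t\<^sup>2 * c\<^sup>2 / 2)" by simp
  also have "\<dots> \<le> exp (card J * (t\<^sup>2 * c\<^sup>2 / 2)) * exp (t\<^sup>2 * c\<^sup>2 / 2)"
    using insert.IH[OF g gK gc] by (intro mult_right_mono) (auto simp: E_def)
  also have "\<dots> = exp (card (insert i J) * (t\<^sup>2 * c\<^sup>2 / 2))"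
    using insert.hyps by (simp add: algebra_simps flip: exp_add)
  finally show ?case by (simp add: Ef)
qed

section \<open>From moment generating functions to tails and mean deviations\<close>

lemma (in prob_space) integrable_exp_centred:
  fixes f :: "'a \<Rightarrow> real"
  assumes [measurable]: "f \<in> borel_measurable M"
    and K: "\<And>x. x \<in> space M \<Longrightarrow> \<bar>f x\<bar> \<le> K"
  shows "integrable M (\<lambda>x. exp (t * (f x - e)))"
proof (rule integrable_bounded_on_space[OF finite_measure_axioms])
  fix x assume x: "x \<in> space M"
  have "t * (f x - e) \<le> \<bar>t\<bar> * \<bar>f x - e\<bar>" by (metis abs_ge_self abs_mult)
  also have "\<dots> \<le> \<bar>t\<bar> * (K + \<bar>e\<bar>)" using K[OF x] by (intro mult_left_mono) auto
  finally show "\<bar>exp (t * (f x - e))\<bar> \<le> exp (\<bar>t\<bar> * (K + \<bar>e\<bar>))" by simp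
qed measurable

lemma (in prob_space) mgf_imp_tail:
  fixes f :: "'a \<Rightarrow> real"
  assumes [measurable]: "f \<in> borel_measurable M"
    and K: "\<And>x. x \<in> space M \<Longrightarrow> \<bar>f x\<bar> \<le> K"
    and mgf: "\<And>t. expectation (\<lambda>x. exp (t * (f x - expectation f))) \<le> exp (t\<^sup>2 * V / 2)"
    and V: "0 < V" and \<epsilon>: "0 < \<epsilon>"
  shows "prob {x \<in> space M. \<epsilon> \<le> \<bar>f x - expectation f\<bar>} \<le> 2 * exp (- \<epsilon>\<^sup>2 / (2 * V))"
proof -
  let ?E = "expectation f"
  note int = integrable_exp_centred[OF assms(1) K, where e = ?E]
  \<comment> \<open>The minimizer of t^2 V / 2 - t \<epsilon>, with minimum - \<epsilon>^2 / (2
    V).\<close>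
  let ?t = "\<epsilon> / V"
  have side: "prob {x \<in> space M. \<epsilon> \<le> s * (f x - ?E)} \<le> exp (- \<epsilon>\<^sup>2 / (2 * V))" if s: "s = 1 \<or> s = -1" for s
  proof -
    have "{x \<in> space M. \<epsilon> \<le> s * (f x - ?E)} = {x \<in> space M. exp (?t * \<epsilon>) \<le> exp (?t * s * (f x - ?E))}"
      using V \<epsilon> by (simp add: mult.assoc divide_le_cancel)
    also have "prob \<dots> \<le> expectation (\<lambda>x. exp (?t * s * (f x - ?E))) / exp (?t * \<epsilon>)"
      by (rule integral_Markov_inequality_measure[where A = "{}", OF int]) (simp_all)
    also have "\<dots> \<le> exp ((?t * s)\<^sup>2 * V / 2) / exp (?t * \<epsilon>)"
      by (intro divide_right_mono mgf) auto
    also have "(?t * s)\<^sup>2 * V / 2 = ?t * \<epsilon> / 2"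
      using s V by (auto simp: power2_eq_square field_simps)
    also have "exp (?t * \<epsilon> / 2) / exp (?t * \<epsilon>) = exp (- \<epsilon>\<^sup>2 / (2 * V))"
      by (simp add: power2_eq_square flip: exp_diff)
    finally show ?thesis .
  qed
  have "{x \<in> space M. \<epsilon> \<le> \<bar>f x - ?E\<bar>} =
      {x \<in> space M. \<epsilon> \<le> 1 * (f x - ?E)} \<union> {x \<in> space M. \<epsilon> \<le> -1 * (f x - ?E)}"
    by (auto simp: abs_if)
  also have "prob \<dots> \<le> prob {x \<in> space M. \<epsilon> \<le> 1 * (f x - ?E)} + prob {x \<in> space M. \<epsilon> \<le> -1 * (f x - ?E)}"
    by (intro measure_Un_le) measurable
  also have "\<dots> \<le> 2 * exp (- \<epsilon>\<^sup>2 / (2 * V))"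
    using side[of 1] side[of "-1"] by simp
  finally show ?thesis .
qed

text \<open>Integrate |z| \<le> exp z + exp (- z) - 1 at z = y / sqrt V. At this scale each
  exponential moment is at most exp (1/2), and 2 exp (1/2) - 1 is below 3.\<close>

lemma (in prob_space) mgf_imp_abs_deviation:
  fixes f :: "'a \<Rightarrow> real"
  assumes [measurable]: "f \<in> borel_measurable M"
    and K: "\<And>x. x \<in> space M \<Longrightarrow> \<bar>f x\<bar> \<le> K"
    and mgf: "\<And>t. expectation (\<lambda>x. exp (t * (f x - expectation f))) \<le> exp (t\<^sup>2 * V / 2)"
    and V: "0 < V"
  shows "expectation (\<lambda>x. \<bar>f x - expectation f\<bar>) \<le> 3 * sqrt V"
proof -
  let ?E = "expectation f" and ?t = "1 / sqrt V"
  note int = integrable_exp_centred[OF assms(1) K, where e = ?E]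
  have int_f: "integrable M f"
    by (rule integrable_bounded_on_space[OF finite_measure_axioms _ K]) auto
  have pt: "\<bar>y\<bar> \<le> sqrt V * (exp (?t * y) + exp (- ?t * y) - 1)" for y
  proof -
    have e: "\<bar>z\<bar> \<le> exp z + exp (- z) - 1" for z :: real
    proof -
      have "1 + \<bar>z\<bar> \<le> exp \<bar>z\<bar>" by (rule exp_ge_add_one_self)
      moreover have "exp \<bar>z\<bar> + exp (- \<bar>z\<bar>) = exp z + exp (- z)" by (simp add: abs_if)
      moreover have "0 < exp (- \<bar>z\<bar>)" by simp
      ultimately show ?thesis
        using exp_ge_add_one_self[of "\<bar>z\<bar>"] by linarith
    qed
    have "\<bar>y\<bar> = sqrt V * \<bar>?t * y\<bar>" using V by (simp add: abs_mult)
    also have "\<dots> \<le> sqrt V * (exp (?t * y) + exp (- (?t * y)) - 1)"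
      using V by (intro mult_left_mono e) auto
    finally show ?thesis by simp
  qed
  have "expectation (\<lambda>x. \<bar>f x - ?E\<bar>)
      \<le> expectation (\<lambda>x. sqrt V * (exp (?t * (f x - ?E)) + exp (- ?t * (f x - ?E)) - 1))"
    by (intro integral_mono pt integrable_abs Bochner_Integration.integrable_diff
        Bochner_Integration.integrable_add integrable_mult_right int int_f) auto
  also have "\<dots> = sqrt V * (expectation (\<lambda>x. exp (?t * (f x - ?E))) +
      expectation (\<lambda>x. exp (- ?t * (f x - ?E))) - 1)"
    using int[of ?t] int[of "- ?t"] by (simp add: prob_space)
  also have "\<dots> \<le> sqrt V * (exp (?t\<^sup>2 * V / 2) + exp ((- ?t)\<^sup>2 * V / 2) - 1)"
    using V by (intro mult_left_mono diff_right_mono add_mono mgf) auto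
  also have "\<dots> = sqrt V * (2 * exp (1 / 2) - 1)"
    using V by (simp add: power_divide)
  also have "\<dots> \<le> sqrt V * 3"
  proof (intro mult_left_mono)
    have "exp (1 / 2 :: real) \<le> 1 + 1/2 + (1/2)\<^sup>2"
      by (rule exp_bound) auto
    then show "2 * exp (1 / 2) - 1 \<le> (3 :: real)" by (simp add: power2_eq_square)
  qed (use V in auto)
  finally show ?thesis by simp
qed

section \<open>Variance of quadratic forms\<close>

lemma prod_power_of_bool:
  fixes y :: "nat \<Rightarrow> real"
  assumes "a < m"
  shows "(\<Prod>i<m. y i ^ of_bool (i = a)) = y a"
proof -
  have "(\<Prod>i<m. y i ^ of_bool (i = a)) = (\<Prod>i<m. if i = a then y i else 1)"
    by (intro prod.cong) auto
  then show ?thesis using assms by simp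
qed

locale standardized_law = prob_space L for L :: "real measure" +
  assumes sets_L[measurable_cong]: "sets L = sets borel"
    and integrable_pow4: "integrable L (\<lambda>x. x ^ 4)"
    and mean_L: "(\<integral>x. x \<partial>L) = 0"
    and var_L: "(\<integral>x. x\<^sup>2 \<partial>L) = 1"
begin

definition moment :: "nat \<Rightarrow> real" where "moment r = (\<integral>x. x ^ r \<partial>L)"

lemma integrable_pow: "r \<le> 4 \<Longrightarrow> integrable L (\<lambda>x. x ^ r)"
proof (rule Bochner_Integration.integrable_bound[of L "\<lambda>x. 1 + x ^ 4"])
  assume "r \<le> 4"
  have "\<bar>x\<bar> ^ r \<le> 1 + \<bar>x\<bar> ^ 4" for x :: real
  proof (cases "\<bar>x\<bar> \<le> 1")
    case True
    then have "\<bar>x\<bar> ^ r \<le> 1" by (intro power_le_one) auto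
    then show ?thesis by (simp add: add_increasing2)
  next
    case False
    then have "\<bar>x\<bar> ^ r \<le> \<bar>x\<bar> ^ 4" using \<open>r \<le> 4\<close> by (intro power_increasing) auto
    then show ?thesis by simp
  qed
  then show "AE x in L. norm (x ^ r) \<le> norm (1 + x ^ 4)"
    by (intro AE_I2) (simp add: power_abs power_even_abs_numeral abs_of_nonneg add_nonneg_nonneg)
qed (use integrable_pow4 in auto)

lemma moment_simps: "moment 0 = 1" "moment (Suc 0) = 0" "moment 2 = 1"
  using prob_space mean_L var_L by (auto simp: moment_def)

text \<open>Allows both covariance values 1 and \<open>moment 4 - 1\<close> that occur below to be
  bounded by \<open>moment 4\<close>.\<close>

lemma moment4_ge_1: "1 \<le> moment 4"
proof -
  have "(\<integral>x. 2 * x ^ 2 - 1 \<partial>L) \<le> (\<integral>x. x ^ 4 \<partial>L)"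
  proof (rule integral_mono)
    fix x :: real
    have "0 \<le> (x\<^sup>2 - 1)\<^sup>2" by simp
    then show "2 * x ^ 2 - 1 \<le> x ^ 4" by (simp add: power2_eq_square power4_eq_xxxx algebra_simps)
  qed (use integrable_pow[of 2] integrable_pow4 in auto)
  also have "(\<integral>x. 2 * x ^ 2 - 1 \<partial>L) = 1"
    using integrable_pow[of 2] by (simp add: prob_space var_L)
  finally show ?thesis by (simp add: moment_def)
qed

abbreviation col_law :: "nat \<Rightarrow> (nat \<Rightarrow> real) measure" where "col_law m \<equiv> PiM {..<m} (\<lambda>_. L)"

lemma prob_space_col_law: "prob_space (col_law m)"
  by (intro prob_space_PiM prob_space_axioms)

lemma
  assumes "\<And>i. i < m \<Longrightarrow> e i \<le> 4"
  shows integrable_monomial: "integrable (col_law m) (\<lambda>y. \<Prod>i<m. y i ^ e i)"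
    and integral_monomial: "(\<integral>y. (\<Prod>i<m. y i ^ e i) \<partial>col_law m) = (\<Prod>i<m. moment (e i))"
proof -
  interpret product_sigma_finite "\<lambda>_::nat. L"
    by (intro product_sigma_finite.intro sigma_finite_measure_axioms)
  show "integrable (col_law m) (\<lambda>y. \<Prod>i<m. y i ^ e i)"
    using assms by (intro product_integrable_prod integrable_pow) auto
  show "(\<integral>y. (\<Prod>i<m. y i ^ e i) \<partial>col_law m) = (\<Prod>i<m. moment (e i))"
    unfolding moment_def using assms by (intro product_integral_prod integrable_pow) auto
qed

text \<open>The multiplicity of \<open>i\<close> among the four indices. It rewrites a product of
  four coordinates as a monomial over all coordinates, whose integral factorizes into
  moments.\<close>

definition mult4 :: "nat \<Rightarrow> nat \<Rightarrow> nat \<Rightarrow> nat \<Rightarrow> nat \<Rightarrow> nat" where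
  "mult4 a b c d i = of_bool (i = a) + of_bool (i = b) + of_bool (i = c) + of_bool (i = d)"

lemma prod4_eq_monomial:
  fixes y :: "nat \<Rightarrow> real"
  assumes "a < m" "b < m" "c < m" "d < m"
  shows "y a * y b * y c * y d = (\<Prod>i<m. y i ^ mult4 a b c d i)"
  using prod_power_of_bool[OF assms(1), of y] prod_power_of_bool[OF assms(2), of y]
    prod_power_of_bool[OF assms(3), of y] prod_power_of_bool[OF assms(4), of y]
  by (simp add: mult4_def power_add prod.distrib)

lemma
  assumes "a < m" "b < m" "c < m" "d < m"
  shows integrable_prod4: "integrable (col_law m) (\<lambda>y. y a * y b * y c * y d)"
    and integral_prod4: "(\<integral>y. y a * y b * y c * y d \<partial>col_law m) = (\<Prod>i<m. moment (mult4 a b c d i))"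
proof -
  have eq: "(\<lambda>y. y a * y b * y c * y d :: real) = (\<lambda>y. \<Prod>i<m. y i ^ mult4 a b c d i)"
    by (rule ext) (rule prod4_eq_monomial[OF assms])
  have le: "mult4 a b c d i \<le> 4" for i by (simp add: mult4_def)
  show "integrable (col_law m) (\<lambda>y. y a * y b * y c * y d)"
    unfolding eq using le by (rule integrable_monomial)
  show "(\<integral>y. y a * y b * y c * y d \<partial>col_law m) = (\<Prod>i<m. moment (mult4 a b c d i))"
    unfolding eq using le by (rule integral_monomial)
qed

lemma
  assumes "a < m" "b < m"
  shows integrable_prod2: "integrable (col_law m) (\<lambda>y. y a * y b)"
    and integral_prod2: "(\<integral>y. y a * y b \<partial>col_law m) = of_bool (a = b)"
proof -
  let ?e = "\<lambda>i. of_bool (i = a) + of_bool (i = b) :: nat"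
  have eq: "(\<lambda>y. y a * y b :: real) = (\<lambda>y. \<Prod>i<m. y i ^ ?e i)"
  proof
    show "y a * y b = (\<Prod>i<m. y i ^ ?e i)" for y :: "nat \<Rightarrow> real"
      using prod_power_of_bool[OF assms(1), of y] prod_power_of_bool[OF assms(2), of y]
      by (simp add: power_add prod.distrib)
  qed
  show "integrable (col_law m) (\<lambda>y. y a * y b)"
    unfolding eq by (rule integrable_monomial) simp
  have "(\<integral>y. y a * y b \<partial>col_law m) = (\<Prod>i<m. moment (?e i))"
    unfolding eq by (rule integral_monomial) simp
  also have "\<dots> = of_bool (a = b)"
  proof (cases "a = b")
    case True
    then have "moment (?e i) = 1" for i by (simp add: moment_simps flip: numeral_2_eq_2)
    with True show ?thesis by simp
  next
    case False
    then have "moment (?e a) = 0" by (simp add: moment_simps)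
    with False assms show ?thesis by (auto intro!: prod_zero)
  qed
  finally show "(\<integral>y. y a * y b \<partial>col_law m) = of_bool (a = b)" .
qed

text \<open>An entry of y y^T - 1; under \<open>col_law\<close> the subtracted indicator is the mean
  of the product.\<close>

definition quad2 :: "(nat \<Rightarrow> real) \<Rightarrow> nat \<times> nat \<Rightarrow> real" where
  "quad2 y q = y (fst q) * y (snd q) - of_bool (fst q = snd q)"

lemma
  assumes "a < m" "b < m" "c < m" "d < m"
  shows integrable_quad2: "integrable (col_law m) (\<lambda>y. quad2 y (a, b) * quad2 y (c, d))"
    and integral_quad2: "(\<integral>y. quad2 y (a, b) * quad2 y (c, d) \<partial>col_law m) =
      (\<Prod>i<m. moment (mult4 a b c d i)) - of_bool (a = b) * of_bool (c = d)"
proof -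
  interpret P: prob_space "col_law m" by (rule prob_space_col_law)
  have eq: "quad2 y (a, b) * quad2 y (c, d) = y a * y b * y c * y d - of_bool (a = b) * (y c * y d)
      - of_bool (c = d) * (y a * y b) + of_bool (a = b) * of_bool (c = d)" for y
    by (simp add: quad2_def algebra_simps)
  note I = integrable_prod4[OF assms] integrable_prod2[OF assms(1,2)] integrable_prod2[OF assms(3,4)]
  show "integrable (col_law m) (\<lambda>y. quad2 y (a, b) * quad2 y (c, d))"
    unfolding eq using I by simp
  show "(\<integral>y. quad2 y (a, b) * quad2 y (c, d) \<partial>col_law m) =
      (\<Prod>i<m. moment (mult4 a b c d i)) - of_bool (a = b) * of_bool (c = d)"
    unfolding eq using I
    by (simp add: integral_prod4 integral_prod2 assms P.prob_space del: of_bool_eq_iff)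
qed

text \<open>The entries of y y^T - 1 are uncorrelated except with themselves and with their mirror
  image. An index occurring exactly once among the four annihilates the mean of the product, as the
  mean of the law is 0. If none does, either the two pairs agree up to order, or a = b and c = d
  with a \<noteq> c, where the mean 1 cancels against the subtracted indicators.\<close>

lemma integral_quad2_bound:
  assumes "a < m" "b < m" "c < m" "d < m"
  shows "\<bar>\<integral>y. quad2 y (a, b) * quad2 y (c, d) \<partial>col_law m\<bar> \<le>
    moment 4 * (of_bool ((c, d) = (a, b)) + of_bool ((c, d) = (b, a)))"
proof -
  let ?P = "\<Prod>i<m. moment (mult4 a b c d i)"
  have zero: "?P = 0" if "\<exists>i<m. mult4 a b c d i = Suc 0"
    using that by (metis finite_lessThan lessThan_iff moment_simps(2) prod_zero)
  have one: "?P = 1" if "\<And>i. mult4 a b c d i \<in> {0, 2}"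
  proof (rule prod.neutral, rule ballI)
    show "moment (mult4 a b c d i) = 1" for i
      using that[of i] by (auto simp: moment_simps)
  qed
  note m4 = moment4_ge_1
  show ?thesis
  proof (cases "a = b")
    case True
    consider "c = d" "c = a" | "c = d" "c \<noteq> a" | "c \<noteq> d" by blast
    then show ?thesis
    proof cases
      case 1
      have "moment (mult4 a a a a i) = (if i = a then moment 4 else 1)" for i
        by (simp add: mult4_def moment_simps numeral_eq_Suc)
      then have "?P = moment 4" using 1 True assms by simp
      then show ?thesis using 1 True m4 assms by (simp add: integral_quad2)
    next
      case 2
      then have "?P = 1" using True by (intro one) (auto simp: mult4_def)
      then show ?thesis using 2 True assms m4 by (simp add: integral_quad2)
    next
      case 3
      then have "\<exists>i<m. mult4 a b c d i = Suc 0"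
        using True assms by (cases "c = a") (auto simp: mult4_def intro: exI[of _ c] exI[of _ d])
      then show ?thesis using 3 True assms m4 zero by (simp add: integral_quad2)
    qed
  next
    case False
    consider "c = a" "d = b" | "c = b" "d = a" | "a \<noteq> c" "a \<noteq> d" | "b \<noteq> c" "b \<noteq> d"
      using False by blast
    then show ?thesis
    proof cases
      case 1
      then have "?P = 1" using False by (intro one) (auto simp: mult4_def)
      then show ?thesis using 1 False assms m4 by (simp add: integral_quad2)
    next
      case 2
      then have "?P = 1" using False by (intro one) (auto simp: mult4_def)
      then show ?thesis using 2 False assms m4 by (simp add: integral_quad2)
    next
      case 3
      then have "?P = 0" using False assms by (intro zero exI[of _ a]) (auto simp: mult4_def)
      then show ?thesis using 3 False assms m4 by (simp add: integral_quad2 del: prod_zero_iff)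
    next
      case 4
      then have "?P = 0" using False assms by (intro zero exI[of _ b]) (auto simp: mult4_def)
      then show ?thesis using 4 False assms m4 by (simp add: integral_quad2 del: prod_zero_iff)
    qed
  qed
qed

text \<open>After expanding the square only r = q and r = \<open>prod.swap q\<close> survive. The
  mixed term |A q| |A (swap q)| is split by 2 x y \<le> x^2 + y^2, giving the weights 3/2 and 1/2;
  reindexing by the swap merges them into the constant 2.\<close>

lemma quadratic_form_variance:
  fixes A :: "nat \<times> nat \<Rightarrow> real" and m :: nat
  defines "I \<equiv> {..<m} \<times> {..<m}"
  shows "integrable (col_law m) (\<lambda>y. (\<Sum>q\<in>I. A q * quad2 y q)\<^sup>2)"
    and "(\<integral>y. (\<Sum>q\<in>I. A q * quad2 y q)\<^sup>2 \<partial>col_law m) \<le> 2 * moment 4 * (\<Sum>q\<in>I. (A q)\<^sup>2)"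
proof -
  have sq: "(\<Sum>q\<in>I. A q * quad2 y q)\<^sup>2 =
      (\<Sum>q\<in>I. \<Sum>r\<in>I. A q * A r * (quad2 y q * quad2 y r))" for y
    by (simp add: power2_eq_square sum_product mult_ac)
  have int: "integrable (col_law m) (\<lambda>y. quad2 y q * quad2 y r)" if "q \<in> I" "r \<in> I" for q r
    using that integrable_quad2[of "fst q" m "snd q" "fst r" "snd r"] by (auto simp: I_def)
  show "integrable (col_law m) (\<lambda>y. (\<Sum>q\<in>I. A q * quad2 y q)\<^sup>2)"
    unfolding sq by (intro Bochner_Integration.integrable_sum integrable_mult_right int)
  have fin: "finite I" by (simp add: I_def)
  have swap: "prod.swap q \<in> I" if "q \<in> I" for q using that by (auto simp: I_def)
  have "(\<integral>y. (\<Sum>q\<in>I. A q * quad2 y q)\<^sup>2 \<partial>col_law m)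
      = (\<Sum>q\<in>I. \<Sum>r\<in>I. A q * A r * (\<integral>y. quad2 y q * quad2 y r \<partial>col_law m))"
    unfolding sq by (simp add: int Bochner_Integration.integral_sum)
  also have "\<dots> \<le> (\<Sum>q\<in>I. \<Sum>r\<in>I. \<bar>A q\<bar> * \<bar>A r\<bar> * (moment 4 * (of_bool (r = q) + of_bool (r = prod.swap q))))"
  proof (intro sum_mono)
    fix q r assume qr: "q \<in> I" "r \<in> I"
    have "\<bar>\<integral>y. quad2 y q * quad2 y r \<partial>col_law m\<bar> \<le> moment 4 * (of_bool (r = q) + of_bool (r = prod.swap q))"
      using integral_quad2_bound[of "fst q" m "snd q" "fst r" "snd r"] qr
      by (cases q, cases r) (simp add: I_def)
    then have "\<bar>A q * A r\<bar> * \<bar>\<integral>y. quad2 y q * quad2 y r \<partial>col_law m\<bar>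
        \<le> \<bar>A q * A r\<bar> * (moment 4 * (of_bool (r = q) + of_bool (r = prod.swap q)))"
      by (intro mult_left_mono) auto
    then show "A q * A r * (\<integral>y. quad2 y q * quad2 y r \<partial>col_law m)
        \<le> \<bar>A q\<bar> * \<bar>A r\<bar> * (moment 4 * (of_bool (r = q) + of_bool (r = prod.swap q)))"
      using abs_ge_self[of "A q * A r * (\<integral>y. quad2 y q * quad2 y r \<partial>col_law m)"]
      unfolding abs_mult by linarith
  qed
  also have "\<dots> = (\<Sum>q\<in>I. moment 4 * (\<bar>A q\<bar> * \<bar>A q\<bar> + \<bar>A q\<bar> * \<bar>A (prod.swap q)\<bar>))"
  proof (rule sum.cong[OF refl])
    fix q assume q: "q \<in> I"
    have "(\<Sum>r\<in>I. \<bar>A q\<bar> * \<bar>A r\<bar> * (moment 4 * (of_bool (r = q) + of_bool (r = prod.swap q)))) =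
        (\<Sum>r\<in>I. (if r = q then \<bar>A q\<bar> * \<bar>A r\<bar> * moment 4 else 0)
          + (if r = prod.swap q then \<bar>A q\<bar> * \<bar>A r\<bar> * moment 4 else 0))"
      by (intro sum.cong) (auto simp: algebra_simps)
    also have "\<dots> = moment 4 * (\<bar>A q\<bar> * \<bar>A q\<bar> + \<bar>A q\<bar> * \<bar>A (prod.swap q)\<bar>)"
      using q swap[OF q] fin by (simp add: sum.distrib algebra_simps)
    finally show "(\<Sum>r\<in>I. \<bar>A q\<bar> * \<bar>A r\<bar> * (moment 4 * (of_bool (r = q) + of_bool (r = prod.swap q)))) = \<dots>" .
  qed
  also have "\<dots> \<le> (\<Sum>q\<in>I. moment 4 * (3/2 * (A q)\<^sup>2 + 1/2 * (A (prod.swap q))\<^sup>2))"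
  proof (intro sum_mono mult_left_mono)
    fix q
    have "0 \<le> (\<bar>A q\<bar> - \<bar>A (prod.swap q)\<bar>)\<^sup>2" by simp
    then have "2 * (\<bar>A q\<bar> * \<bar>A (prod.swap q)\<bar>) \<le> (A q)\<^sup>2 + (A (prod.swap q))\<^sup>2"
      by (simp add: power2_diff)
    then show "\<bar>A q\<bar> * \<bar>A q\<bar> + \<bar>A q\<bar> * \<bar>A (prod.swap q)\<bar> \<le> 3/2 * (A q)\<^sup>2 + 1/2 * (A (prod.swap q))\<^sup>2"
      by (simp add: power2_eq_square)
  qed (use moment4_ge_1 in auto)
  also have "(\<Sum>q\<in>I. moment 4 * (3/2 * (A q)\<^sup>2 + 1/2 * (A (prod.swap q))\<^sup>2))
      = moment 4 * (3/2 * (\<Sum>q\<in>I. (A q)\<^sup>2) + 1/2 * (\<Sum>q\<in>I. (A (prod.swap q))\<^sup>2))"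
    by (simp only: sum_distrib_left sum.distrib[symmetric])
  also have "(\<Sum>q\<in>I. (A (prod.swap q))\<^sup>2) = (\<Sum>q\<in>I. (A q)\<^sup>2)"
    by (rule sum.reindex_bij_witness[of _ prod.swap prod.swap]) (auto simp: I_def)
  finally show "(\<integral>y. (\<Sum>q\<in>I. A q * quad2 y q)\<^sup>2 \<partial>col_law m) \<le> 2 * moment 4 * (\<Sum>q\<in>I. (A q)\<^sup>2)"
    by simp
qed

end

section \<open>Random resolvents\<close>

text \<open>The hypothesis is a nonnegative integral, so that it can come from an iterated integral
  before integrability is known. The second claim integrates |y| \<le> y^2 / (2 r) + r / 2 at r =
  sqrt C.\<close>

lemma (in prob_space) abs_le_sqrt_second_moment:
  fixes h :: "'a \<Rightarrow> real"
  assumes [measurable]: "h \<in> borel_measurable M"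
    and C: "0 < C" "(\<integral>\<^sup>+x. ennreal ((h x)\<^sup>2) \<partial>M) \<le> ennreal C"
  shows "integrable M h" and "expectation (\<lambda>x. \<bar>h x\<bar>) \<le> sqrt C"
proof -
  have int: "integrable M (\<lambda>x. (h x)\<^sup>2)"
    by (rule integrableI_nonneg) (use C in \<open>auto intro: le_less_trans\<close>)
  show "integrable M h"
    by (rule square_integrable_imp_integrable[OF assms(1) int])
  then have inth: "integrable M (\<lambda>x. \<bar>h x\<bar>)" by simp
  have le: "expectation (\<lambda>x. (h x)\<^sup>2) \<le> C"
    using C int by (subst (asm) nn_integral_eq_integral) (auto simp: ennreal_le_iff)
  let ?r = "sqrt C"
  have r: "0 < ?r" "?r * ?r = C" using C by auto
  have pt': "\<bar>y\<bar> \<le> y\<^sup>2 / (2 * r) + r / 2" if r: "0 < r" for y r :: real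
  proof -
    have "0 \<le> (\<bar>y\<bar> - r)\<^sup>2" by simp
    then have "2 * r * \<bar>y\<bar> \<le> y\<^sup>2 + r * r" by (simp add: power2_eq_square algebra_simps)
    then have "\<bar>y\<bar> \<le> (y\<^sup>2 + r * r) / (2 * r)"
      using r by (simp add: field_simps)
    also have "\<dots> = y\<^sup>2 / (2 * r) + r / 2" using r by (simp add: add_divide_distrib)
    finally show ?thesis .
  qed
  note pt = pt'[OF r(1)]
  have "expectation (\<lambda>x. \<bar>h x\<bar>) \<le> expectation (\<lambda>x. (h x)\<^sup>2 / (2 * ?r) + ?r / 2)"
    by (intro integral_mono pt inth) (use int in auto)
  also have "\<dots> = expectation (\<lambda>x. (h x)\<^sup>2) / (2 * ?r) + ?r / 2"
    using int by (simp add: prob_space)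
  also have "\<dots> \<le> C / (2 * ?r) + ?r / 2"
    using le r(1) by (intro add_right_mono divide_right_mono) auto
  also have "C / (2 * ?r) = C / ?r / 2" by simp
  also have "C / ?r = ?r" using r by (metis less_irrefl nonzero_divide_eq_eq)
  also have "?r / 2 + ?r / 2 = ?r" by simp
  finally show "expectation (\<lambda>x. \<bar>h x\<bar>) \<le> sqrt C" .
qed

lemma res_form_unit_fun_abs_le:
  assumes "0 < l" "a < m"
  shows "\<bar>res_form l m xs (unit_fun a) (unit_fun a)\<bar> \<le> 1 / l"
  using res_form_unit_fun_le[OF assms] res_form_nonneg[OF assms(1)] by (simp add: abs_le_iff order_trans[of _ 0])

text \<open>
  Here the first index of a weighted random matrix numbers the columns, so a matrix is a function of
  independent columns; transposing exchanges the two indices.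
\<close>

definition wcols :: "(nat \<Rightarrow> nat \<Rightarrow> real) \<Rightarrow> (nat \<Rightarrow> nat \<Rightarrow> real) \<Rightarrow> nat \<Rightarrow> nat \<Rightarrow> real" where
  "wcols w Z j i = w j i * Z j i"

lemma map_wcols_upd: "j \<notin> set js \<Longrightarrow> map (wcols w (Z(j := y))) js = map (wcols w Z) js"
  by (auto simp: wcols_def fun_eq_iff)

context standardized_law
begin

abbreviation mat_law :: "nat \<Rightarrow> nat \<Rightarrow> (nat \<Rightarrow> nat \<Rightarrow> real) measure" where
  "mat_law k m \<equiv> PiM {..<k} (\<lambda>_. col_law m)"

lemma prob_space_mat_law: "prob_space (mat_law k m)"
  by (intro prob_space_PiM prob_space_col_law)

lemma product_prob_space_col_law: "product_prob_space (\<lambda>_. col_law m)"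
proof -
  interpret P: prob_space "col_law m" by (rule prob_space_col_law)
  show ?thesis by unfold_locales
qed

lemma measurable_entry:
  assumes "i < m"
  shows "(\<lambda>y. y i) \<in> borel_measurable (col_law m)"
    and "j < k \<Longrightarrow> (\<lambda>Z. Z j i) \<in> borel_measurable (mat_law k m)"
proof -
  have L: "f \<in> borel_measurable N" if "f \<in> measurable N L" for f and N :: "'z measure"
    using that measurable_cong_sets[OF refl sets_L] by blast
  have 1: "(\<lambda>y. y i) \<in> measurable (col_law m) L"
    using assms by (intro measurable_component_singleton) auto
  then show "(\<lambda>y. y i) \<in> borel_measurable (col_law m)" by (rule L)
  assume "j < k"
  then have "(\<lambda>Z. Z j) \<in> measurable (mat_law k m) (col_law m)"
    by (intro measurable_component_singleton) auto
  from measurable_compose[OF this 1] show "(\<lambda>Z. Z j i) \<in> borel_measurable (mat_law k m)"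
    by (rule L)
qed

lemma measurable_res_form_wcols:
  assumes "0 < l" "set js \<subseteq> {..<k}"
    and "\<And>i. i < m \<Longrightarrow> (\<lambda>Z. U Z i) \<in> borel_measurable (mat_law k m)"
    and "\<And>i. i < m \<Longrightarrow> (\<lambda>Z. V Z i) \<in> borel_measurable (mat_law k m)"
  shows "(\<lambda>Z. res_form l m (map (wcols w Z) js) (U Z) (V Z)) \<in> borel_measurable (mat_law k m)"
proof (rule measurable_res_form[OF assms(1) _ assms(3,4)])
  fix j i assume "j \<in> set js" "i < m"
  then have [measurable]: "(\<lambda>Z. Z j i) \<in> borel_measurable (mat_law k m)"
    using assms(2) by (intro measurable_entry) auto
  show "(\<lambda>Z. wcols w Z j i) \<in> borel_measurable (mat_law k m)"
    unfolding wcols_def by measurable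
qed

definition weighted_trace :: "real \<Rightarrow> nat \<Rightarrow> nat \<Rightarrow> (nat \<Rightarrow> nat \<Rightarrow> real) \<Rightarrow> (nat \<Rightarrow> real) \<Rightarrow> (nat \<Rightarrow> nat \<Rightarrow> real) \<Rightarrow> real" where
  "weighted_trace l m k w b Z = (\<Sum>a<m. b a * res_form l m (map (wcols w Z) [0..<k]) (unit_fun a) (unit_fun a))"

lemma measurable_weighted_trace: "0 < l \<Longrightarrow> weighted_trace l m k w b \<in> borel_measurable (mat_law k m)"
  unfolding weighted_trace_def by (intro borel_measurable_sum borel_measurable_times borel_measurable_const
      measurable_res_form_wcols) auto

lemma weighted_trace_abs_le:
  assumes "0 < l" "\<And>a. a < m \<Longrightarrow> 0 \<le> b a" "\<And>a. a < m \<Longrightarrow> b a \<le> \<beta>"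
  shows "\<bar>weighted_trace l m k w b Z\<bar> \<le> real m * (\<beta> * (1 / l))"
proof -
  have "\<bar>weighted_trace l m k w b Z\<bar> \<le> (\<Sum>a<m. \<bar>b a * res_form l m (map (wcols w Z) [0..<k]) (unit_fun a) (unit_fun a)\<bar>)"
    unfolding weighted_trace_def by (rule sum_abs)
  also have "\<dots> \<le> (\<Sum>a<m. \<beta> * (1 / l))"
  proof (rule sum_mono)
    fix a assume a: "a \<in> {..<m}"
    have "\<bar>b a\<bar> \<le> \<beta>" using assms(2,3) a by (simp add: abs_of_nonneg)
    then show "\<bar>b a * res_form l m (map (wcols w Z) [0..<k]) (unit_fun a) (unit_fun a)\<bar> \<le> \<beta> * (1 / l)"
      unfolding abs_mult using res_form_unit_fun_abs_le[OF assms(1)] a by (intro mult_mono) auto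
  qed
  finally show ?thesis by simp
qed

text \<open>Both matrices share all columns except \<open>j\<close>. With g the trace of the
  resolvent of the shared columns, both values lie in the interval from g - \<beta> / l to
  g.\<close>

lemma weighted_trace_bounded_differences:
  assumes "0 < l" "\<And>a. a < m \<Longrightarrow> 0 \<le> b a" "\<And>a. a < m \<Longrightarrow> b a \<le> \<beta>" "0 \<le> \<beta>" "j < k"
  shows "\<bar>weighted_trace l m k w b Z - weighted_trace l m k w b (Z(j := y))\<bar> \<le> \<beta> / l"
proof -
  let ?R = "\<lambda>Z. map (wcols w Z) (remove1 j [0..<k])"
  let ?g = "\<lambda>xs. \<Sum>a<m. b a * res_form l m xs (unit_fun a) (unit_fun a)"
  have eq: "weighted_trace l m k w b Z = ?g (wcols w Z j # ?R Z)" for Z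
    unfolding weighted_trace_def res_form_remove1[OF assms(1,5), of m "wcols w Z"] ..
  have R: "?R (Z(j := y)) = ?R Z" by (rule map_wcols_upd) auto
  note W = weighted_trace_res_form_Cons[OF assms(1), where m = m and b = b and \<beta> = \<beta>, OF assms(2,3)]
  show ?thesis unfolding eq R
    using W(1)[where x = "wcols w Z j" and xs = "?R Z"]
      W(2)[where x = "wcols w Z j" and xs = "?R Z"]
      W(1)[where x = "wcols w (Z(j := y)) j" and xs = "?R Z"]
      W(2)[where x = "wcols w (Z(j := y)) j" and xs = "?R Z"] assms(4)
    by (simp add: abs_le_iff del: res_form.simps)
qed

lemma weighted_trace_mgf:
  assumes "0 < l" "\<And>a. a < m \<Longrightarrow> 0 \<le> b a" "\<And>a. a < m \<Longrightarrow> b a \<le> \<beta>" "0 \<le> \<beta>"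
  shows "(\<integral>Z. exp (t * (weighted_trace l m k w b Z - (\<integral>Z. weighted_trace l m k w b Z \<partial>mat_law k m))) \<partial>mat_law k m)
    \<le> exp (t\<^sup>2 * (real k * (\<beta> / l)\<^sup>2) / 2)"
proof -
  interpret product_prob_space "\<lambda>_. col_law m" "{..<k}"
    by (rule product_prob_space_col_law)
  have "(\<integral>Z. exp (t * (weighted_trace l m k w b Z - (\<integral>Z. weighted_trace l m k w b Z \<partial>mat_law k m))) \<partial>mat_law k m)
      \<le> exp (card {..<k} * (t\<^sup>2 * (\<beta> / l)\<^sup>2 / 2))"
    by (rule bounded_differences_mgf[OF _ measurable_weighted_trace])
      (use assms weighted_trace_abs_le[OF assms(1-3)] weighted_trace_bounded_differences[OF assms] in auto)
  then show ?thesis by (simp add: algebra_simps)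
qed

lemma weighted_trace_tail:
  assumes "0 < l" "\<And>a. a < m \<Longrightarrow> 0 \<le> b a" "\<And>a. a < m \<Longrightarrow> b a \<le> \<beta>" "0 < \<beta>" "0 < k" "0 < \<epsilon>"
  shows "measure (mat_law k m) {Z \<in> space (mat_law k m).
      \<epsilon> \<le> \<bar>weighted_trace l m k w b Z - (\<integral>Z. weighted_trace l m k w b Z \<partial>mat_law k m)\<bar>}
    \<le> 2 * exp (- \<epsilon>\<^sup>2 / (2 * (real k * (\<beta> / l)\<^sup>2)))"
proof -
  interpret P: prob_space "mat_law k m" by (rule prob_space_mat_law)
  show ?thesis
    by (rule P.mgf_imp_tail[OF measurable_weighted_trace weighted_trace_abs_le weighted_trace_mgf]) (use assms in auto)
qed

lemma weighted_trace_abs_deviation: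
  assumes "0 < l" "\<And>a. a < m \<Longrightarrow> 0 \<le> b a" "\<And>a. a < m \<Longrightarrow> b a \<le> \<beta>" "0 < \<beta>" "0 < k"
  shows "(\<integral>Z. \<bar>weighted_trace l m k w b Z - (\<integral>Z. weighted_trace l m k w b Z \<partial>mat_law k m)\<bar> \<partial>mat_law k m)
    \<le> 3 * sqrt (real k) * (\<beta> / l)"
proof -
  interpret P: prob_space "mat_law k m" by (rule prob_space_mat_law)
  have "(\<integral>Z. \<bar>weighted_trace l m k w b Z - (\<integral>Z. weighted_trace l m k w b Z \<partial>mat_law k m)\<bar> \<partial>mat_law k m)
      \<le> 3 * sqrt (real k * (\<beta> / l)\<^sup>2)"
    by (rule P.mgf_imp_abs_deviation[OF measurable_weighted_trace weighted_trace_abs_le weighted_trace_mgf]) (use assms in auto)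
  then show ?thesis using assms by (simp add: real_sqrt_mult)
qed

text \<open>The quadratic form of column \<open>j\<close> in the resolvent of the other columns,
  minus its conditional mean given those columns when the entries are standardized.\<close>

definition quad_dev :: "real \<Rightarrow> nat \<Rightarrow> nat \<Rightarrow> (nat \<Rightarrow> nat \<Rightarrow> real) \<Rightarrow> nat \<Rightarrow> (nat \<Rightarrow> nat \<Rightarrow> real) \<Rightarrow> real" where
  "quad_dev l m k w j Z =
     res_form l m (map (wcols w Z) (remove1 j [0..<k])) (wcols w Z j) (wcols w Z j)
     - (\<Sum>a<m. (w j a)\<^sup>2 * res_form l m (map (wcols w Z) (remove1 j [0..<k])) (unit_fun a) (unit_fun a))"

lemma measurable_quad_dev:
  assumes "0 < l" "j < k"
  shows "quad_dev l m k w j \<in> borel_measurable (mat_law k m)"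
proof -
  have [measurable]: "(\<lambda>Z. wcols w Z j i) \<in> borel_measurable (mat_law k m)" if "i < m" for i
  proof -
    have [measurable]: "(\<lambda>Z. Z j i) \<in> borel_measurable (mat_law k m)"
      using assms that by (intro measurable_entry) auto
    show ?thesis unfolding wcols_def by measurable
  qed
  show ?thesis
    unfolding quad_dev_def using assms(1)
    by (intro borel_measurable_diff borel_measurable_sum borel_measurable_times
        borel_measurable_const measurable_res_form_wcols) (auto dest: notin_set_remove1 in_set_remove1[THEN iffD1] set_remove1_subset[THEN subsetD])
qed

text \<open>The column \<open>x\<^sub>j\<close> is independent of the resolvent built from the other columns.\<close>

lemma quad_dev_second_moment:
  assumes l: "0 < l" and w: "\<And>a. a < m \<Longrightarrow> (w j a)\<^sup>2 \<le> \<beta>" and j: "j < k" and \<beta>: "0 \<le> \<beta>"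
  shows "(\<integral>\<^sup>+Z. ennreal ((quad_dev l m k w j Z)\<^sup>2) \<partial>mat_law k m) \<le> ennreal (2 * moment 4 * (\<beta>\<^sup>2 * (real m / l\<^sup>2)))"
proof -
  let ?C = "2 * moment 4 * (\<beta>\<^sup>2 * (real m / l\<^sup>2))"
  let ?J = "{..<k} - {j}"
  interpret product_prob_space "\<lambda>_. col_law m" "{..<k}"
    by (rule product_prob_space_col_law)
  interpret PJ: prob_space "PiM ?J (\<lambda>_. col_law m)"
    by (intro prob_space_PiM prob_space_col_law)
  note [measurable] = measurable_quad_dev[OF l j]
  have ins: "insert j ?J = {..<k}" using j by auto
  have inner: "(\<integral>\<^sup>+y. ennreal ((quad_dev l m k w j (Z(j := y)))\<^sup>2) \<partial>col_law m) \<le> ennreal ?C" for Z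
  proof -
    let ?R = "res_form l m (map (wcols w Z) (remove1 j [0..<k]))"
    note R = is_resolvent_res_form[OF l, of m "map (wcols w Z) (remove1 j [0..<k])"]
    let ?I = "{..<m} \<times> {..<m}"
    \<comment> \<open>The weights of column \<open>j\<close> are moved into the matrix, leaving a
      vector \<open>y\<close> with standardized coordinates.\<close>
    define A where "A q = w j (fst q) * w j (snd q) * ?R (unit_fun (fst q)) (unit_fun (snd q))" for q
    have eq: "quad_dev l m k w j (Z(j := y)) = (\<Sum>q\<in>?I. A q * quad2 y q)" for y
    proof -
      let ?x = "\<lambda>i. w j i * y i"
      have c: "wcols w (Z(j := y)) j = ?x" by (auto simp: wcols_def)
      have rm: "map (wcols w (Z(j := y))) (remove1 j [0..<k]) = map (wcols w Z) (remove1 j [0..<k])"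
        by (rule map_wcols_upd) auto
      have "?R ?x ?x = (\<Sum>a<m. ?x a * (\<Sum>b<m. ?x b * ?R (unit_fun b) (unit_fun a)))"
        by (subst is_resolvent_rep[OF R], subst is_resolvent_sym[OF R], subst is_resolvent_rep[OF R])
          (rule refl)
      also have "\<dots> = (\<Sum>a<m. \<Sum>b<m. A (a, b) * (y a * y b))"
        unfolding sum_distrib_left A_def
        by (intro sum.cong refl) (simp add: is_resolvent_sym[OF R, of "unit_fun _" "unit_fun _"] mult_ac)
      finally have 1: "?R ?x ?x = (\<Sum>a<m. \<Sum>b<m. A (a, b) * (y a * y b))" .
      have 2: "(\<Sum>a<m. (w j a)\<^sup>2 * ?R (unit_fun a) (unit_fun a)) = (\<Sum>a<m. \<Sum>b<m. A (a, b) * of_bool (a = b))"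
        by (intro sum.cong refl) (simp add: A_def power2_eq_square mult.commute[of _ "of_bool _"])
      show ?thesis
        unfolding quad_dev_def c rm 1 2
        by (simp add: quad2_def sum.cartesian_product' right_diff_distrib sum_subtractf)
    qed
    have "(\<Sum>q\<in>?I. (A q)\<^sup>2) \<le> (\<Sum>q\<in>?I. \<beta>\<^sup>2 * (?R (unit_fun (fst q)) (unit_fun (snd q)))\<^sup>2)"
    proof (rule sum_mono)
      fix q assume "q \<in> ?I"
      then have "(w j (fst q))\<^sup>2 * (w j (snd q))\<^sup>2 \<le> \<beta> * \<beta>"
        using w \<beta> by (intro mult_mono) auto
      then show "(A q)\<^sup>2 \<le> \<beta>\<^sup>2 * (?R (unit_fun (fst q)) (unit_fun (snd q)))\<^sup>2"
        unfolding A_def power_mult_distrib by (simp add: power2_eq_square mult_right_mono)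
    qed
    also have "\<dots> = \<beta>\<^sup>2 * (\<Sum>a<m. \<Sum>b<m. (?R (unit_fun a) (unit_fun b))\<^sup>2)"
      by (simp add: sum.cartesian_product' flip: sum_distrib_left)
    also have "\<dots> \<le> \<beta>\<^sup>2 * (real m / l\<^sup>2)"
      by (intro mult_left_mono res_form_frobenius_le l) auto
    finally have A: "2 * moment 4 * (\<Sum>q\<in>?I. (A q)\<^sup>2) \<le> ?C"
      using moment4_ge_1 by (intro mult_left_mono) auto
    have "(\<integral>\<^sup>+y. ennreal ((quad_dev l m k w j (Z(j := y)))\<^sup>2) \<partial>col_law m)
        = ennreal (\<integral>y. (\<Sum>q\<in>?I. A q * quad2 y q)\<^sup>2 \<partial>col_law m)"
      unfolding eq by (rule nn_integral_eq_integral[OF quadratic_form_variance(1)]) auto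
    also have "\<dots> \<le> ennreal ?C"
      using order_trans[OF quadratic_form_variance(2) A] by (rule ennreal_leI)
    finally show ?thesis .
  qed
  have mq: "(\<lambda>Z. ennreal ((quad_dev l m k w j Z)\<^sup>2)) \<in> borel_measurable (PiM (insert j ?J) (\<lambda>_. col_law m))"
    unfolding ins by measurable
  have "(\<integral>\<^sup>+Z. ennreal ((quad_dev l m k w j Z)\<^sup>2) \<partial>PiM (insert j ?J) (\<lambda>_. col_law m))
      = (\<integral>\<^sup>+Z. \<integral>\<^sup>+y. ennreal ((quad_dev l m k w j (Z(j := y)))\<^sup>2) \<partial>col_law m \<partial>PiM ?J (\<lambda>_. col_law m))"
    by (rule product_nn_integral_insert[OF _ _ mq]) auto
  also have "\<dots> \<le> (\<integral>\<^sup>+Z. ennreal ?C \<partial>PiM ?J (\<lambda>_. col_law m))"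
    by (intro nn_integral_mono inner)
  also have "\<dots> = ennreal ?C" by (simp add: PJ.emeasure_space_1)
  finally show ?thesis unfolding ins .
qed

text \<open>The map x \<mapsto> 1 / (l (1 + x)) is Lipschitz with constant 1 / l on nonnegative x,
  so the distance from the quadratic form to the mean weighted trace decides. It splits into the
  deviation of the form from its conditional mean, the cost \<beta> / l of reinserting column
  \<open>j\<close> into the trace, and the deviation of the trace from its mean. These give the
  three summands of the bound, in this order; for \<beta> of order 1/n and \<open>k\<close>,
  \<open>m\<close> of order n it is of order 1 / sqrt n.\<close>

lemma resolvent_diag_approx_mat_law:
  assumes l: "0 < l" and w: "\<And>a. a < m \<Longrightarrow> (w j a)\<^sup>2 \<le> \<beta>" and j: "j < k" and \<beta>: "0 < \<beta>" and m: "0 < m"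
  shows "\<bar>(\<integral>Z. res_form l k (map (\<lambda>i j. wcols w Z j i) [0..<m]) (unit_fun j) (unit_fun j) \<partial>mat_law k m)
      - 1 / (l * (1 + (\<Sum>a<m. (w j a)\<^sup>2 *
          (\<integral>Z. res_form l m (map (wcols w Z) [0..<k]) (unit_fun a) (unit_fun a) \<partial>mat_law k m))))\<bar>
    \<le> \<beta> / l\<^sup>2 * (sqrt (2 * moment 4 * real m) + 1 + 3 * sqrt (real k))"
proof -
  interpret P: prob_space "mat_law k m" by (rule prob_space_mat_law)
  let ?b = "\<lambda>a. (w j a)\<^sup>2"
  let ?f = "weighted_trace l m k w ?b"
  let ?R = "\<lambda>Z. map (wcols w Z) (remove1 j [0..<k])"
  define a where "a Z = res_form l m (?R Z) (wcols w Z j) (wcols w Z j)" for Z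
  define s where "s = P.expectation ?f"
  have k: "0 < k" using j by simp
  note mf[measurable] = measurable_weighted_trace[OF l, of m k w ?b] and mq[measurable] = measurable_quad_dev[OF l j, of m w]
  have C: "0 < 2 * moment 4 * (\<beta>\<^sup>2 * (real m / l\<^sup>2))"
    using moment4_ge_1 \<beta> l m by simp
  note Q = P.abs_le_sqrt_second_moment[OF mq C quad_dev_second_moment[where w = w, OF l w j less_imp_le[OF \<beta>]]]
  have int_f: "integrable (mat_law k m) ?f"
    by (rule integrable_bounded_on_space[OF P.finite_measure_axioms mf weighted_trace_abs_le[OF l]]) (use w in auto)
  have int_res_form: "integrable (mat_law k m) (\<lambda>Z. res_form l m (map (wcols w Z) [0..<k]) (unit_fun a) (unit_fun a))" if "a < m" for a
    by (rule integrable_bounded_on_space[OF P.finite_measure_axioms _ res_form_unit_fun_abs_le[OF l that]])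
      (rule measurable_res_form_wcols[OF l], auto)
  have s: "s = (\<Sum>a<m. ?b a * (\<integral>Z. res_form l m (map (wcols w Z) [0..<k]) (unit_fun a) (unit_fun a) \<partial>mat_law k m))"
    unfolding s_def weighted_trace_def using int_res_form by (simp add: Bochner_Integration.integral_sum)
  have s0: "0 \<le> s" unfolding s_def weighted_trace_def
    by (intro integral_nonneg_AE AE_I2 sum_nonneg mult_nonneg_nonneg res_form_nonneg l) auto
  have a0: "0 \<le> a Z" for Z unfolding a_def by (rule res_form_nonneg[OF l])
  have row: "res_form l k (map (\<lambda>i j. wcols w Z j i) [0..<m]) (unit_fun j) (unit_fun j) = 1 / (l * (1 + a Z))" for Z
    unfolding a_def by (rule res_form_rows_diag[OF l j])
  have ma[measurable]: "a \<in> borel_measurable (mat_law k m)"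
  proof -
    have "(\<lambda>Z. \<Sum>a<m. ?b a * res_form l m (?R Z) (unit_fun a) (unit_fun a)) \<in> borel_measurable (mat_law k m)"
      by (intro borel_measurable_sum borel_measurable_times borel_measurable_const measurable_res_form_wcols l)
        (auto dest: notin_set_remove1 set_remove1_subset[THEN subsetD])
    then have "(\<lambda>Z. quad_dev l m k w j Z + (\<Sum>a<m. ?b a * res_form l m (?R Z) (unit_fun a) (unit_fun a)))
        \<in> borel_measurable (mat_law k m)" by measurable
    moreover have "a = (\<lambda>Z. quad_dev l m k w j Z + (\<Sum>a<m. ?b a * res_form l m (?R Z) (unit_fun a) (unit_fun a)))"
      by (auto simp: quad_dev_def a_def)
    ultimately show ?thesis by simp
  qed
  have dev: "\<bar>a Z - s\<bar> \<le> \<bar>quad_dev l m k w j Z\<bar> + \<beta> / l + \<bar>?f Z - s\<bar>" for Z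
  proof -
    let ?g = "\<lambda>xs. \<Sum>a<m. ?b a * res_form l m xs (unit_fun a) (unit_fun a)"
    have f: "?f Z = ?g (wcols w Z j # ?R Z)"
      unfolding weighted_trace_def res_form_remove1[OF l j, of m "wcols w Z"] ..
    have "\<bar>?g (?R Z) - ?f Z\<bar> \<le> \<beta> / l" unfolding f
      using weighted_trace_res_form_Cons[OF l, where m = m and b = ?b and \<beta> = \<beta> and x = "wcols w Z j" and xs = "?R Z"] w \<beta>
      by (simp add: abs_le_iff del: res_form.simps)
    moreover have "a Z = quad_dev l m k w j Z + ?g (?R Z)"
      by (simp add: quad_dev_def a_def)
    ultimately show ?thesis by linarith
  qed
  have pt: "\<bar>1 / (l * (1 + a Z)) - 1 / (l * (1 + s))\<bar> \<le> 1 / l * (\<bar>quad_dev l m k w j Z\<bar> + \<beta> / l + \<bar>?f Z - s\<bar>)" for Z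
  proof -
    have "1 / (l * (1 + a Z)) - 1 / (l * (1 + s)) = 1 / l * ((s - a Z) / ((1 + a Z) * (1 + s)))"
    proof -
      have "1 / (l * A) - 1 / (l * S) = 1 / l * ((S - A) / (A * S))" if "0 < A" "0 < S" for A S
        using l that by (simp add: field_simps)
      from this[of "1 + a Z" "1 + s"] show ?thesis using a0[of Z] s0 by simp
    qed
    also have "\<bar>\<dots>\<bar> = 1 / l * (\<bar>a Z - s\<bar> / ((1 + a Z) * (1 + s)))"
      using l a0[of Z] s0 by (simp add: abs_mult abs_minus_commute)
    also have "\<dots> \<le> 1 / l * (\<bar>a Z - s\<bar> / 1)"
    proof (intro mult_left_mono divide_left_mono)
      show "1 \<le> (1 + a Z) * (1 + s)"
        using a0[of Z] s0 mult_mono[of 1 "1 + a Z" 1 "1 + s"] by simp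
    qed (use l a0[of Z] s0 in auto)
    also have "\<dots> \<le> 1 / l * (\<bar>quad_dev l m k w j Z\<bar> + \<beta> / l + \<bar>?f Z - s\<bar>)"
      using dev[of Z] l by (intro mult_left_mono) auto
    finally show ?thesis .
  qed
  have int1: "integrable (mat_law k m) (\<lambda>Z. 1 / (l * (1 + a Z)))"
  proof (rule integrable_bounded_on_space[OF P.finite_measure_axioms])
    show "\<bar>1 / (l * (1 + a Z))\<bar> \<le> 1 / l" for Z
    proof -
      have "l * 1 \<le> l * (1 + a Z)" using a0[of Z] l by (intro mult_left_mono) auto
      then have "1 / (l * (1 + a Z)) \<le> 1 / l"
        using l a0[of Z] by (intro divide_left_mono) auto
      then show ?thesis using l a0[of Z] by simp
    qed
  qed measurable
  have "\<bar>(\<integral>Z. 1 / (l * (1 + a Z)) \<partial>mat_law k m) - 1 / (l * (1 + s))\<bar>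
      = \<bar>\<integral>Z. 1 / (l * (1 + a Z)) - 1 / (l * (1 + s)) \<partial>mat_law k m\<bar>"
    using int1 by (simp add: P.prob_space)
  also have "\<dots> \<le> (\<integral>Z. \<bar>1 / (l * (1 + a Z)) - 1 / (l * (1 + s))\<bar> \<partial>mat_law k m)"
    by (rule integral_abs_bound)
  also have "\<dots> \<le> (\<integral>Z. 1 / l * (\<bar>quad_dev l m k w j Z\<bar> + \<beta> / l + \<bar>?f Z - s\<bar>) \<partial>mat_law k m)"
    by (intro integral_mono pt) (use int1 Q(1) int_f in auto)
  also have "\<dots> = 1 / l * ((\<integral>Z. \<bar>quad_dev l m k w j Z\<bar> \<partial>mat_law k m) + \<beta> / l + (\<integral>Z. \<bar>?f Z - s\<bar> \<partial>mat_law k m))"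
    using Q(1) int_f by (simp add: P.prob_space)
  also have "\<dots> \<le> 1 / l * (sqrt (2 * moment 4 * (\<beta>\<^sup>2 * (real m / l\<^sup>2))) + \<beta> / l + 3 * sqrt (real k) * (\<beta> / l))"
    using Q(2) weighted_trace_abs_deviation[OF l _ w \<beta> k, where w = w] l unfolding s_def
    by (intro mult_left_mono add_mono) auto
  also have "2 * moment 4 * (\<beta>\<^sup>2 * (real m / l\<^sup>2)) = (2 * moment 4 * real m) * (\<beta> / l)\<^sup>2"
    by (simp add: power_divide)
  also have "sqrt \<dots> = sqrt (2 * moment 4 * real m) * (\<beta> / l)"
    using \<beta> l by (simp only: real_sqrt_mult real_sqrt_abs abs_of_pos divide_pos_pos)
  also have "1 / l * (sqrt (2 * moment 4 * real m) * (\<beta> / l) + \<beta> / l + 3 * sqrt (real k) * (\<beta> / l))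
      = \<beta> / l\<^sup>2 * (sqrt (2 * moment 4 * real m) + 1 + 3 * sqrt (real k))"
    by (simp add: power2_eq_square algebra_simps add_divide_distrib)
  finally show ?thesis unfolding row s .
qed

end

section \<open>Stability of the deterministic system\<close>

text \<open>For K \<ge> 1 the quotient (1 + K s) / (1 + s) increases in s, hence is largest at s =
  S. The value there is strictly below K when K > 1 and S > 0, which is the source of the
  contraction.\<close>

lemma phi_ratio_lower:
  fixes s s' S K :: real
  assumes "0 \<le> s" "s \<le> S" "1 \<le> K" "0 \<le> s'" "s' \<le> K * s"
  shows "1 + s' \<le> (1 + K * S) / (1 + S) * (1 + s)"
proof -
  have "(1 + K * s) * (1 + S) \<le> (1 + K * S) * (1 + s)"
  proof -
    have "(1 + K * S) * (1 + s) - (1 + K * s) * (1 + S) = (K - 1) * (S - s)"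
      by (simp add: algebra_simps)
    moreover have "0 \<le> (K - 1) * (S - s)" using assms by (intro mult_nonneg_nonneg) auto
    ultimately show ?thesis by linarith
  qed
  then have "1 + K * s \<le> (1 + K * S) / (1 + S) * (1 + s)"
    using assms by (simp add: field_simps)
  then show ?thesis using assms by linarith
qed

text \<open>
  Thompson-metric stability: if \<open>K\<close> is the largest ratio between two approximate positive solutions,
  one application of the map \<open>s \<mapsto> 1 / (l (1 + s))\<close> improves it to \<open>(1 + K S) / (1 + S)\<close>, and the
  errors spoil it by at most the factor \<open>1 + \<eta>\<close>.
\<close>

lemma system_stability:
  fixes b :: "nat \<Rightarrow> nat \<Rightarrow> real" and t q :: "nat \<Rightarrow> real" and t' q' :: "nat \<Rightarrow> real"
  assumes l: "0 < l" and S: "0 < S" and p: "0 < p"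
    and b: "\<And>i j. i < n \<Longrightarrow> j < p \<Longrightarrow> 0 \<le> b i j"
    and t: "\<And>j. j < p \<Longrightarrow> t j = 1 / (l * (1 + (\<Sum>i<n. b i j * t' i)))"
    and t': "\<And>i. i < n \<Longrightarrow> t' i = 1 / (l * (1 + (\<Sum>j<p. b i j * t j)))"
    and q: "\<And>j. j < p \<Longrightarrow> \<bar>q j - 1 / (l * (1 + (\<Sum>i<n. b i j * q' i)))\<bar> \<le> \<epsilon>"
    and q': "\<And>i. i < n \<Longrightarrow> \<bar>q' i - 1 / (l * (1 + (\<Sum>j<p. b i j * q j)))\<bar> \<le> \<epsilon>"
    and t0: "\<And>j. j < p \<Longrightarrow> 0 \<le> t j" "\<And>i. i < n \<Longrightarrow> 0 \<le> t' i"
    and q0: "\<And>j. j < p \<Longrightarrow> 0 \<le> q j" "\<And>i. i < n \<Longrightarrow> 0 \<le> q' i"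
    and q1: "\<And>j. j < p \<Longrightarrow> q j \<le> 1 / l"
    and St: "\<And>j. j < p \<Longrightarrow> (\<Sum>i<n. b i j * t' i) \<le> S" "\<And>i. i < n \<Longrightarrow> (\<Sum>j<p. b i j * t j) \<le> S"
    and Sq: "\<And>j. j < p \<Longrightarrow> (\<Sum>i<n. b i j * q' i) \<le> S" "\<And>i. i < n \<Longrightarrow> (\<Sum>j<p. b i j * q j) \<le> S"
    and \<eta>: "\<eta> = 2 * \<epsilon> * l * (1 + S)" "\<eta> \<le> 1" "\<eta> * S < 1" and j: "j < p"
  shows "\<bar>q j - t j\<bar> \<le> ((1 + \<eta>) / (1 - \<eta> * S) - 1) / l"
proof -
  \<comment> \<open>The least value of the map on the interval from 0 to S. It bounds the exact
    solution below; since \<epsilon> \<le> lo / 2, the approximate one is at least lo / 2, so all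
    ratios below are defined.\<close>
  define lo where "lo = 1 / (l * (1 + S))"
  have lo0: "0 < lo" using l S by (simp add: lo_def)
  have phi_lo: "lo \<le> 1 / (l * (1 + s))" if "0 \<le> s" "s \<le> S" for s
    unfolding lo_def using that l by (intro divide_left_mono mult_left_mono mult_pos_pos) auto
  have phi_hi: "1 / (l * (1 + s)) \<le> 1 / l" if "0 \<le> s" for s
  proof -
    have "l * 1 \<le> l * (1 + s)" using that l by (intro mult_left_mono) auto
    then show ?thesis using l that by (intro divide_left_mono) auto
  qed
  have \<epsilon>0: "0 \<le> \<epsilon>" using q[OF p] by linarith
  have \<epsilon>_lo: "2 * \<epsilon> = \<eta> * lo" using \<eta>(1) l S by (simp add: lo_def)
  have \<epsilon>_half: "\<epsilon> \<le> lo / 2"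
    using \<epsilon>_lo \<eta>(2) mult_right_mono[OF \<eta>(2) less_imp_le[OF lo0]] by linarith
  have \<eta>0: "0 \<le> \<eta>" using \<epsilon>0 l S \<eta>(1) by simp
  define \<Phi> where "\<Phi> s = 1 / (l * (1 + s))" for s :: real
  have phi_mono: "\<Phi> b \<le> c * \<Phi> a" if "0 \<le> b" "0 \<le> a" "1 + a \<le> c * (1 + b)" for a b c
  proof -
    have "1 / B \<le> c * (1 / A)" if "0 < A" "0 < B" "A \<le> c * B" for A B :: real
      using that by (simp add: field_simps)
    moreover have "l * (1 + a) \<le> c * (l * (1 + b))"
      using mult_left_mono[OF that(3), of l] l by (simp add: mult_ac)
    ultimately show ?thesis using that l by (simp add: \<Phi>_def)
  qed
  have nn: "0 \<le> (\<Sum>i<n. b i j * t' i)" "0 \<le> (\<Sum>i<n. b i j * q' i)" if "j < p" for j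
    using that b t0 q0 by (auto intro!: sum_nonneg mult_nonneg_nonneg)
  have nn': "0 \<le> (\<Sum>j<p. b i j * t j)" "0 \<le> (\<Sum>j<p. b i j * q j)" if "i < n" for i
    using that b t0 q0 by (auto intro!: sum_nonneg mult_nonneg_nonneg)
  have tlo: "lo \<le> t j" "t j \<le> 1 / l" if "j < p" for j
    using t[OF that] phi_lo[OF nn(1) St(1)] phi_hi[OF nn(1)] that by auto
  have tlo': "lo \<le> t' i" if "i < n" for i
    using t'[OF that] phi_lo[OF nn'(1) St(2)] that by auto
  have qlo: "lo / 2 \<le> q j" if "j < p" for j
    using abs_le_D2[OF q[OF that]] phi_lo[OF nn(2)[OF that] Sq(1)[OF that]] \<epsilon>_half by linarith
  have qlo': "lo / 2 \<le> q' i" if "i < n" for i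
    using abs_le_D2[OF q'[OF that]] phi_lo[OF nn'(2)[OF that] Sq(2)[OF that]] \<epsilon>_half by linarith
  \<comment> \<open>Both quotients are included for every index, so the maximum controls the two
    solutions in both directions and is at least 1.\<close>
  define R where "R = (\<lambda>j. q j / t j) ` {..<p} \<union> (\<lambda>j. t j / q j) ` {..<p}
      \<union> (\<lambda>i. q' i / t' i) ` {..<n} \<union> (\<lambda>i. t' i / q' i) ` {..<n}"
  define K where "K = Max R"
  have finR: "finite R" by (simp add: R_def)
  have Rne: "R \<noteq> {}" using p by (auto simp: R_def)
  have RK: "r \<le> K" if "r \<in> R" for r unfolding K_def using finR that by (rule Max_ge)
  have qt: "q j \<le> K * t j" "t j \<le> K * q j" if "j < p" for j
  proof -
    have "q j / t j \<le> K" "t j / q j \<le> K" using that by (auto intro!: RK simp: R_def)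
    moreover have "0 < t j" "0 < q j" using tlo(1)[OF that] qlo[OF that] lo0 by linarith+
    ultimately show "q j \<le> K * t j" "t j \<le> K * q j" by (simp_all add: divide_le_eq)
  qed
  have qt': "q' i \<le> K * t' i" "t' i \<le> K * q' i" if "i < n" for i
  proof -
    have "q' i / t' i \<le> K" "t' i / q' i \<le> K" using that by (auto intro!: RK simp: R_def)
    moreover have "0 < t' i" "0 < q' i" using tlo'[OF that] qlo'[OF that] lo0 by linarith+
    ultimately show "q' i \<le> K * t' i" "t' i \<le> K * q' i" by (simp_all add: divide_le_eq)
  qed
  have K1: "1 \<le> K"
  proof (rule ccontr)
    assume "\<not> 1 \<le> K"
    moreover have "0 < t 0" "0 < q 0" using tlo(1)[OF p] qlo[OF p] lo0 by linarith+
    ultimately have "K * t 0 < t 0" "K * q 0 < q 0" by auto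
    then show False using qt[OF p] by linarith
  qed
  define K' where "K' = (1 + K * S) / (1 + S)"
  have K'1: "1 \<le> K'" unfolding K'_def using K1 S by simp
  \<comment> \<open>The two inequalities are treated alike; \<open>x\<close> is exact and \<open>y\<close> approximate.\<close>
  have step: "y \<le> K' * (1 + \<eta>) * x \<and> x \<le> K' * (1 + \<eta>) * y"
    if x: "x = \<Phi> sx" and y: "\<bar>y - \<Phi> sy\<bar> \<le> \<epsilon>" and sx: "0 \<le> sx" "sx \<le> S"
      and sy: "0 \<le> sy" "sy \<le> S" and sxy: "sx \<le> K * sy" "sy \<le> K * sx" and ylo: "lo / 2 \<le> y" for x y sx sy
  proof -
    have 1: "\<Phi> sy \<le> K' * \<Phi> sx"
    proof -
      have "1 + sx \<le> K' * (1 + sy)" unfolding K'_def by (rule phi_ratio_lower[OF sy K1 sx(1) sxy(1)])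
      then show ?thesis by (rule phi_mono[OF sy(1) sx(1)])
    qed
    have 2: "\<Phi> sx \<le> K' * \<Phi> sy"
    proof -
      have "1 + sy \<le> K' * (1 + sx)" unfolding K'_def by (rule phi_ratio_lower[OF sx K1 sy(1) sxy(2)])
      then show ?thesis by (rule phi_mono[OF sx(1) sy(1)])
    qed
    have xlo: "lo \<le> x" unfolding x \<Phi>_def by (rule phi_lo[OF sx])
    have "\<epsilon> \<le> \<eta> * x"
      using \<epsilon>_lo mult_left_mono[OF xlo \<eta>0] \<epsilon>0 by linarith
    also have "\<dots> \<le> K' * (\<eta> * x)"
    proof -
      have "0 \<le> \<eta> * x" using \<eta>0 xlo lo0 by simp
      from mult_right_mono[OF K'1 this] show ?thesis by simp
    qed
    finally have "y \<le> K' * x + K' * (\<eta> * x)" using y 1[folded x] by linarith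
    \<comment> \<open>The additive error becomes multiplicative. Only y \<ge> lo / 2 is available
      here, whence the factor 2 in \<eta>.\<close>
    moreover have "\<epsilon> \<le> \<eta> * y"
      using \<epsilon>_lo mult_left_mono[OF ylo \<eta>0] by linarith
    then have "\<Phi> sy \<le> y + \<eta> * y" using y by linarith
    then have "K' * \<Phi> sy \<le> K' * (y + \<eta> * y)" using K'1 by (intro mult_left_mono) auto
    then have "x \<le> K' * (y + \<eta> * y)" using 2[folded x] by linarith
    ultimately show ?thesis by (simp add: algebra_simps)
  qed
  have sumK: "(\<Sum>a\<in>A. f a * g a) \<le> K * (\<Sum>a\<in>A. f a * h a)"
    if "\<And>a. a \<in> A \<Longrightarrow> 0 \<le> f a" "\<And>a. a \<in> A \<Longrightarrow> g a \<le> K * h a" for A :: "nat set" and f g h :: "nat \<Rightarrow> real"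
  proof -
    have "(\<Sum>a\<in>A. f a * g a) \<le> (\<Sum>a\<in>A. f a * (K * h a))"
      using that by (intro sum_mono mult_left_mono) auto
    then show ?thesis by (simp add: sum_distrib_left mult_ac)
  qed
  have stepj: "q j \<le> K' * (1 + \<eta>) * t j \<and> t j \<le> K' * (1 + \<eta>) * q j" if "j < p" for j
    by (rule step[of _ "\<Sum>i<n. b i j * t' i" _ "\<Sum>i<n. b i j * q' i"])
      (use that t q nn St Sq qlo b qt' in \<open>auto simp: \<Phi>_def intro!: sumK\<close>)
  have stepi: "q' i \<le> K' * (1 + \<eta>) * t' i \<and> t' i \<le> K' * (1 + \<eta>) * q' i" if "i < n" for i
    by (rule step[of _ "\<Sum>j<p. b i j * t j" _ "\<Sum>j<p. b i j * q j"])
      (use that t' q' nn' St Sq qlo' b qt in \<open>auto simp: \<Phi>_def intro!: sumK\<close>)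
  have "K \<le> K' * (1 + \<eta>)"
    unfolding K_def
  proof (rule Max.boundedI[OF finR Rne])
    fix r assume "r \<in> R"
    then consider (j) j where "j < p" "r = q j / t j \<or> r = t j / q j"
      | (i) i where "i < n" "r = q' i / t' i \<or> r = t' i / q' i"
      by (auto simp: R_def)
    then show "r \<le> K' * (1 + \<eta>)"
    proof cases
      case j
      then have "0 < t j" "0 < q j" using tlo(1)[of j] qlo[of j] lo0 by linarith+
      then show ?thesis using j stepj[of j] by (auto simp: divide_le_eq)
    next
      case i
      then have "0 < t' i" "0 < q' i" using tlo'[of i] qlo'[of i] lo0 by linarith+
      then show ?thesis using i stepi[of i] by (auto simp: divide_le_eq)
    qed
  qed
  \<comment> \<open>The improved bound holds for every member of \<open>R\<close>, hence for the
    maximum itself, which gives a linear inequality in K.\<close>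
  then have "K * (1 + S) \<le> (1 + K * S) * (1 + \<eta>)"
    unfolding K'_def using S by (simp add: field_simps)
  then have "K * (1 - \<eta> * S) \<le> 1 + \<eta>" by (simp add: algebra_simps)
  then have Kb: "K \<le> (1 + \<eta>) / (1 - \<eta> * S)" using \<eta>(3) by (simp add: pos_le_divide_eq)
  have "q j - t j \<le> (K - 1) * t j" using qt(1)[OF j] by (simp add: algebra_simps)
  also have "\<dots> \<le> (K - 1) * (1 / l)" using K1 tlo(2)[OF j] by (intro mult_left_mono) auto
  finally have u: "q j - t j \<le> (K - 1) / l" by simp
  have "t j - q j \<le> (K - 1) * q j" using qt(2)[OF j] by (simp add: algebra_simps)
  also have "\<dots> \<le> (K - 1) * (1 / l)" using K1 q1[OF j] by (intro mult_left_mono) auto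
  finally have v: "t j - q j \<le> (K - 1) / l" by simp
  have "(K - 1) / l \<le> ((1 + \<eta>) / (1 - \<eta> * S) - 1) / l"
    using Kb l by (intro divide_right_mono) auto
  then show ?thesis using u v by linarith
qed

section \<open>Transfer from product laws to the given probability space\<close>

text \<open>Injectivity makes the singleton blocks \<open>{f i}\<close> disjoint, and families over
  disjoint blocks are independent. Used to extract a column and to transpose the matrix.\<close>

lemma (in prob_space) indep_vars_reindex_inj:
  assumes ind: "indep_vars M' X J" and f: "inj_on f I" "f ` I \<subseteq> J"
  shows "indep_vars (\<lambda>i. M' (f i)) (\<lambda>i. X (f i)) I"
proof -
  have "indep_vars (\<lambda>i. PiM {f i} M') (\<lambda>i \<omega>. restrict (\<lambda>q. X q \<omega>) {f i}) I"
    using f by (intro indep_vars_restrict[OF ind]) (auto simp: disjoint_family_on_def inj_on_def)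
  then have "indep_vars (\<lambda>i. M' (f i)) (\<lambda>i \<omega>. (restrict (\<lambda>q. X q \<omega>) {f i}) (f i)) I"
    by (rule indep_vars_compose2) (auto intro: measurable_component_singleton)
  then show ?thesis by simp
qed

text \<open>Product measures live on functions restricted to the index set, while the random matrix
  is arbitrary outside its block. Weights vanishing outside the block remove the difference.\<close>

lemma wcols_restrict:
  assumes "\<And>j i. \<not> (j < k \<and> i < m) \<Longrightarrow> w j i = 0"
  shows "wcols w (\<lambda>j\<in>{..<k}. \<lambda>i\<in>{..<m}. z j i) = wcols w z"
  using assms by (fastforce simp: wcols_def fun_eq_iff)

context standardized_law
begin

context
  fixes M :: "'w measure" and Z :: "nat \<Rightarrow> nat \<Rightarrow> 'w \<Rightarrow> real" and k m :: nat
  assumes M: "prob_space M"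
    and ind: "prob_space.indep_vars M (\<lambda>_. borel) (\<lambda>(j, i). Z j i) ({..<k} \<times> {..<m})"
    and law: "\<And>j i. j < k \<Longrightarrow> i < m \<Longrightarrow> distr M borel (Z j i) = L"
    and km: "0 < k" "0 < m"
begin

lemma Z_measurable: "j < k \<Longrightarrow> i < m \<Longrightarrow> Z j i \<in> borel_measurable M"
  using ind unfolding prob_space.indep_vars_def[OF M] by auto

lemma sets_col_law: "sets (col_law m) = sets (PiM {..<m} (\<lambda>_. borel))"
  by (intro sets_PiM_cong refl sets_L)

lemma column_measurable: "j < k \<Longrightarrow> (\<lambda>\<omega>. \<lambda>i\<in>{..<m}. Z j i \<omega>) \<in> measurable M (col_law m)"
  unfolding measurable_cong_sets[OF refl sets_col_law] by (intro measurable_restrict Z_measurable) auto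

lemma matrix_measurable: "(\<lambda>\<omega>. \<lambda>j\<in>{..<k}. \<lambda>i\<in>{..<m}. Z j i \<omega>) \<in> measurable M (mat_law k m)"
  by (intro measurable_restrict column_measurable) auto

lemma distr_column:
  assumes j: "j < k"
  shows "distr M (col_law m) (\<lambda>\<omega>. \<lambda>i\<in>{..<m}. Z j i \<omega>) = col_law m"
proof -
  interpret M: prob_space M by (rule M)
  have "M.indep_vars (\<lambda>i. borel) (\<lambda>i. (\<lambda>(j, i). Z j i) (j, i)) {..<m}"
    by (rule M.indep_vars_reindex_inj[OF ind, of "\<lambda>i. (j, i)"]) (use j in \<open>auto simp: inj_on_def\<close>)
  then have "M.indep_vars (\<lambda>_. borel) (Z j) {..<m}" by simp
  then have "distr M (PiM {..<m} (\<lambda>_. borel)) (\<lambda>\<omega>. \<lambda>i\<in>{..<m}. Z j i \<omega>)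
      = PiM {..<m} (\<lambda>i. distr M borel (Z j i))"
    using km j by (subst (asm) M.indep_vars_iff_distr_eq_PiM') (auto intro: Z_measurable)
  also have "\<dots> = col_law m" using j by (intro PiM_cong) (auto simp: law)
  finally show ?thesis
    by (subst distr_cong[OF refl sets_col_law refl])
qed

text \<open>The index sets of distinct columns are disjoint, so the columns are independent as
  random vectors; each has law \<open>col_law m\<close>, and the joint law is the iterated
  product.\<close>

lemma distr_matrix: "distr M (mat_law k m) (\<lambda>\<omega>. \<lambda>j\<in>{..<k}. \<lambda>i\<in>{..<m}. Z j i \<omega>) = mat_law k m"
proof -
  interpret M: prob_space M by (rule M)
  let ?K = "\<lambda>j. {j} \<times> {..<m}"
  have "M.indep_vars (\<lambda>j. PiM (?K j) (\<lambda>_. borel)) (\<lambda>j \<omega>. restrict (\<lambda>q. (\<lambda>(j, i). Z j i) q \<omega>) (?K j)) {..<k}"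
    by (intro M.indep_vars_restrict[OF ind]) (auto simp: disjoint_family_on_def)
  then have "M.indep_vars (\<lambda>_. col_law m) (\<lambda>j \<omega>. (\<lambda>y. \<lambda>i\<in>{..<m}. y (j, i))
      (restrict (\<lambda>q. (\<lambda>(j, i). Z j i) q \<omega>) (?K j))) {..<k}"
  proof (rule M.indep_vars_compose2)
    show "(\<lambda>y. \<lambda>i\<in>{..<m}. y (j, i)) \<in> measurable (PiM (?K j) (\<lambda>_. borel)) (col_law m)" for j
      unfolding measurable_cong_sets[OF refl sets_col_law]
      by (intro measurable_restrict measurable_component_singleton) auto
  qed
  moreover have "(\<lambda>i\<in>{..<m}. (restrict (\<lambda>q. (\<lambda>(j, i). Z j i) q \<omega>) (?K j)) (j, i)) = (\<lambda>i\<in>{..<m}. Z j i \<omega>)" for j \<omega>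
    by (intro restrict_ext) auto
  ultimately have "M.indep_vars (\<lambda>_. col_law m) (\<lambda>j \<omega>. \<lambda>i\<in>{..<m}. Z j i \<omega>) {..<k}"
    by simp
  then have "distr M (mat_law k m) (\<lambda>\<omega>. \<lambda>j\<in>{..<k}. \<lambda>i\<in>{..<m}. Z j i \<omega>)
      = PiM {..<k} (\<lambda>j. distr M (col_law m) (\<lambda>\<omega>. \<lambda>i\<in>{..<m}. Z j i \<omega>))"
    using km by (subst (asm) M.indep_vars_iff_distr_eq_PiM') (auto intro: column_measurable)
  also have "\<dots> = mat_law k m" by (intro PiM_cong) (auto simp: distr_column)
  finally show ?thesis .
qed

lemma integral_matrix:
  fixes F :: "(nat \<Rightarrow> nat \<Rightarrow> real) \<Rightarrow> real"
  assumes "F \<in> borel_measurable (mat_law k m)"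
  shows "(\<integral>\<omega>. F (\<lambda>j\<in>{..<k}. \<lambda>i\<in>{..<m}. Z j i \<omega>) \<partial>M) = (\<integral>z. F z \<partial>mat_law k m)"
  using integral_distr[OF matrix_measurable assms] by (simp add: distr_matrix)

context
  fixes w :: "nat \<Rightarrow> nat \<Rightarrow> real" and l :: real
  assumes w: "\<And>j i. \<not> (j < k \<and> i < m) \<Longrightarrow> w j i = 0" and l: "0 < l"
begin

lemma wcols_restrict_w: "wcols w (\<lambda>j\<in>{..<k}. \<lambda>i\<in>{..<m}. z j i) = wcols w z"
  using w by (rule wcols_restrict)

lemma measurable_res_form_matrix:
  "(\<lambda>\<omega>. res_form l m (map (wcols w (\<lambda>j i. Z j i \<omega>)) [0..<k]) (unit_fun a) (unit_fun a)) \<in> borel_measurable M"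
proof -
  have "(\<lambda>z. res_form l m (map (wcols w z) [0..<k]) (unit_fun a) (unit_fun a)) \<in> borel_measurable (mat_law k m)"
    by (rule measurable_res_form_wcols[OF l]) auto
  from measurable_compose[OF matrix_measurable this] show ?thesis
    by (simp only: wcols_restrict_w)
qed

lemma integral_res_form_matrix:
  "(\<integral>\<omega>. res_form l m (map (wcols w (\<lambda>j i. Z j i \<omega>)) [0..<k]) (unit_fun a) (unit_fun a) \<partial>M)
    = (\<integral>z. res_form l m (map (wcols w z) [0..<k]) (unit_fun a) (unit_fun a) \<partial>mat_law k m)"
proof -
  have "(\<lambda>z. res_form l m (map (wcols w z) [0..<k]) (unit_fun a) (unit_fun a)) \<in> borel_measurable (mat_law k m)"
    by (rule measurable_res_form_wcols[OF l]) auto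
  from integral_matrix[OF this] show ?thesis by (simp only: wcols_restrict_w)
qed

lemma resolvent_diag_approx:
  assumes "\<And>a. a < m \<Longrightarrow> (w j a)\<^sup>2 \<le> \<beta>" and j: "j < k" and "0 < \<beta>"
  shows "\<bar>(\<integral>\<omega>. res_form l k (map (\<lambda>i j. wcols w (\<lambda>j i. Z j i \<omega>) j i) [0..<m]) (unit_fun j) (unit_fun j) \<partial>M)
      - 1 / (l * (1 + (\<Sum>a<m. (w j a)\<^sup>2 *
          (\<integral>\<omega>. res_form l m (map (wcols w (\<lambda>j i. Z j i \<omega>)) [0..<k]) (unit_fun a) (unit_fun a) \<partial>M))))\<bar>
    \<le> \<beta> / l\<^sup>2 * (sqrt (2 * moment 4 * real m) + 1 + 3 * sqrt (real k))"
proof -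
  have "(\<lambda>z. res_form l k (map (\<lambda>i j. wcols w z j i) [0..<m]) (unit_fun j) (unit_fun j)) \<in> borel_measurable (mat_law k m)"
  proof (rule measurable_res_form[OF l])
    fix i j' assume "i \<in> set [0..<m]" "j' < k"
    then have [measurable]: "(\<lambda>z. z j' i) \<in> borel_measurable (mat_law k m)"
      by (intro measurable_entry) auto
    show "(\<lambda>z. wcols w z j' i) \<in> borel_measurable (mat_law k m)"
      unfolding wcols_def by measurable
  qed auto
  from integral_matrix[OF this]
  have "(\<integral>\<omega>. res_form l k (map (\<lambda>i j. wcols w (\<lambda>j i. Z j i \<omega>) j i) [0..<m]) (unit_fun j) (unit_fun j) \<partial>M)
      = (\<integral>z. res_form l k (map (\<lambda>i j. wcols w z j i) [0..<m]) (unit_fun j) (unit_fun j) \<partial>mat_law k m)"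
    by (simp only: wcols_restrict_w)
  then show ?thesis
    using resolvent_diag_approx_mat_law[where w = w, OF l assms km(2)] by (simp only: integral_res_form_matrix)
qed

text \<open>The normalized trace has constant weights, so \<beta> is \<open>1 / real m\<close>. When
  \<open>k\<close> and \<open>m\<close> are of the same order, the exponent grows linearly in
  them.\<close>

lemma trace_tail:
  fixes \<epsilon> :: real
  assumes \<epsilon>: "0 < \<epsilon>"
  defines "f \<equiv> \<lambda>\<omega>. (\<Sum>a<m. 1 / real m * res_form l m (map (wcols w (\<lambda>j i. Z j i \<omega>)) [0..<k]) (unit_fun a) (unit_fun a))"
  shows "f \<in> borel_measurable M"
    and "(\<integral>\<omega>. f \<omega> \<partial>M) = (\<Sum>a<m. 1 / real m *
        (\<integral>\<omega>. res_form l m (map (wcols w (\<lambda>j i. Z j i \<omega>)) [0..<k]) (unit_fun a) (unit_fun a) \<partial>M))"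
    and "measure M {\<omega> \<in> space M. \<epsilon> \<le> \<bar>f \<omega> - (\<integral>\<omega>. f \<omega> \<partial>M)\<bar>}
      \<le> 2 * exp (- \<epsilon>\<^sup>2 / (2 * (real k * (1 / real m / l)\<^sup>2)))"
proof -
  interpret M: prob_space M by (rule M)
  let ?b = "\<lambda>_::nat. 1 / real m"
  let ?g = "\<lambda>\<omega>. \<lambda>j\<in>{..<k}. \<lambda>i\<in>{..<m}. Z j i \<omega>"
  show f: "f \<in> borel_measurable M" unfolding f_def
    by (intro borel_measurable_sum borel_measurable_times borel_measurable_const measurable_res_form_matrix)
  have "integrable M (\<lambda>\<omega>. res_form l m (map (wcols w (\<lambda>j i. Z j i \<omega>)) [0..<k]) (unit_fun a) (unit_fun a))" if "a < m" for a
    by (rule integrable_bounded_on_space[OF M.finite_measure_axioms measurable_res_form_matrix res_form_unit_fun_abs_le[OF l that]])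
  then show "(\<integral>\<omega>. f \<omega> \<partial>M) = (\<Sum>a<m. 1 / real m *
        (\<integral>\<omega>. res_form l m (map (wcols w (\<lambda>j i. Z j i \<omega>)) [0..<k]) (unit_fun a) (unit_fun a) \<partial>M))"
    unfolding f_def by (simp add: Bochner_Integration.integral_sum)
  have eq: "weighted_trace l m k w ?b (?g \<omega>) = f \<omega>" for \<omega>
    unfolding weighted_trace_def f_def wcols_restrict_w ..
  note mw = measurable_weighted_trace[OF l, of m k w ?b]
  have E: "(\<integral>\<omega>. f \<omega> \<partial>M) = (\<integral>z. weighted_trace l m k w ?b z \<partial>mat_law k m)"
    using integral_matrix[OF mw] by (simp only: eq)
  let ?A = "{z \<in> space (mat_law k m). \<epsilon> \<le> \<bar>weighted_trace l m k w ?b z - (\<integral>z. weighted_trace l m k w ?b z \<partial>mat_law k m)\<bar>}"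
  have A: "?A \<in> sets (mat_law k m)" using mw by measurable
  have "measure (mat_law k m) ?A = measure M (?g -` ?A \<inter> space M)"
    using measure_distr[OF matrix_measurable A] by (simp only: distr_matrix)
  also have "?g -` ?A \<inter> space M = {\<omega> \<in> space M. \<epsilon> \<le> \<bar>f \<omega> - (\<integral>\<omega>. f \<omega> \<partial>M)\<bar>}"
    using measurable_space[OF matrix_measurable] unfolding E by (auto simp: eq)
  finally show "measure M {\<omega> \<in> space M. \<epsilon> \<le> \<bar>f \<omega> - (\<integral>\<omega>. f \<omega> \<partial>M)\<bar>}
      \<le> 2 * exp (- \<epsilon>\<^sup>2 / (2 * (real k * (1 / real m / l)\<^sup>2)))"
    using weighted_trace_tail[OF l, of m ?b "1 / real m" k \<epsilon> w] km \<epsilon> by simp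
qed

end

end

end

section \<open>Degrees of freedom\<close>

text \<open>\<open>mat_inverse\<close> is known to succeed on units, so the right inverse is first
  shown to be two-sided; the matrix returned then agrees with \<open>B\<close> by
  associativity.\<close>

lemma minv_eqI:
  fixes A :: "'a::field mat"
  assumes A: "A \<in> carrier_mat d d" and B: "B \<in> carrier_mat d d" and AB: "A * B = 1\<^sub>m d"
  shows "minv A = B"
proof -
  have BA: "B * A = 1\<^sub>m d" by (rule mat_mult_left_right_inverse[OF A B AB])
  have "A \<in> Units (ring_mat TYPE('a) d ())"
    using A B AB BA by (auto simp: Units_def ring_mat_def)
  then obtain C where C: "mat_inverse A = Some C"
    using mat_inverse(1)[OF A, of "()"] by (cases "mat_inverse A") auto
  note inv = mat_inverse(2)[OF A C]
  have "C = (B * A) * C" using inv left_mult_one_mat[of C d d] by (simp add: BA)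
  also have "\<dots> = B * (A * C)" using A B inv by (simp add: assoc_mult_mat[of B d d A d C d])
  also have "\<dots> = B" using inv B by simp
  finally show ?thesis using C by (simp add: minv_def)
qed

lemma mat_diag_mult: "mat_diag d f * mat_diag d g = mat_diag d (\<lambda>i. f i * g i :: 'a::semiring_0)"
  by (rule eq_matI) (auto simp: mat_diag_def scalar_prod_def if_distrib[of "\<lambda>x. x * _"] sum.If_cases
      intro: sum.neutral cong: if_cong)

lemma mtrace_diag: "mtrace (mat_diag d f) = (\<Sum>i<d. f i)"
  by (simp add: mtrace_def mat_diag_def)

lemma minv_diag:
  fixes f :: "nat \<Rightarrow> 'a::field"
  assumes "\<And>i. i < d \<Longrightarrow> f i \<noteq> 0"
  shows "minv (mat_diag d f) = mat_diag d (\<lambda>i. 1 / f i)"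
proof (rule minv_eqI)
  show "mat_diag d f * mat_diag d (\<lambda>i. 1 / f i) = 1\<^sub>m d"
    unfolding mat_diag_mult using assms by (intro eq_matI) (auto simp: mat_diag_def)
qed (simp_all add: mat_diag_def)

text \<open>The resolvent equation on unit vectors reads S R = 1 - lam R for the matrix
  \<open>R\<close> of the form. This identifies \<open>R\<close> as the inverse of S + lam, and its
  trace is p - lam Tr R.\<close>

lemma df1_hat_eq:
  fixes \<gamma> z w :: "nat \<Rightarrow> nat \<Rightarrow> real"
  assumes l: "0 < lam" and n: "0 < n" and p: "0 < p"
    and w: "\<And>i j. i < n \<Longrightarrow> j < p \<Longrightarrow> w i j = \<gamma> i j * z i j / sqrt (real n)"
  shows "df1_hat n p \<gamma> z lam =
    1 - lam * (\<Sum>j<p. 1 / real p * res_form lam p (map w [0..<n]) (unit_fun j) (unit_fun j))"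
proof -
  let ?S = "Sigma_hat n p \<gamma> z" and ?B = "res_form lam p (map w [0..<n])"
  define R where "R = mat p p (\<lambda>(a, b). ?B (unit_fun a) (unit_fun b))"
  note spec = is_resolvent_res_form[OF l, of p "map w [0..<n]"]
  have S: "?S \<in> carrier_mat p p" by (rule carrier_matI) (simp_all add: Sigma_hat_def design_def)
  have S_entry: "?S $$ (a, b) = (\<Sum>i<n. w i a * w i b)" if "a < p" "b < p" for a b
  proof -
    have "?S $$ (a, b) = 1 / real n * (\<Sum>i<n. (\<gamma> i a * z i a) * (\<gamma> i b * z i b))"
      using that by (simp add: Sigma_hat_def design_def scalar_prod_def lessThan_atLeast0)
    also have "\<dots> = (\<Sum>i<n. w i a * w i b)"
      unfolding sum_distrib_left
    proof (rule sum.cong[OF refl])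
      fix i assume "i \<in> {..<n}"
      then show "1 / real n * ((\<gamma> i a * z i a) * (\<gamma> i b * z i b)) = w i a * w i b"
        using that n by (simp add: w field_simps)
    qed
    finally show ?thesis .
  qed
  have R: "R \<in> carrier_mat p p" by (simp add: R_def)
  have SR: "(?S * R) $$ (a, b) = of_bool (a = b) - lam * ?B (unit_fun a) (unit_fun b)" if "a < p" "b < p" for a b
  proof -
    have "(?S * R) $$ (a, b) = (\<Sum>c<p. (\<Sum>i<n. w i a * w i c) * ?B (unit_fun c) (unit_fun b))"
      using that S by (simp add: R_def scalar_prod_def lessThan_atLeast0[symmetric] S_entry
          del: sum_distrib_right)
    also have "\<dots> = (\<Sum>i<n. w i a * (\<Sum>c<p. w i c * ?B (unit_fun c) (unit_fun b)))"
      unfolding sum_distrib_right sum_distrib_left by (subst sum.swap) (simp add: mult.assoc)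
    also have "\<dots> = (\<Sum>i<n. ip p (unit_fun a) (w i) * ?B (w i) (unit_fun b))"
      using that by (simp add: ip_unit_fun is_resolvent_rep[OF spec, of "w _", symmetric])
    also have "\<dots> = ip p (unit_fun a) (unit_fun b) - lam * ?B (unit_fun a) (unit_fun b)"
      using is_resolvent_eq[OF spec, of "unit_fun a" "unit_fun b"] by (simp add: o_def sum_list_map_upt)
    also have "ip p (unit_fun a) (unit_fun b) = of_bool (a = b)"
      using that by (simp add: ip_unit_fun) (simp add: unit_fun_def)
    finally show ?thesis .
  qed
  have "(?S + lam \<cdot>\<^sub>m 1\<^sub>m p) * R = ?S * R + lam \<cdot>\<^sub>m R"
    using S R by (simp add: add_mult_distrib_mat[of ?S p p _ R p] mult_smult_assoc_mat[of _ p p R p])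
  also have "\<dots> = 1\<^sub>m p"
  proof (rule eq_matI)
    fix a b assume "a < dim_row (1\<^sub>m p :: real mat)" "b < dim_col (1\<^sub>m p :: real mat)"
    then have ab: "a < p" "b < p" by auto
    have "(?S * R + lam \<cdot>\<^sub>m R) $$ (a, b) = (?S * R) $$ (a, b) + lam * R $$ (a, b)"
      using ab S R by simp
    then show "(?S * R + lam \<cdot>\<^sub>m R) $$ (a, b) = 1\<^sub>m p $$ (a, b)"
      using ab by (simp add: SR) (simp add: R_def)
  qed (use S R in auto)
  finally have "minv (?S + lam \<cdot>\<^sub>m 1\<^sub>m p) = R"
    using S R by (intro minv_eqI) auto
  then have "df1_hat n p \<gamma> z lam = 1 / real p * (\<Sum>a<p. (?S * R) $$ (a, a))"
    using S by (simp add: df1_hat_def mtrace_def)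
  also have "(\<Sum>a<p. (?S * R) $$ (a, a)) = real p - lam * (\<Sum>a<p. ?B (unit_fun a) (unit_fun a))"
    by (simp add: SR sum_subtractf sum_distrib_left)
  also have "1 / real p * \<dots> = 1 - lam * (\<Sum>j<p. 1 / real p * ?B (unit_fun j) (unit_fun j))"
    using p by (simp add: right_diff_distrib sum_distrib_left sum_divide_distrib field_simps)
  finally show ?thesis .
qed

text \<open>At z = - lam the integrand is the real number 1 / (t + lam), nonnegative for almost
  every t. This selects the positive solution of the algebraic system, on which the ratio argument
  acts.\<close>

lemma is_stieltjes_neg:
  assumes f: "is_stieltjes f" and l: "0 < lam"
  shows "f (- complex_of_real lam) = complex_of_real (Re (f (- complex_of_real lam)))"
    and "0 \<le> Re (f (- complex_of_real lam))"
proof -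
  obtain \<mu> where \<mu>: "real_distribution \<mu>" "AE t in \<mu>. 0 \<le> t"
    and eq: "\<And>z. z \<notin> \<real>\<^sub>\<ge>\<^sub>0 \<Longrightarrow> f z = (\<integral>t. 1 / (complex_of_real t - z) \<partial>\<mu>)"
    using f by (auto simp: is_stieltjes_def)
  have "- complex_of_real lam \<notin> \<real>\<^sub>\<ge>\<^sub>0"
    using l by (simp add: complex_nonneg_Reals_iff)
  then have "f (- complex_of_real lam) = (\<integral>t. complex_of_real (1 / (t + lam)) \<partial>\<mu>)"
    by (simp add: eq)
  also have "\<dots> = complex_of_real (\<integral>t. 1 / (t + lam) \<partial>\<mu>)"
    by (rule integral_complex_of_real)
  finally have 1: "f (- complex_of_real lam) = complex_of_real (\<integral>t. 1 / (t + lam) \<partial>\<mu>)" .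
  show "f (- complex_of_real lam) = complex_of_real (Re (f (- complex_of_real lam)))"
    by (simp add: 1)
  have "0 \<le> (\<integral>t. 1 / (t + lam) \<partial>\<mu>)"
    by (rule integral_nonneg_AE) (use \<mu>(2) l in auto)
  then show "0 \<le> Re (f (- complex_of_real lam))" by (simp add: 1)
qed

lemma solves_system_neg:
  fixes \<gamma> :: "nat \<Rightarrow> nat \<Rightarrow> real"
  assumes sys: "solves_system n p \<gamma> T T'" and l: "0 < lam"
  defines "t \<equiv> \<lambda>j. Re (T j (- complex_of_real lam))"
    and "t' \<equiv> \<lambda>i. Re (T' i (- complex_of_real lam))"
  shows "\<And>j. j < p \<Longrightarrow> T j (- complex_of_real lam) = complex_of_real (t j)"
    and "\<And>i. i < n \<Longrightarrow> T' i (- complex_of_real lam) = complex_of_real (t' i)"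
    and "\<And>j. j < p \<Longrightarrow> 0 \<le> t j" and "\<And>i. i < n \<Longrightarrow> 0 \<le> t' i"
    and "\<And>j. j < p \<Longrightarrow> t j = 1 / (lam * (1 + (\<Sum>i<n. (\<gamma> i j)\<^sup>2 / real n * t' i)))"
    and "\<And>i. i < n \<Longrightarrow> t' i = 1 / (lam * (1 + (\<Sum>j<p. (\<gamma> i j)\<^sup>2 / real n * t j)))"
proof -
  let ?z = "- complex_of_real lam"
  have st: "\<And>j. j < p \<Longrightarrow> is_stieltjes (T j)" "\<And>i. i < n \<Longrightarrow> is_stieltjes (T' i)"
    using sys by (auto simp: solves_system_def)
  have z: "?z \<notin> \<real>\<^sub>\<ge>\<^sub>0" using l by (simp add: complex_nonneg_Reals_iff)
  show T: "T j ?z = complex_of_real (t j)" if "j < p" for j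
    using is_stieltjes_neg(1)[OF st(1)[OF that] l] by (simp add: t_def)
  show T': "T' i ?z = complex_of_real (t' i)" if "i < n" for i
    using is_stieltjes_neg(1)[OF st(2)[OF that] l] by (simp add: t'_def)
  show "0 \<le> t j" if "j < p" for j
    using is_stieltjes_neg(2)[OF st(1)[OF that] l] by (simp add: t_def)
  show "0 \<le> t' i" if "i < n" for i
    using is_stieltjes_neg(2)[OF st(2)[OF that] l] by (simp add: t'_def)
  show "t j = 1 / (lam * (1 + (\<Sum>i<n. (\<gamma> i j)\<^sup>2 / real n * t' i)))" if j: "j < p" for j
  proof -
    have tr: "mtrace (D_col n \<gamma> j * diag_at n T' ?z) = complex_of_real (\<Sum>i<n. (\<gamma> i j)\<^sup>2 * t' i)"
      by (simp add: D_col_def diag_at_def mat_diag_mult mtrace_diag T')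
    have "T j ?z = -1 / (?z * (1 + 1 / of_nat n * mtrace (D_col n \<gamma> j * diag_at n T' ?z)))"
      using sys z j unfolding solves_system_def by blast
    also have "\<dots> = complex_of_real (-1 / (- lam * (1 + 1 / real n * (\<Sum>i<n. (\<gamma> i j)\<^sup>2 * t' i))))"
      unfolding tr by simp
    finally have "t j = -1 / (- lam * (1 + 1 / real n * (\<Sum>i<n. (\<gamma> i j)\<^sup>2 * t' i)))"
      unfolding T[OF j] of_real_eq_iff .
    then show ?thesis by (simp add: sum_distrib_left)
  qed
  show "t' i = 1 / (lam * (1 + (\<Sum>j<p. (\<gamma> i j)\<^sup>2 / real n * t j)))" if i: "i < n" for i
  proof -
    have tr: "mtrace (D_row p \<gamma> i * diag_at p T ?z) = complex_of_real (\<Sum>j<p. (\<gamma> i j)\<^sup>2 * t j)"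
      by (simp add: D_row_def diag_at_def mat_diag_mult mtrace_diag T)
    have "T' i ?z = -1 / (?z * (1 + 1 / of_nat n * mtrace (D_row p \<gamma> i * diag_at p T ?z)))"
      using sys z i unfolding solves_system_def by blast
    also have "\<dots> = complex_of_real (-1 / (- lam * (1 + 1 / real n * (\<Sum>j<p. (\<gamma> i j)\<^sup>2 * t j))))"
      unfolding tr by simp
    finally have "t' i = -1 / (- lam * (1 + 1 / real n * (\<Sum>j<p. (\<gamma> i j)\<^sup>2 * t j)))"
      unfolding T'[OF i] of_real_eq_iff .
    then show ?thesis by (simp add: sum_distrib_left)
  qed
qed

text \<open>With G = Tr D_j and H = Tr [D_j T'] the choice \<kappa> = G / H gives (G/n) / (G/n +
  G/H) = H / (H + n) = 1 - 1 / (1 + H/n), and the system identifies the last fraction with lam t_j.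
  For G = 0 also H = 0, so lam t_j = 1 and both sides vanish.\<close>

lemma df1_eq:
  fixes \<gamma> :: "nat \<Rightarrow> nat \<Rightarrow> real"
  assumes sys: "solves_system n p \<gamma> T T'" and l: "0 < lam" and n: "0 < n" and p: "0 < p"
    and \<Sigma>: "\<Sigma> = (1 / real n) \<cdot>\<^sub>m mat_diag p (\<lambda>j. \<Sum>i<n. (\<gamma> i j)\<^sup>2)"
  shows "df1 p \<Sigma> (kappa n \<gamma> T' lam) =
    complex_of_real (1 - lam * (\<Sum>j<p. 1 / real p * Re (T j (- complex_of_real lam))))"
proof -
  let ?z = "- complex_of_real lam"
  define t where "t j = Re (T j ?z)" for j
  define t' where "t' i = Re (T' i ?z)" for i
  note N = solves_system_neg[OF sys l, folded t_def t'_def]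
  define g where "g j = (\<Sum>i<n. (\<gamma> i j)\<^sup>2)" for j
  define h where "h j = (\<Sum>i<n. (\<gamma> i j)\<^sup>2 * t' i)" for j
  define \<kappa> where "\<kappa> j = (if g j = 0 then 1 else g j / h j)" for j
  have t'_pos: "0 < t' i" if "i < n" for i
  proof -
    have "0 \<le> (\<Sum>j<p. (\<gamma> i j)\<^sup>2 / real n * t j)"
      using N(3) by (intro sum_nonneg mult_nonneg_nonneg) auto
    then show ?thesis using l by (subst N(6)[OF that]) (simp add: add_pos_nonneg)
  qed
  have g0: "0 \<le> g j" for j by (simp add: g_def sum_nonneg)
  have h0: "0 \<le> h j" for j
    unfolding h_def using N(4) by (intro sum_nonneg mult_nonneg_nonneg) auto
  \<comment> \<open>Every \<open>t' i\<close> is strictly positive, so the denominator of \<kappa>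
    vanishes only together with its numerator.\<close>
  have gh: "g j = 0 \<longleftrightarrow> h j = 0" for j
  proof -
    have "g j = 0 \<longleftrightarrow> (\<forall>i\<in>{..<n}. (\<gamma> i j)\<^sup>2 = 0)"
      unfolding g_def by (rule sum_nonneg_eq_0_iff) auto
    moreover have "h j = 0 \<longleftrightarrow> (\<forall>i\<in>{..<n}. (\<gamma> i j)\<^sup>2 * t' i = 0)"
      unfolding h_def using N(4) by (intro sum_nonneg_eq_0_iff) auto
    ultimately show ?thesis using t'_pos by force
  qed
  have kap: "kappa n \<gamma> T' lam j = complex_of_real (\<kappa> j)" for j
  proof -
    have "mtrace (D_col n \<gamma> j) = complex_of_real (g j)"
      by (simp add: D_col_def mtrace_diag g_def)
    moreover have "mtrace (D_col n \<gamma> j * diag_at n T' ?z) = complex_of_real (h j)"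
      by (simp add: D_col_def diag_at_def mat_diag_mult mtrace_diag N(2) h_def)
    ultimately show ?thesis by (simp add: kappa_def \<kappa>_def)
  qed
  have pos: "0 < g j / real n + \<kappa> j" for j
  proof (cases "g j = 0")
    case False
    then have "0 < g j" "0 < h j" using g0[of j] h0[of j] gh[of j] by linarith+
    then show ?thesis using n by (simp add: \<kappa>_def add_pos_pos)
  qed (simp add: \<kappa>_def)
  have summand: "g j / real n * (1 / (g j / real n + \<kappa> j)) = 1 - lam * t j" if "j < p" for j
  proof -
    have tj: "t j = 1 / (lam * (1 + h j / real n))"
      using N(5)[OF that] by (simp add: h_def sum_divide_distrib)
    show ?thesis
    proof (cases "g j = 0")
      case True
      then have "h j = 0" using gh by simp
      then show ?thesis using True l tj by simp
    next
      case False
      then have gp: "0 < g j" "0 < h j" using g0[of j] h0[of j] gh[of j] by linarith+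
      have "lam * t j = 1 / (1 + h j / real n)" using l tj by simp
      moreover have "G / N * (1 / (G / N + G / H)) = 1 - 1 / (1 + H / N)"
        if "0 < G" "0 < H" "0 < N" for G H N :: real
      proof -
        have "G / N + G / H = G * (H + N) / (N * H)" using that by (simp add: field_simps)
        then have "G / N * (1 / (G / N + G / H)) = H / (H + N)" using that by simp
        moreover have "1 + H / N = (H + N) / N" using that by (simp add: field_simps)
        moreover have "H / (H + N) = 1 - N / (H + N)"
          using that add_pos_pos[of H N] by (simp add: field_simps)
        ultimately show ?thesis by simp
      qed
      ultimately show ?thesis using gp n False by (simp add: \<kappa>_def)
    qed
  qed
  have S: "map_mat complex_of_real \<Sigma> = mat_diag p (\<lambda>j. complex_of_real (g j / real n))"
    unfolding \<Sigma> by (rule eq_matI) (auto simp: mat_diag_def g_def)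
  have SK: "mat_diag p (\<lambda>j. complex_of_real (g j / real n)) + mat_diag p (kappa n \<gamma> T' lam)
      = mat_diag p (\<lambda>j. complex_of_real (g j / real n + \<kappa> j))"
    by (rule eq_matI) (auto simp: mat_diag_def kap)
  have "minv (mat_diag p (\<lambda>j. complex_of_real (g j / real n + \<kappa> j)))
      = mat_diag p (\<lambda>j. 1 / complex_of_real (g j / real n + \<kappa> j))"
    using pos by (intro minv_diag) (metis less_irrefl of_real_eq_0_iff)
  then have "df1 p \<Sigma> (kappa n \<gamma> T' lam) =
      1 / of_nat p * (\<Sum>j<p. complex_of_real (g j / real n) * (1 / complex_of_real (g j / real n + \<kappa> j)))"
    unfolding df1_def S SK by (simp only: mat_diag_mult mtrace_diag)
  also have "\<dots> = complex_of_real (1 / real p * (\<Sum>j<p. g j / real n * (1 / (g j / real n + \<kappa> j))))"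
    by simp
  also have "(\<Sum>j<p. g j / real n * (1 / (g j / real n + \<kappa> j))) = (\<Sum>j<p. 1 - lam * t j)"
    by (intro sum.cong refl summand) auto
  also have "1 / real p * (\<Sum>j<p. 1 - lam * t j) = 1 - lam * (\<Sum>j<p. 1 / real p * t j)"
    using p by (simp add: sum_subtractf right_diff_distrib diff_divide_distrib sum_distrib_left sum_divide_distrib)
  finally show ?thesis by (simp add: t_def)
qed

section \<open>Almost sure convergence\<close>

text \<open>Borel-Cantelli for each fixed \<epsilon>, then a countable intersection over \<epsilon>
  = 1 / (i + 1).\<close>

lemma (in prob_space) AE_tendsto_of_summable_tails:
  fixes f :: "nat \<Rightarrow> 'a \<Rightarrow> real"
  assumes meas: "\<And>n. N \<le> n \<Longrightarrow> f n \<in> borel_measurable M"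
    and tail: "\<And>\<epsilon>. 0 < \<epsilon> \<Longrightarrow> \<exists>a. summable a \<and>
        eventually (\<lambda>n. prob {x \<in> space M. \<epsilon> \<le> \<bar>f n x\<bar>} \<le> a n) sequentially"
  shows "AE x in M. (\<lambda>n. f n x) \<longlonglongrightarrow> 0"
proof -
  have ev: "AE x in M. eventually (\<lambda>n. \<bar>f n x\<bar> < \<epsilon>) sequentially" if \<epsilon>: "0 < \<epsilon>" for \<epsilon>
  proof -
    obtain a where a: "summable a"
      and "eventually (\<lambda>n. prob {x \<in> space M. \<epsilon> \<le> \<bar>f n x\<bar>} \<le> a n) sequentially"
      using tail[OF \<epsilon>] by blast
    then obtain N' where N': "\<And>n. N' \<le> n \<Longrightarrow> prob {x \<in> space M. \<epsilon> \<le> \<bar>f n x\<bar>} \<le> a n"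
      by (auto simp: eventually_sequentially)
    let ?N = "max N N'"
    \<comment> \<open>Measurability and the tail bound are available only from some index on, so the
      earlier events are replaced by the empty set.\<close>
    define A where "A n = (if ?N \<le> n then {x \<in> space M. \<epsilon> \<le> \<bar>f n x\<bar>} else {})" for n
    have A: "A n \<in> events" for n
    proof (cases "?N \<le> n")
      case True
      then have [measurable]: "f n \<in> borel_measurable M" using meas by simp
      show ?thesis unfolding A_def by simp
    next
      case False
      then show ?thesis by (simp only: A_def if_False sets.empty_sets)
    qed
    have sm: "summable (\<lambda>n. prob (A n))"
      by (rule summable_comparison_test[OF _ a])
        (rule exI[of _ ?N], use N' in \<open>auto simp: A_def\<close>)
    have "AE x in M. eventually (\<lambda>n. x \<in> space M - A n) sequentially"
      by (rule borel_cantelli_AE1[OF A _ sm]) (simp add: emeasure_eq_measure)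
    then show ?thesis
    proof eventually_elim
      case (elim x)
      show ?case
        using elim eventually_ge_at_top[of ?N]
        by eventually_elim (auto simp: A_def split: if_splits)
    qed
  qed
  have "AE x in M. \<forall>i::nat. eventually (\<lambda>n. \<bar>f n x\<bar> < 1 / real (Suc i)) sequentially"
    unfolding AE_all_countable by (intro allI ev) simp
  then show ?thesis
  proof eventually_elim
    case (elim x)
    show ?case
    proof (rule tendstoI)
      fix e :: real assume "0 < e"
      then obtain i :: nat where i: "1 / real (Suc i) < e"
        using reals_Archimedean[of e] by (auto simp: inverse_eq_divide)
      show "eventually (\<lambda>n. dist (f n x) 0 < e) sequentially"
        using elim[rule_format, of i] by eventually_elim (use i in auto)
    qed
  qed
qed

text \<open>All entries have law \<open>L\<close>, so its moments are read off from a single one;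
  the fourth is finite because x^4 \<le> 1 + |x|^(4 + \<delta>).\<close>

lemma standardized_lawI:
  assumes "prob_space M" and iid: "iid_standardized M L I X" and i: "i \<in> I"
    and \<delta>: "0 < (\<delta> :: real)" and mom: "integrable M (\<lambda>\<omega>. \<bar>X i \<omega>\<bar> powr (4 + \<delta>))"
  shows "standardized_law L"
proof -
  interpret M: prob_space M by fact
  have X[measurable]: "X i \<in> borel_measurable M"
    using iid i unfolding iid_standardized_def M.indep_vars_def by auto
  have L: "L = distr M borel (X i)" and mean: "M.expectation (X i) = 0" and var: "M.variance (X i) = 1"
    and sq: "integrable M (\<lambda>\<omega>. (X i \<omega>)\<^sup>2)"
    using iid i unfolding iid_standardized_def by auto
  have pw: "\<bar>x ^ 4\<bar> \<le> 1 + \<bar>x\<bar> powr (4 + \<delta>)" for x :: real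
  proof (cases "\<bar>x\<bar> \<le> 1")
    case True
    then have "\<bar>x\<bar> ^ 4 \<le> 1" by (intro power_le_one) auto
    moreover have "0 \<le> \<bar>x\<bar> powr (4 + \<delta>)" by simp
    ultimately show ?thesis unfolding power_abs[symmetric] by linarith
  next
    case False
    then have "\<bar>x\<bar> ^ 4 = \<bar>x\<bar> powr 4" by (subst powr_numeral) auto
    also have "\<dots> \<le> \<bar>x\<bar> powr (4 + \<delta>)" using False \<delta> by (intro powr_mono) auto
    finally show ?thesis unfolding power_abs[symmetric] by linarith
  qed
  have "integrable M (\<lambda>\<omega>. X i \<omega> ^ 4)"
  proof (rule Bochner_Integration.integrable_bound[of M "\<lambda>\<omega>. 1 + \<bar>X i \<omega>\<bar> powr (4 + \<delta>)"])
    show "AE \<omega> in M. norm (X i \<omega> ^ 4) \<le> norm (1 + \<bar>X i \<omega>\<bar> powr (4 + \<delta>))"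
    proof (rule AE_I2)
      fix \<omega>
      have "0 \<le> \<bar>X i \<omega>\<bar> powr (4 + \<delta>)" by simp
      then show "norm (X i \<omega> ^ 4) \<le> norm (1 + \<bar>X i \<omega>\<bar> powr (4 + \<delta>))"
        using pw[of "X i \<omega>"] unfolding real_norm_def by linarith
    qed
  qed (use mom in auto)
  moreover have "prob_space L" unfolding L by (rule M.prob_space_distr) simp
  ultimately show ?thesis
    using mean var
    by (intro standardized_law.intro standardized_law_axioms.intro)
      (simp_all add: L integrable_distr_eq integral_distr)
qed

section \<open>Mean resolvents as approximate solutions of the system\<close>

context standardized_law
begin

text \<open>\<open>resolvent_diag_approx\<close>, used for the matrix and for its transpose, makes
  the two mean diagonals an approximate solution; \<open>system_stability\<close> then compares it
  with the exact one. Both dimensions are at most (c + 2) n, so one error serves all equations. S is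
  (c + 2) n times the largest squared weight G^2 / n times the bound 1 / lam on the solutions, and
  \<eta> is 2 \<epsilon> lam (1 + S) written out.\<close>

lemma mean_resolvent_close:
  fixes \<gamma> :: "nat \<Rightarrow> nat \<Rightarrow> real" and Z :: "nat \<Rightarrow> nat \<Rightarrow> 'w \<Rightarrow> real" and c G lam :: real
  assumes M: "prob_space M"
    and ind: "prob_space.indep_vars M (\<lambda>_. borel) (\<lambda>(i, j). Z i j) ({..<n} \<times> {..<p})"
    and law: "\<And>i j. i < n \<Longrightarrow> j < p \<Longrightarrow> distr M borel (Z i j) = L"
    and np: "0 < n" "0 < p" "real p \<le> (c + 1) * real n" and c: "0 < c"
    and lam: "0 < lam" and G: "0 < G" and \<gamma>: "\<And>i j. i < n \<Longrightarrow> j < p \<Longrightarrow> \<bar>\<gamma> i j\<bar> \<le> G"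
    and sys: "solves_system n p \<gamma> T T'"
  defines "w \<equiv> \<lambda>i j. if i < n \<and> j < p then \<gamma> i j / sqrt (real n) else 0"
    and "S \<equiv> G\<^sup>2 * (c + 2) / lam"
    and "\<eta> \<equiv> 2 * (G\<^sup>2 / real n / lam\<^sup>2 *
        ((sqrt (2 * moment 4 * (c + 2)) + 3 * sqrt (c + 2)) * sqrt (real n) + 1)) * lam * (1 + G\<^sup>2 * (c + 2) / lam)"
  assumes \<eta>: "\<eta> \<le> 1" "\<eta> * S < 1" and j: "j < p"
  shows "\<bar>(\<integral>\<omega>. res_form lam p (map (wcols w (\<lambda>i j. Z i j \<omega>)) [0..<n]) (unit_fun j) (unit_fun j) \<partial>M)
      - Re (T j (- complex_of_real lam))\<bar> \<le> ((1 + \<eta>) / (1 - \<eta> * S) - 1) / lam"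
proof -
  interpret M: prob_space M by (rule M)
  let ?wt = "\<lambda>j i. w i j" and ?Zt = "\<lambda>j i. Z i j"
  define \<beta> where "\<beta> = G\<^sup>2 / real n"
  define q where "q j = (\<integral>\<omega>. res_form lam p (map (wcols w (\<lambda>i j. Z i j \<omega>)) [0..<n]) (unit_fun j) (unit_fun j) \<partial>M)" for j
  define q' where "q' i = (\<integral>\<omega>. res_form lam n (map (wcols ?wt (\<lambda>j i. Z i j \<omega>)) [0..<p]) (unit_fun i) (unit_fun i) \<partial>M)" for i
  define t where "t j = Re (T j (- complex_of_real lam))" for j
  define t' where "t' i = Re (T' i (- complex_of_real lam))" for i
  note N = solves_system_neg[OF sys lam, folded t_def t'_def]
  define \<epsilon> where "\<epsilon> = \<beta> / lam\<^sup>2 * ((sqrt (2 * moment 4 * (c + 2)) + 3 * sqrt (c + 2)) * sqrt (real n) + 1)"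
  have \<beta>0: "0 < \<beta>" using G np by (simp add: \<beta>_def)
  have w2: "(w i j)\<^sup>2 = (\<gamma> i j)\<^sup>2 / real n" if "i < n" "j < p" for i j
    using that np by (simp add: w_def power_divide)
  have w_le: "(w i j)\<^sup>2 \<le> \<beta>" if "i < n" "j < p" for i j
    unfolding w2[OF that] \<beta>_def using \<gamma>[OF that] np
    by (intro divide_right_mono) (simp_all add: abs_le_square_iff[symmetric] G less_imp_le)
  have ind': "M.indep_vars (\<lambda>_. borel) (\<lambda>(j, i). Z i j) ({..<p} \<times> {..<n})"
  proof -
    have "M.indep_vars (\<lambda>_. borel) (\<lambda>r. (\<lambda>(i, j). Z i j) (prod.swap r)) ({..<p} \<times> {..<n})"
      by (rule M.indep_vars_reindex_inj[OF ind]) auto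
    then show ?thesis by (simp add: case_prod_unfold)
  qed
  have law': "distr M borel (?Zt j i) = L" if "j < p" "i < n" for j i
    using law that by simp
  have wz: "w i j = 0" if "\<not> (i < n \<and> j < p)" for i j
    using that by (simp only: w_def if_False)
  have wz': "?wt j i = 0" if "\<not> (j < p \<and> i < n)" for j i
    using that by (intro wz) blast
  have err: "\<beta> / lam\<^sup>2 * (sqrt (2 * moment 4 * real m) + 1 + 3 * sqrt (real k)) \<le> \<epsilon>"
    if "real m \<le> (c + 2) * real n" "real k \<le> (c + 2) * real n" for m k :: nat
  proof -
    have "2 * moment 4 * real m \<le> 2 * moment 4 * ((c + 2) * real n)"
      using that(1) moment4_ge_1 by (intro mult_left_mono) auto
    then have "sqrt (2 * moment 4 * real m) \<le> sqrt (2 * moment 4 * (c + 2) * real n)"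
      by (simp add: mult.assoc)
    also have "\<dots> = sqrt (2 * moment 4 * (c + 2)) * sqrt (real n)" by (rule real_sqrt_mult)
    finally have 1: "sqrt (2 * moment 4 * real m) \<le> sqrt (2 * moment 4 * (c + 2)) * sqrt (real n)" .
    have "sqrt (real k) \<le> sqrt ((c + 2) * real n)" using that(2) by simp
    also have "\<dots> = sqrt (c + 2) * sqrt (real n)" by (rule real_sqrt_mult)
    finally have 2: "sqrt (real k) \<le> sqrt (c + 2) * sqrt (real n)" .
    have "sqrt (2 * moment 4 * real m) + 1 + 3 * sqrt (real k)
        \<le> (sqrt (2 * moment 4 * (c + 2)) + 3 * sqrt (c + 2)) * sqrt (real n) + 1"
      using 1 2 by (simp add: algebra_simps)
    then show ?thesis unfolding \<epsilon>_def using \<beta>0 by (intro mult_left_mono) auto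
  qed
  have n_le: "real n \<le> (c + 2) * real n" and p_le: "real p \<le> (c + 2) * real n"
    using np c by (auto simp: algebra_simps)
  have rows: "(\<lambda>i j. wcols ?wt (\<lambda>j i. Z i j \<omega>) j i) = wcols w (\<lambda>i j. Z i j \<omega>)"
    and rows': "(\<lambda>j i. wcols w (\<lambda>i j. Z i j \<omega>) i j) = wcols ?wt (\<lambda>j i. Z i j \<omega>)" for \<omega>
    by (intro ext; simp add: wcols_def)+
  have q: "\<bar>q j - 1 / (lam * (1 + (\<Sum>i<n. (w i j)\<^sup>2 * q' i)))\<bar> \<le> \<epsilon>" if "j < p" for j
    using order_trans[OF resolvent_diag_approx[where w = ?wt and Z = ?Zt, OF M ind' law' np(2,1) wz' lam w_le[OF _ that] that \<beta>0]
        err[OF n_le p_le]]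
    unfolding rows q_def q'_def by simp
  have q': "\<bar>q' i - 1 / (lam * (1 + (\<Sum>j<p. (w i j)\<^sup>2 * q j)))\<bar> \<le> \<epsilon>" if "i < n" for i
    using order_trans[OF resolvent_diag_approx[where w = w and Z = Z, OF M ind law np(1,2) wz lam w_le[OF that] that \<beta>0]
        err[OF p_le n_le]]
    unfolding rows' q_def q'_def by simp
  have q0: "0 \<le> q j" "0 \<le> q' i" for i j
    unfolding q_def q'_def by (intro integral_nonneg_AE AE_I2 res_form_nonneg lam)+
  have q1: "q j \<le> 1 / lam" if "j < p" for j
    unfolding q_def
    by (intro M.integral_le_const integrable_bounded_on_space[OF M.finite_measure_axioms _ res_form_unit_fun_abs_le[OF lam that]]
        AE_I2 res_form_unit_fun_le[OF lam that] measurable_res_form_matrix[where Z = Z, OF M ind law np(1,2) wz lam])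
  have q1': "q' i \<le> 1 / lam" if "i < n" for i
    unfolding q'_def
    by (intro M.integral_le_const integrable_bounded_on_space[OF M.finite_measure_axioms _ res_form_unit_fun_abs_le[OF lam that]]
        AE_I2 res_form_unit_fun_le[OF lam that] measurable_res_form_matrix[where Z = ?Zt, OF M ind' law' np(2,1) wz' lam])
  have inv_le: "1 / (lam * (1 + s)) \<le> 1 / lam" if "0 \<le> s" for s
  proof -
    have "lam * 1 \<le> lam * (1 + s)" using that lam by (intro mult_left_mono) auto
    then show ?thesis using lam that by (intro divide_left_mono) auto
  qed
  have t: "t j = 1 / (lam * (1 + (\<Sum>i<n. (w i j)\<^sup>2 * t' i)))" if "j < p" for j
    using N(5)[OF that] that by (simp add: w2)
  have t': "t' i = 1 / (lam * (1 + (\<Sum>j<p. (w i j)\<^sup>2 * t j)))" if "i < n" for i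
    using N(6)[OF that] that by (simp add: w2)
  have t1: "t j \<le> 1 / lam" if "j < p" for j
    unfolding t[OF that] using N(4) by (intro inv_le sum_nonneg mult_nonneg_nonneg) auto
  have t1': "t' i \<le> 1 / lam" if "i < n" for i
    unfolding t'[OF that] using N(3) by (intro inv_le sum_nonneg mult_nonneg_nonneg) auto
  have S_bound: "(\<Sum>a<d. (v a)\<^sup>2 * x a) \<le> S"
    if "\<And>a. a < d \<Longrightarrow> (v a)\<^sup>2 \<le> \<beta>" "\<And>a. a < d \<Longrightarrow> 0 \<le> x a" "\<And>a. a < d \<Longrightarrow> x a \<le> 1 / lam"
      "real d \<le> (c + 2) * real n" for d :: nat and v x :: "nat \<Rightarrow> real"
  proof -
    have "(\<Sum>a<d. (v a)\<^sup>2 * x a) \<le> of_nat (card {..<d}) * (\<beta> * (1 / lam))"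
      using that \<beta>0 by (intro sum_bounded_above mult_mono) auto
    also have "\<dots> \<le> ((c + 2) * real n) * (\<beta> * (1 / lam))"
      using that(4) \<beta>0 lam by (intro mult_right_mono) auto
    also have "\<dots> = S" using np by (simp add: S_def \<beta>_def)
    finally show ?thesis .
  qed
  have S0: "0 < S" using G c lam by (simp add: S_def)
  have \<eta>_eq: "\<eta> = 2 * \<epsilon> * lam * (1 + S)" by (simp add: \<eta>_def \<epsilon>_def S_def \<beta>_def)
  have "\<bar>q j - t j\<bar> \<le> ((1 + \<eta>) / (1 - \<eta> * S) - 1) / lam"
  proof (rule system_stability[where b = "\<lambda>i j. (w i j)\<^sup>2" and n = n and p = p and t' = t' and q' = q' and \<epsilon> = \<epsilon>])
    show "\<And>j. j < p \<Longrightarrow> (\<Sum>i<n. (w i j)\<^sup>2 * t' i) \<le> S"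
      by (rule S_bound) (use w_le N(4) t1' n_le in auto)
    show "\<And>i. i < n \<Longrightarrow> (\<Sum>j<p. (w i j)\<^sup>2 * t j) \<le> S"
      by (rule S_bound) (use w_le N(3) t1 p_le in auto)
    show "\<And>j. j < p \<Longrightarrow> (\<Sum>i<n. (w i j)\<^sup>2 * q' i) \<le> S"
      by (rule S_bound) (use w_le q0 q1' n_le in auto)
    show "\<And>i. i < n \<Longrightarrow> (\<Sum>j<p. (w i j)\<^sup>2 * q j) \<le> S"
      by (rule S_bound) (use w_le q0 q1 p_le in auto)
  qed (fact lam S0 np(2) t t' q q' N(3) N(4) q0(1) q0(2) q1 \<eta>_eq \<eta>(1) \<eta>(2) j | rule q0 | rule zero_le_power2)+
  then show ?thesis by (simp add: q_def t_def)
qed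

end

theorem proposition3p1:
  fixes M :: "'w measure"
    and p :: "nat \<Rightarrow> nat"
    and c \<delta> \<gamma>max lam :: real
    and \<gamma> :: "nat \<Rightarrow> nat \<Rightarrow> nat \<Rightarrow> real"
    and \<gamma>' :: "nat \<Rightarrow> nat \<Rightarrow> real"
    and Z :: "nat \<Rightarrow> nat \<Rightarrow> nat \<Rightarrow> 'w \<Rightarrow> real"
    and z' :: "nat \<Rightarrow> nat \<Rightarrow> 'w \<Rightarrow> real"
    and L L' :: "real measure"
    and T T' :: "nat \<Rightarrow> nat \<Rightarrow> complex \<Rightarrow> complex"
  assumes prob: "prob_space M"
    and c: "0 < c"
    and ratio: "(\<lambda>n. real (p n) / real n) \<longlonglongrightarrow> c"
    and iid_Z: "\<And>n. 1 \<le> n \<Longrightarrow> iid_standardized M L ({..<n} \<times> {..<p n}) (\<lambda>(i, j). Z n i j)"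
    and iid_z': "\<And>n. 1 \<le> n \<Longrightarrow> iid_standardized M L' {..<p n} (z' n)"
    and \<delta>: "0 < \<delta>"
    and moment_Z: "\<And>n i j. 1 \<le> n \<Longrightarrow> i < n \<Longrightarrow> j < p n \<Longrightarrow>
          integrable M (\<lambda>\<omega>. \<bar>Z n i j \<omega>\<bar> powr (4 + \<delta>))"
    and moment_z': "\<And>n j. 1 \<le> n \<Longrightarrow> j < p n \<Longrightarrow>
          integrable M (\<lambda>\<omega>. \<bar>z' n j \<omega>\<bar> powr (4 + \<delta>))"
    and \<gamma>max: "0 < \<gamma>max"
    and bound_\<gamma>: "\<And>n i j. 1 \<le> n \<Longrightarrow> i < n \<Longrightarrow> j < p n \<Longrightarrow> \<bar>\<gamma> n i j\<bar> < \<gamma>max"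
    and bound_\<gamma>': "\<And>n j. 1 \<le> n \<Longrightarrow> j < p n \<Longrightarrow> \<bar>\<gamma>' n j\<bar> < \<gamma>max"
    and system: "\<And>n. 1 \<le> n \<Longrightarrow> solves_system n (p n) (\<gamma> n) (T n) (T' n)"
    and lam: "0 < lam"
  shows "AE \<omega> in M.
    (\<lambda>n. cmod (complex_of_real (df1_hat n (p n) (\<gamma> n) (\<lambda>i j. Z n i j \<omega>) lam) -
               df1 (p n) (Sigma_mean M n (p n) (\<gamma> n) (Z n)) (kappa n (\<gamma> n) (T' n) lam)))
      \<longlonglongrightarrow> 0"
proof -
  interpret M: prob_space M by (rule prob)
  \<comment> \<open>The lower bound makes the concentration exponent linear in \<open>n\<close>; the
    upper one is what the comparison of means requires. Both also keep the dimensions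
    positive.\<close>
  have "eventually (\<lambda>n. c / 2 < real (p n) / real n \<and> real (p n) / real n < c + 1) sequentially"
    using order_tendstoD(1)[OF ratio, of "c / 2"] order_tendstoD(2)[OF ratio, of "c + 1"] c
    by (intro eventually_conj) simp_all
  then have "eventually (\<lambda>n. 0 < n \<and> 0 < p n \<and> c / 2 * real n \<le> real (p n) \<and>
      real (p n) \<le> (c + 1) * real n) sequentially"
    using eventually_gt_at_top[of 0]
  proof eventually_elim
    case (elim n)
    then have "0 < real (p n) / real n" using c by linarith
    then have "0 < p n" by (simp add: zero_less_divide_iff)
    then show ?case using elim by (simp add: field_simps)
  qed
  then obtain N where N: "\<And>n. N \<le> n \<Longrightarrow> 0 < n \<and> 0 < p n \<and> c / 2 * real n \<le> real (p n) \<and>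
      real (p n) \<le> (c + 1) * real n"
    by (auto simp: eventually_sequentially)
  note N1 = N[THEN conjunct1] and N2 = N[THEN conjunct2, THEN conjunct1]
    and N3 = N[THEN conjunct2, THEN conjunct2, THEN conjunct1]
    and N4 = N[THEN conjunct2, THEN conjunct2, THEN conjunct2]
  \<comment> \<open>The law is recovered from an actual entry, so an index is chosen at which the
    matrix is nonempty.\<close>
  interpret standardized_law L
  proof (rule standardized_lawI[OF prob iid_Z, of N "(0, 0)" \<delta>])
    show "integrable M (\<lambda>\<omega>. \<bar>(case (0, 0) of (i, j) \<Rightarrow> Z N i j) \<omega>\<bar> powr (4 + \<delta>))"
      using moment_Z[of N 0 0] N1[of N] N2[of N] by simp
  qed (use N1[of N] N2[of N] \<delta> in auto)
  define w where "w n i j = (if i < n \<and> j < p n then \<gamma> n i j / sqrt (real n) else 0)" for n i j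
  define B where "B n \<omega> j = res_form lam (p n) (map (wcols (w n) (\<lambda>i j. Z n i j \<omega>)) [0..<n]) (unit_fun j) (unit_fun j)"
    for n \<omega> j
  define f where "f n \<omega> = (\<Sum>j<p n. 1 / real (p n) * B n \<omega> j)" for n \<omega>
  define t where "t n = (\<Sum>j<p n. 1 / real (p n) * Re (T n j (- complex_of_real lam)))" for n
  define S where "S = \<gamma>max\<^sup>2 * (c + 2) / lam"
  define \<eta> where "\<eta> n = 2 * (\<gamma>max\<^sup>2 / real n / lam\<^sup>2 *
      ((sqrt (2 * moment 4 * (c + 2)) + 3 * sqrt (c + 2)) * sqrt (real n) + 1)) * lam * (1 + S)" for n
  define r where "r n = ((1 + \<eta> n) / (1 - \<eta> n * S) - 1) / lam" for n
  have ind: "M.indep_vars (\<lambda>_. borel) (\<lambda>(i, j). Z n i j) ({..<n} \<times> {..<p n})"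
    and law: "\<And>i j. i < n \<Longrightarrow> j < p n \<Longrightarrow> distr M borel (Z n i j) = L" if "N \<le> n" for n
    using iid_Z[of n] N1[OF that] unfolding iid_standardized_def by auto
  have wz: "w n i j = 0" if "\<not> (i < n \<and> j < p n)" for n i j
    using that by (simp only: w_def if_False)
  note tr = trace_tail[where Z = "Z n" and w = "w n" and k = n and m = "p n" and l = lam for n,
      OF prob ind law N1 N2 wz lam, folded B_def, folded f_def]
  have f_meas: "f n \<in> borel_measurable M" if "N \<le> n" for n
    using tr(1)[of n 1] that by simp
  have f_mean: "M.expectation (f n) = (\<Sum>j<p n. 1 / real (p n) * (\<integral>\<omega>. B n \<omega> j \<partial>M))" if "N \<le> n" for n
    using tr(2)[of n 1] that by simp
  have f_tail: "measure M {\<omega> \<in> space M. \<epsilon> \<le> \<bar>f n \<omega> - M.expectation (f n)\<bar>}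
      \<le> 2 * exp (- \<epsilon>\<^sup>2 / (2 * (real n * (1 / real (p n) / lam)\<^sup>2)))" if "N \<le> n" "0 < \<epsilon>" for n \<epsilon>
    using tr(3)[of n \<epsilon>] that by simp
  have conc: "AE \<omega> in M. (\<lambda>n. f n \<omega> - M.expectation (f n)) \<longlonglongrightarrow> 0"
  proof (rule M.AE_tendsto_of_summable_tails[where N = N])
    show "(\<lambda>\<omega>. f n \<omega> - M.expectation (f n)) \<in> borel_measurable M" if "N \<le> n" for n
      using f_meas[OF that] by measurable
    fix \<epsilon> :: real assume \<epsilon>: "0 < \<epsilon>"
    \<comment> \<open>The exponent of the tail is \<epsilon>^2 lam^2 p^2 / (2 n); with p \<ge> c n /
      2 it is at least n a, so the tails are dominated by a geometric series.\<close>
    define a where "a = \<epsilon>\<^sup>2 * lam\<^sup>2 * c\<^sup>2 / 8"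
    have a: "0 < a" using \<epsilon> lam c by (simp add: a_def)
    have "summable (\<lambda>n. 2 * exp (- a) ^ n)"
      using a by (intro summable_mult summable_geometric) auto
    moreover have "measure M {\<omega> \<in> space M. \<epsilon> \<le> \<bar>f n \<omega> - M.expectation (f n)\<bar>} \<le> 2 * exp (- a) ^ n"
      if n: "N \<le> n" for n
    proof -
      have np: "0 < real n" "0 < real (p n)" using N1[OF n] N2[OF n] by auto
      have "(c / 2 * real n)\<^sup>2 \<le> (real (p n))\<^sup>2"
        using N3[OF n] c by (intro power_mono) auto
      then have "\<epsilon>\<^sup>2 * lam\<^sup>2 * (c / 2 * real n)\<^sup>2 / (2 * real n) \<le> \<epsilon>\<^sup>2 * lam\<^sup>2 * (real (p n))\<^sup>2 / (2 * real n)"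
        by (intro divide_right_mono mult_left_mono) auto
      moreover have "\<epsilon>\<^sup>2 * lam\<^sup>2 * (c / 2 * real n)\<^sup>2 / (2 * real n) = real n * a"
        using np by (simp add: a_def power2_eq_square)
      moreover have "\<epsilon>\<^sup>2 / (2 * (real n * (1 / real (p n) / lam)\<^sup>2)) = \<epsilon>\<^sup>2 * lam\<^sup>2 * (real (p n))\<^sup>2 / (2 * real n)"
        using np lam by (simp add: power_divide power_mult_distrib)
      ultimately have "exp (- \<epsilon>\<^sup>2 / (2 * (real n * (1 / real (p n) / lam)\<^sup>2))) \<le> exp (real n * (- a))"
        by simp
      also have "\<dots> = exp (- a) ^ n" by (rule exp_of_nat_mult)
      finally show ?thesis using f_tail[OF n \<epsilon>] by linarith
    qed
    ultimately show "\<exists>a. summable a \<and> eventually (\<lambda>n. measure M {\<omega> \<in> space M.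
        \<epsilon> \<le> \<bar>f n \<omega> - M.expectation (f n)\<bar>} \<le> a n) sequentially"
      unfolding eventually_sequentially by blast
  qed
  have \<eta>_lim: "\<eta> \<longlonglongrightarrow> 0"
  proof -
    define C where "C = sqrt (2 * moment 4 * (c + 2)) + 3 * sqrt (c + 2)"
    have i1: "(\<lambda>n. 1 / real n) \<longlonglongrightarrow> 0" by (rule lim_1_over_n)
    have i2: "(\<lambda>n. sqrt (1 / real n)) \<longlonglongrightarrow> 0"
      using tendsto_real_sqrt[OF i1] by simp
    have lim: "(\<lambda>n. 2 * \<gamma>max\<^sup>2 / lam\<^sup>2 * lam * (1 + S) * (C * sqrt (1 / real n) + 1 / real n))
        \<longlonglongrightarrow> 2 * \<gamma>max\<^sup>2 / lam\<^sup>2 * lam * (1 + S) * (C * 0 + 0)"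
      by (intro tendsto_intros i1 i2)
    have "\<eta> n = 2 * \<gamma>max\<^sup>2 / lam\<^sup>2 * lam * (1 + S) * (C * sqrt (1 / real n) + 1 / real n)" for n
    proof -
      have "sqrt (1 / real n) = sqrt (real n) / real n"
        by (cases "n = 0") (simp_all add: real_sqrt_divide frac_eq_eq)
      then show ?thesis by (simp add: \<eta>_def C_def algebra_simps add_divide_distrib)
    qed
    from this[abs_def] show ?thesis using lim by simp
  qed
  have r_lim: "r \<longlonglongrightarrow> 0"
  proof -
    have "r \<longlonglongrightarrow> ((1 + 0) / (1 - 0 * S) - 1) / lam"
      unfolding r_def by (intro tendsto_intros \<eta>_lim) (use lam in auto)
    then show ?thesis by simp
  qed
  have mean: "eventually (\<lambda>n. \<bar>M.expectation (f n) - t n\<bar> \<le> r n) sequentially"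
  proof -
    have "eventually (\<lambda>n. \<eta> n < 1) sequentially"
      using order_tendstoD(2)[OF \<eta>_lim] by simp
    moreover have "(\<lambda>n. \<eta> n * S) \<longlonglongrightarrow> 0"
      using tendsto_mult_right[OF \<eta>_lim, of S] by simp
    then have "eventually (\<lambda>n. \<eta> n * S < 1) sequentially"
      by (rule order_tendstoD(2)) simp
    ultimately show ?thesis
      using eventually_ge_at_top[of N]
    proof eventually_elim
      case (elim n)
      \<comment> \<open>The bound is uniform in \<open>j\<close>, so averaging over the diagonal
        preserves it.\<close>
      have close: "\<bar>(\<integral>\<omega>. B n \<omega> j \<partial>M) - Re (T n j (- complex_of_real lam))\<bar> \<le> r n" if "j < p n" for j
        unfolding B_def r_def
        using mean_resolvent_close[OF prob ind[OF elim(3)] law[OF elim(3)] N1[OF elim(3)] N2[OF elim(3)]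
            N4[OF elim(3)] c lam \<gamma>max less_imp_le[OF bound_\<gamma>] system,
            folded S_def, folded w_def \<eta>_def] elim N1[OF elim(3)] that
        by simp
      have "\<bar>M.expectation (f n) - t n\<bar> = \<bar>\<Sum>j<p n. 1 / real (p n) *
          ((\<integral>\<omega>. B n \<omega> j \<partial>M) - Re (T n j (- complex_of_real lam)))\<bar>"
        by (simp only: f_mean[OF elim(3)] t_def right_diff_distrib sum_subtractf)
      also have "\<dots> \<le> (\<Sum>j<p n. \<bar>1 / real (p n) *
          ((\<integral>\<omega>. B n \<omega> j \<partial>M) - Re (T n j (- complex_of_real lam)))\<bar>)"
        by (rule sum_abs)
      also have "\<dots> \<le> (\<Sum>j<p n. 1 / real (p n) * r n)"
        using close by (intro sum_mono) (simp add: abs_mult divide_right_mono)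
      also have "\<dots> = r n" using N2[OF elim(3)] by simp
      finally show ?case .
    qed
  qed
  have diff: "cmod (complex_of_real (df1_hat n (p n) (\<gamma> n) (\<lambda>i j. Z n i j \<omega>) lam) -
      df1 (p n) (Sigma_mean M n (p n) (\<gamma> n) (Z n)) (kappa n (\<gamma> n) (T' n) lam)) = lam * \<bar>f n \<omega> - t n\<bar>"
    if n: "N \<le> n" for n \<omega>
  proof -
    have "1 \<le> n" using N1[OF n] by simp
    have hat: "df1_hat n (p n) (\<gamma> n) (\<lambda>i j. Z n i j \<omega>) lam = 1 - lam * f n \<omega>"
      unfolding f_def B_def
      by (rule df1_hat_eq[OF lam N1[OF n] N2[OF n]]) (simp add: wcols_def w_def)
    have det: "df1 (p n) (Sigma_mean M n (p n) (\<gamma> n) (Z n)) (kappa n (\<gamma> n) (T' n) lam)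
        = complex_of_real (1 - lam * t n)"
      unfolding t_def
      by (rule df1_eq[OF system[OF \<open>1 \<le> n\<close>] lam N1[OF n] N2[OF n]
            Sigma_mean_eq_diag[OF prob iid_Z[OF \<open>1 \<le> n\<close>]]])
    have "complex_of_real (1 - lam * f n \<omega>) - complex_of_real (1 - lam * t n)
        = complex_of_real (lam * (t n - f n \<omega>))"
      by (simp add: algebra_simps)
    then show ?thesis unfolding hat det
      using lam by (simp only: norm_of_real) (simp add: abs_mult abs_minus_commute)
  qed
  from conc show ?thesis
  proof eventually_elim
    case (elim \<omega>)
    have lim: "(\<lambda>n. lam * (\<bar>f n \<omega> - M.expectation (f n)\<bar> + r n)) \<longlonglongrightarrow> 0"
      using tendsto_mult_left[OF tendsto_add[OF tendsto_rabs_zero[OF elim] r_lim], of lam] by simp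
    show ?case
    proof (rule tendsto_sandwich[OF _ _ tendsto_const lim])
      show "eventually (\<lambda>n. 0 \<le> cmod (complex_of_real (df1_hat n (p n) (\<gamma> n) (\<lambda>i j. Z n i j \<omega>) lam) -
          df1 (p n) (Sigma_mean M n (p n) (\<gamma> n) (Z n)) (kappa n (\<gamma> n) (T' n) lam))) sequentially"
        by simp
      show "eventually (\<lambda>n. cmod (complex_of_real (df1_hat n (p n) (\<gamma> n) (\<lambda>i j. Z n i j \<omega>) lam) -
          df1 (p n) (Sigma_mean M n (p n) (\<gamma> n) (Z n)) (kappa n (\<gamma> n) (T' n) lam))
          \<le> lam * (\<bar>f n \<omega> - M.expectation (f n)\<bar> + r n)) sequentially"
        using mean eventually_ge_at_top[of N]
      proof eventually_elim
        case (elim n)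
        then show ?case unfolding diff[OF elim(2)] using lam
          by (intro mult_left_mono) linarith+
      qed
    qed
  qed
qed

end
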